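(* Fix $1<\alpha<\beta$, let $I_1=[0,1]$, $I_2=[\alpha,\beta]$, let $\phi,\psi,\theta\in\mathbb{R}$, and let $P_B$ be the selfadjoint restriction of the maximal momentum operator associated with the matrix $B=B(w,\phi,\psi,\theta)$ with $w=1$. Then $P_B$ has pure point spectrum $\Lambda_1\cup\Lambda_2$, where $$\Lambda_1=-\phi+\mathbb{Z},\qquad \Lambda_2=\frac{\phi-\theta}{\beta-\alpha}+\frac{1}{\beta-\alpha}\mathbb{Z},$$ and corresponding eigenfunctions are, for $n\in\mathbb{Z}$, $$\chi_{[0,1]}\,e_{-\phi+n}\quad\text{and}\quad \chi_{[\alpha,\beta]}\,e_{\frac{\phi-\theta+n}{\beta-\alpha}}.$$ Consequently, each eigenvalue has multiplicity one, except that the eigenvalues, if any, in $\Lambda_1\cap\Lambda_2$ have multiplicity two.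
   Context: $e(x):=e^{i2\pi x}$ and $e_x(y):=e(xy)$; $\chi_S$ is the indicator function of $S$. The maximal momentum operator is $P=\frac{1}{i2\pi}\frac{d}{dt}$ on $L^2(I_1\cup I_2)$, with domain $\mathscr{D}(P)$ the absolutely continuous functions $f$ on $I_1\cup I_2$ with $f'\in L^2(I_1\cup I_2)$. For $0\le w\le 1$ and $\phi,\psi,\theta\in\mathbb{R}$, $$B=B(w,\phi,\psi,\theta)=\begin{pmatrix} w\,e(\phi) & -\sqrt{1-w^2}\,e(\theta-\psi)\\ \sqrt{1-w^2}\,e(\psi) & w\,e(\theta-\phi)\end{pmatrix},$$ and $P_B$ is the restriction of $P$ to $\mathscr{D}(P_B)=\{f\in\mathscr{D}(P) : B\,(f(1),f(\beta))^T=(f(0),f(\alpha))^T\}$. *)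

theory Defs
  imports "HOL-Analysis.Analysis"
begin

section \<open>The Hilbert space of square-integrable functions on a set of reals\<close>

text \<open>Elements of \<open>L\<^sup>2(S)\<close> are handled through representatives \<open>real \<Rightarrow> complex\<close>, of which only the
  values on \<open>S\<close> matter, with equality almost everywhere on \<open>S\<close> in place of equality of classes.\<close>

definition L2 :: "real set \<Rightarrow> (real \<Rightarrow> complex) set" where
  "L2 S = {f. f \<in> borel_measurable (lebesgue_on S) \<and> integrable (lebesgue_on S) (\<lambda>t. (cmod (f t))\<^sup>2)}"

definition ae_eq :: "real set \<Rightarrow> (real \<Rightarrow> complex) \<Rightarrow> (real \<Rightarrow> complex) \<Rightarrow> bool" where
  "ae_eq S f g \<longleftrightarrow> (AE t in lebesgue_on S. f t = g t)"

definition L2_inner :: "real set \<Rightarrow> (real \<Rightarrow> complex) \<Rightarrow> (real \<Rightarrow> complex) \<Rightarrow> complex" where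
  "L2_inner S f g = integral\<^sup>L (lebesgue_on S) (\<lambda>t. f t * cnj (g t))"

definition L2_norm :: "real set \<Rightarrow> (real \<Rightarrow> complex) \<Rightarrow> real" where
  "L2_norm S f = sqrt (integral\<^sup>L (lebesgue_on S) (\<lambda>t. (cmod (f t))\<^sup>2))"


section \<open>Unbounded operators\<close>

text \<open>An operator in \<open>L\<^sup>2(S)\<close> is represented by its graph, a set of pairs of representatives that is
  closed under equality almost everywhere.  The graph below is that of the operator acting as \<open>A\<close>
  on the classes of the functions in \<open>D\<close>.\<close>

type_synonym l2_op = "((real \<Rightarrow> complex) \<times> (real \<Rightarrow> complex)) set"

definition operator_graph ::
    "real set \<Rightarrow> (real \<Rightarrow> complex) set \<Rightarrow> ((real \<Rightarrow> complex) \<Rightarrow> (real \<Rightarrow> complex)) \<Rightarrow> l2_op" where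
  "operator_graph S D A =
     {(f, g). f \<in> L2 S \<and> g \<in> L2 S \<and> (\<exists>F\<in>D. ae_eq S f F \<and> ae_eq S g (A F))}"

definition densely_defined :: "real set \<Rightarrow> l2_op \<Rightarrow> bool" where
  "densely_defined S T \<longleftrightarrow> (\<forall>h\<in>L2 S. \<forall>\<epsilon>>0. \<exists>(f, g)\<in>T. L2_norm S (\<lambda>t. h t - f t) < \<epsilon>)"

definition adjoint_graph :: "real set \<Rightarrow> l2_op \<Rightarrow> l2_op" where
  "adjoint_graph S T =
     {(g, h). g \<in> L2 S \<and> h \<in> L2 S \<and> (\<forall>(f, f')\<in>T. L2_inner S f' g = L2_inner S f h)}"

definition selfadjoint :: "real set \<Rightarrow> l2_op \<Rightarrow> bool" where
  "selfadjoint S T \<longleftrightarrow> densely_defined S T \<and> adjoint_graph S T = T"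

text \<open>\<open>T - z\<close> is onto \<open>L\<^sup>2(S)\<close> and has a bounded inverse; the bound includes injectivity.\<close>

definition resolvent_set :: "real set \<Rightarrow> l2_op \<Rightarrow> complex set" where
  "resolvent_set S T =
     {z. (\<forall>h\<in>L2 S. \<exists>(f, g)\<in>T. ae_eq S (\<lambda>t. g t - z * f t) h) \<and>
         (\<exists>C. \<forall>(f, g)\<in>T. L2_norm S f \<le> C * L2_norm S (\<lambda>t. g t - z * f t))}"

definition spectrum :: "real set \<Rightarrow> l2_op \<Rightarrow> complex set" where
  "spectrum S T = - resolvent_set S T"

definition eigenspace :: "l2_op \<Rightarrow> complex \<Rightarrow> (real \<Rightarrow> complex) set" where
  "eigenspace T z = {f. (f, \<lambda>t. z * f t) \<in> T}"

definition eigenfunction :: "real set \<Rightarrow> l2_op \<Rightarrow> complex \<Rightarrow> (real \<Rightarrow> complex) \<Rightarrow> bool" where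
  "eigenfunction S T z f \<longleftrightarrow> f \<in> eigenspace T z \<and> \<not> ae_eq S f (\<lambda>t. 0)"

definition point_spectrum :: "real set \<Rightarrow> l2_op \<Rightarrow> complex set" where
  "point_spectrum S T = {z. \<exists>f. eigenfunction S T z f}"

text \<open>The eigenspace of \<open>z\<close>, modulo equality almost everywhere, has a basis of \<open>n\<close> elements: every
  member has exactly one coefficient vector.\<close>

definition has_multiplicity :: "real set \<Rightarrow> l2_op \<Rightarrow> complex \<Rightarrow> nat \<Rightarrow> bool" where
  "has_multiplicity S T z n \<longleftrightarrow>
     (\<exists>b :: nat \<Rightarrow> real \<Rightarrow> complex. (\<forall>k<n. b k \<in> eigenspace T z) \<and>
        (\<forall>f\<in>eigenspace T z. \<exists>!c :: nat \<Rightarrow> complex.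
           (\<forall>k\<ge>n. c k = 0) \<and> ae_eq S f (\<lambda>t. \<Sum>k<n. c k * b k t)))"

text \<open>The linear span of the eigenfunctions is dense in \<open>L\<^sup>2(S)\<close>.\<close>

definition eigenfunctions_total :: "real set \<Rightarrow> l2_op \<Rightarrow> bool" where
  "eigenfunctions_total S T \<longleftrightarrow>
     (\<forall>h\<in>L2 S. \<forall>\<epsilon>>0. \<exists>(n::nat) (c :: nat \<Rightarrow> complex) (b :: nat \<Rightarrow> real \<Rightarrow> complex).
        (\<forall>k<n. \<exists>z. eigenfunction S T z (b k)) \<and>
        L2_norm S (\<lambda>t. h t - (\<Sum>k<n. c k * b k t)) < \<epsilon>)"

definition has_pure_point_spectrum :: "real set \<Rightarrow> l2_op \<Rightarrow> real set \<Rightarrow> bool" where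
  "has_pure_point_spectrum S T \<Lambda> \<longleftrightarrow>
     spectrum S T = complex_of_real ` \<Lambda> \<and> point_spectrum S T = complex_of_real ` \<Lambda> \<and>
     eigenfunctions_total S T"


section \<open>The momentum operator on two intervals\<close>

text \<open>The usual \<open>\<epsilon>\<close>-\<open>\<delta>\<close> notion: \<open>d\<close> is a finite family of non-overlapping compact intervals contained
  in \<open>S\<close>.  For a disjoint union of two compact intervals it is absolute continuity on each of them.\<close>

definition absolutely_continuous_on :: "real set \<Rightarrow> (real \<Rightarrow> complex) \<Rightarrow> bool" where
  "absolutely_continuous_on S f \<longleftrightarrow>
     (\<forall>\<epsilon>>0. \<exists>\<delta>>0. \<forall>d. d division_of \<Union>d \<and> \<Union>d \<subseteq> S \<and> (\<Sum>K\<in>d. Sup K - Inf K) < \<delta> \<longrightarrow>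
        (\<Sum>K\<in>d. cmod (f (Sup K) - f (Inf K))) < \<epsilon>)"

definition momentum_domain :: "real set \<Rightarrow> (real \<Rightarrow> complex) set" where
  "momentum_domain S = {f. absolutely_continuous_on S f \<and>
     (\<exists>f'\<in>L2 S. AE t in lebesgue_on S. (f has_vector_derivative f' t) (at t within S))}"

definition momentum :: "real set \<Rightarrow> (real \<Rightarrow> complex) \<Rightarrow> real \<Rightarrow> complex" where
  "momentum S f = (\<lambda>t. 1 / (\<i> * 2 * of_real pi) * vector_derivative f (at t within S))"

definition unit_exp :: "real \<Rightarrow> complex" where
  "unit_exp x = exp (\<i> * 2 * of_real pi * of_real x)"

definition boundary_matrix :: "real \<Rightarrow> real \<Rightarrow> real \<Rightarrow> real \<Rightarrow> complex^2^2" where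
  "boundary_matrix w \<phi> \<psi> \<theta> = vector
     [vector [of_real w * unit_exp \<phi>, - of_real (sqrt (1 - w\<^sup>2)) * unit_exp (\<theta> - \<psi>)],
      vector [of_real (sqrt (1 - w\<^sup>2)) * unit_exp \<psi>, of_real w * unit_exp (\<theta> - \<phi>)]]"

definition two_intervals :: "real \<Rightarrow> real \<Rightarrow> real set" where
  "two_intervals \<alpha> \<beta> = {0..1} \<union> {\<alpha>..\<beta>}"

definition P_domain :: "real \<Rightarrow> real \<Rightarrow> complex^2^2 \<Rightarrow> (real \<Rightarrow> complex) set" where
  "P_domain \<alpha> \<beta> B = {f \<in> momentum_domain (two_intervals \<alpha> \<beta>).
     B *v vector [f 1, f \<beta>] = vector [f 0, f \<alpha>]}"

definition P_op :: "real \<Rightarrow> real \<Rightarrow> complex^2^2 \<Rightarrow> l2_op" where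
  "P_op \<alpha> \<beta> B =
     operator_graph (two_intervals \<alpha> \<beta>) (P_domain \<alpha> \<beta> B) (momentum (two_intervals \<alpha> \<beta>))"

definition Lambda1 :: "real \<Rightarrow> real set" where
  "Lambda1 \<phi> = {- \<phi> + of_int n |n. True}"

definition Lambda2 :: "real \<Rightarrow> real \<Rightarrow> real \<Rightarrow> real \<Rightarrow> real set" where
  "Lambda2 \<alpha> \<beta> \<phi> \<theta> = {(\<phi> - \<theta>) / (\<beta> - \<alpha>) + 1 / (\<beta> - \<alpha>) * of_int n |n. True}"

end

theory Submission
  imports Defs
begin

text \<open>For \<open>w = 1\<close> the boundary matrix is diagonal, with entries \<open>e(\<phi>)\<close> and \<open>e(\<theta> - \<phi>)\<close> of modulus one.  Hence
  \<open>P\<close> decouples: on each of the two intervals it is \<open>F \<mapsto> F' / (2 \<pi> \<i>)\<close> with a quasi-periodic condition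
  \<open>F a = c * F b\<close>, where \<open>\<bar>c\<bar> = 1\<close>.  For square-integrable \<open>g\<close>, the
  predicate \<open>bvp a b c F g\<close> expresses that \<open>F\<close> lies in the domain
  on \<open>{a..b}\<close> and is mapped to \<open>g\<close>, and \<open>momentum_graph_iff\<close> describes the graph of \<open>P\<close> by two such
  problems with the same \<open>F\<close> and \<open>g\<close>.

  With \<open>wave z = e(z)\<close> for complex \<open>z\<close>, the integrating factor \<open>wave (- z * t)\<close> turns the equation
  \<open>F' = 2 \<pi> \<i> (z F + h)\<close> into a mere integration, and the boundary condition becomes one scalar linear
  equation for the initial value, with coefficient \<open>1 - c * wave (z * (b - a))\<close>.  If this number is
  nonzero, there is exactly one solution, and it is bounded in terms of \<open>h\<close> (\<open>bvp_solvable\<close>, \<open>bvp_L2_bound\<close>).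
  If it vanishes, the solutions for \<open>h = 0\<close> are the multiples of \<open>wave (z * t)\<close> (\<open>bvp_homogeneous\<close>).  On the
  two intervals it vanishes exactly for \<open>z\<close> in \<open>\<Lambda>\<^sub>1\<close> and in \<open>\<Lambda>\<^sub>2\<close> (\<open>resonance1\<close>, \<open>resonance2\<close>).  This yields the
  spectrum, the eigenspaces and, since each interval contributes at most one dimension, the
  multiplicities.

  Selfadjointness follows from symmetry (integration by parts, where the boundary terms cancel because
  of \<open>\<bar>c\<bar> = 1\<close>) together with surjectivity of \<open>P - \<i>\<close> and \<open>P + \<i>\<close>, which holds since \<open>\<Lambda>\<^sub>1\<close> and \<open>\<Lambda>\<^sub>2\<close> are real
  (\<open>selfadjointI\<close>).  The eigenfunctions are total because on each interval they are a fixed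
  exponential times all the exponentials of period \<open>b - a\<close>; by Stone--Weierstrass on the circle the
  span of the latter is uniformly dense in the continuous functions with equal values at the end
  points, and these are dense in \<open>L\<^sup>2\<close> (\<open>trig_polynomial_L2_dense\<close>).  Totality also shows that the domain
  of \<open>P\<close> is dense.

  All of this manipulates absolutely continuous functions through their integrals.  Two theorems of
  real analysis allow it: the indefinite integral of a square-integrable function is absolutely
  continuous with the expected derivative almost everywhere (\<open>ac_derivative_indefinite_integral\<close>), and
  an absolutely continuous function is recovered from its almost everywhere derivative by integration
  (\<open>fundamental_theorem_of_calculus_absolutely_continuous\<close>).\<close>

section \<open>Lebesgue differentiation\<close>

lemma AE_lebesgue_on_iff_negligible:
  fixes S :: "'a::euclidean_space set"
  assumes "S \<in> sets lebesgue"
  shows "(AE t in lebesgue_on S. P t) \<longleftrightarrow> (\<exists>N. negligible N \<and> (\<forall>t\<in>S - N. P t))"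
proof -
  have "(AE t in lebesgue_on S. P t) \<longleftrightarrow> (AE t in lebesgue. t \<in> S \<longrightarrow> P t)"
    using assms by (intro AE_restrict_space_iff) auto
  also have "\<dots> \<longleftrightarrow> (\<exists>N. negligible N \<and> {t. \<not> (t \<in> S \<longrightarrow> P t)} \<subseteq> N)"
    by (auto simp: eventually_ae_filter negligible_iff_null_sets)
  finally show ?thesis
    by blast
qed

lemma AE_interval_exists:
  assumes "a < b" "AE t in lebesgue_on {a..b}. Q t"
  obtains t :: real where "t \<in> {a..b}" "Q t"
proof -
  obtain N where N: "negligible N" "\<And>t. t \<in> {a..b} - N \<Longrightarrow> Q t"
    using assms(2) by (auto simp: AE_lebesgue_on_iff_negligible)
  have "\<not> negligible {a..b}"
    using \<open>a < b\<close> by (simp add: negligible_iff_measure)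
  then have "\<not> {a..b} \<subseteq> N" using N(1) negligible_subset by blast
  then show thesis using that N(2) by blast
qed

text \<open>The right-hand difference quotients of an indefinite integral converge almost everywhere by
  \<open>integrable_ccontinuous_explicit\<close>; the left-hand ones are right-hand ones of the reflected function.\<close>

lemma lebesgue_differentiation_interval:
  fixes f :: "real \<Rightarrow> 'b::euclidean_space"
  assumes f: "f integrable_on {a..b}"
  obtains N where "negligible N"
    "\<And>x. x \<in> {a..b} - N \<Longrightarrow>
       ((\<lambda>t. integral {a..t} f) has_vector_derivative f x) (at x within {a..b})"
proof -
  define g where "g x = (if x \<in> {a..b} then f x else 0)" for x
  have gU: "g integrable_on UNIV"
    unfolding g_def using f integrable_restrict_UNIV by blast
  then have g: "g integrable_on cbox u v" for u v
    by (rule integrable_on_subcbox) auto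
  have gm: "(\<lambda>x. g (- x)) integrable_on cbox u v" for u v
    using Henstock_Kurzweil_Integration.integrable_reflect_real[of g "-u" "-v"] g by simp
  obtain N1 where N1: "negligible N1"
    and D1: "\<And>x e. \<lbrakk>x \<notin> N1; 0 < e\<rbrakk> \<Longrightarrow>
      \<exists>d>0. \<forall>h. 0 < h \<and> h < d \<longrightarrow> norm (integral {x..x + h} g /\<^sub>R h - g x) < e"
    using integrable_ccontinuous_explicit[of g, OF g] by auto
  obtain N2 where N2: "negligible N2"
    and D2: "\<And>x e. \<lbrakk>x \<notin> N2; 0 < e\<rbrakk> \<Longrightarrow>
      \<exists>d>0. \<forall>h. 0 < h \<and> h < d \<longrightarrow>
        norm (integral {x..x + h} (\<lambda>x. g (- x)) /\<^sub>R h - g (- x)) < e"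
    using integrable_ccontinuous_explicit[of "\<lambda>x. g (- x)", OF gm] by auto
  show thesis
  proof
    have "negligible (uminus ` N2)"
      using N2 by (rule negligible_differentiable_image_negligible[rotated]) (auto intro!: differentiable_on_minus differentiable_on_ident)
    then show "negligible (N1 \<union> uminus ` N2 \<union> {a, b})"
      using N1 by (intro negligible_Un) auto
  next
    fix x assume x: "x \<in> {a..b} - (N1 \<union> uminus ` N2 \<union> {a, b})"
    then have xab: "a < x" "x < b" "x \<notin> N1" "- x \<notin> N2"
      using image_eqI[of x uminus "- x" N2] by auto
    have int_eq: "integral {u..v} g = integral {u..v} f" if "a \<le> u" "v \<le> b" for u v
      using that by (intro integral_cong) (auto simp: g_def)
    have incr: "integral {a..v} f - integral {a..u} f = integral {u..v} g"
      if "a \<le> u" "u \<le> v" "v \<le> b" for u v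
    proof -
      have "f integrable_on {a..v}"
        using f by (rule integrable_on_subinterval) (use that in auto)
      from Henstock_Kurzweil_Integration.integral_combine[OF that(1,2) this] show ?thesis
        using that by (simp add: int_eq algebra_simps)
    qed
    show "((\<lambda>t. integral {a..t} f) has_vector_derivative f x) (at x within {a..b})"
      unfolding has_vector_derivative_def has_derivative_within_alt
    proof (intro conjI allI impI)
      show "bounded_linear (\<lambda>y. y *\<^sub>R f x)"
        by (rule bounded_linear_scaleR_left)
      fix e :: real assume "e > 0"
      obtain d1 where d1: "d1 > 0" "\<And>h. \<lbrakk>0 < h; h < d1\<rbrakk> \<Longrightarrow>
          norm (integral {x..x + h} g /\<^sub>R h - g x) < e"
        using D1[OF xab(3) \<open>e > 0\<close>] by blast
      obtain d2 where d2: "d2 > 0" "\<And>h. \<lbrakk>0 < h; h < d2\<rbrakk> \<Longrightarrow>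
          norm (integral {- x..- x + h} (\<lambda>x. g (- x)) /\<^sub>R h - g x) < e"
        using D2[OF xab(4) \<open>e > 0\<close>] by auto
      have gx: "g x = f x"
        using xab by (simp add: g_def)
      show "\<exists>d>0. \<forall>y\<in>{a..b}. norm (y - x) < d \<longrightarrow>
          norm (integral {a..y} f - integral {a..x} f - (y - x) *\<^sub>R f x) \<le> e * norm (y - x)"
      proof (intro exI[of _ "min d1 d2"] conjI ballI impI)
        show "min d1 d2 > 0" using d1 d2 by simp
        fix y assume y: "y \<in> {a..b}" "norm (y - x) < min d1 d2"
        have scale: "norm (I - h *\<^sub>R f x) \<le> e * h"
          if "norm (I /\<^sub>R h - g x) < e" "h > 0" for I h
        proof -
          have "I - h *\<^sub>R f x = h *\<^sub>R (I /\<^sub>R h - g x)"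
            using \<open>h > 0\<close> by (simp add: gx scaleR_right_diff_distrib)
          then have "norm (I - h *\<^sub>R f x) = h * norm (I /\<^sub>R h - g x)"
            using \<open>h > 0\<close> by simp
          also have "\<dots> \<le> h * e"
            using that by (intro mult_left_mono) auto
          finally show ?thesis by (simp add: mult.commute)
        qed
        consider "y = x" | "y > x" | "y < x" by linarith
        then show "norm (integral {a..y} f - integral {a..x} f - (y - x) *\<^sub>R f x) \<le> e * norm (y - x)"
        proof cases
          case 2
          then have "norm (integral {x..x + (y - x)} g /\<^sub>R (y - x) - g x) < e"
            using y by (intro d1(2)) auto
          from scale[OF this] 2 y xab show ?thesis
            by (simp add: incr)
        next
          case 3
          have "integral {- x..- x + (x - y)} (\<lambda>x. g (- x)) = integral {y..x} g"
            using Henstock_Kurzweil_Integration.integral_reflect_real[of x y g] by simp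
          moreover have "norm (integral {- x..- x + (x - y)} (\<lambda>x. g (- x)) /\<^sub>R (x - y) - g x) < e"
            using 3 y by (intro d2(2)) auto
          ultimately have "norm (integral {y..x} g - (x - y) *\<^sub>R f x) \<le> e * (x - y)"
            using scale[where I = "integral {y..x} g" and h = "x - y"] 3 by simp
          moreover have eq: "integral {a..y} f - integral {a..x} f - (y - x) *\<^sub>R f x
              = - (integral {y..x} g - (x - y) *\<^sub>R f x)"
            using 3 y xab incr[of y x] by (simp add: algebra_simps)
          ultimately show ?thesis
            unfolding eq norm_minus_cancel using 3 by simp
        qed auto
      qed
    qed
  qed
qed

section \<open>Absolutely continuous functions\<close>

lemma division_of_real_interval:
  fixes d :: "real set set"
  assumes "d division_of T" "K \<in> d"
  obtains u v where "K = {u..v}" "u \<le> v" "Inf K = u" "Sup K = v"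
proof -
  obtain u v where "K = cbox u v" using assms by blast
  moreover have "K \<noteq> {}" using assms by blast
  ultimately show thesis using that[of u v] by simp
qed

lemma sum_length_division:
  fixes d :: "real set set"
  assumes "d division_of T"
  shows "(\<Sum>K\<in>d. Sup K - Inf K) = measure lebesgue T"
proof -
  have "(\<Sum>K\<in>d. Sup K - Inf K) = (\<Sum>K\<in>d. measure lebesgue K)"
  proof (rule sum.cong)
    fix K assume "K \<in> d"
    then obtain u v where "K = {u..v}" "u \<le> v" "Inf K = u" "Sup K = v"
      by (rule division_of_real_interval[OF assms])
    then show "Sup K - Inf K = measure lebesgue K" by simp
  qed simp
  also have "\<dots> = measure lebesgue T"
    by (rule content_division[OF assms])
  finally show ?thesis .
qed

lemma absolutely_continuous_onD:
  assumes "absolutely_continuous_on S f" "\<epsilon> > 0"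
  obtains \<delta> where "\<delta> > 0"
    "\<And>d. \<lbrakk>d division_of \<Union>d; \<Union>d \<subseteq> S; (\<Sum>K\<in>d. Sup K - Inf K) < \<delta>\<rbrakk> \<Longrightarrow>
       (\<Sum>K\<in>d. cmod (f (Sup K) - f (Inf K))) < \<epsilon>"
  using assms unfolding absolutely_continuous_on_def by meson

lemma absolutely_continuous_on_subset:
  "absolutely_continuous_on S f \<Longrightarrow> T \<subseteq> S \<Longrightarrow> absolutely_continuous_on T f"
  unfolding absolutely_continuous_on_def by (meson order_trans)

text \<open>A common source of closure properties: the increments of \<open>h\<close> over the intervals of a division are
  summed and compared with those of \<open>f\<close> and \<open>g\<close>.\<close>

lemma absolutely_continuous_on_dominated:
  assumes f: "absolutely_continuous_on {a..b} f" and g: "absolutely_continuous_on {a..b} g"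
    and h: "\<And>u v. \<lbrakk>a \<le> u; u \<le> v; v \<le> b\<rbrakk> \<Longrightarrow>
              cmod (h v - h u) \<le> M * (cmod (f v - f u) + cmod (g v - g u))"
  shows "absolutely_continuous_on {a..b} h"
  unfolding absolutely_continuous_on_def
proof (intro allI impI)
  fix e :: real assume e: "e > 0"
  \<comment> \<open>A positive constant is needed to divide by.\<close>
  define M' where "M' = max M 1"
  have M': "M' > 0" "M \<le> M'" by (auto simp: M'_def)
  obtain d1 where d1: "d1 > 0" "\<And>d. \<lbrakk>d division_of \<Union>d; \<Union>d \<subseteq> {a..b}; (\<Sum>K\<in>d. Sup K - Inf K) < d1\<rbrakk> \<Longrightarrow>
       (\<Sum>K\<in>d. cmod (f (Sup K) - f (Inf K))) < e / (2 * M')"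
    by (rule absolutely_continuous_onD[OF f, of "e / (2 * M')"]) (use e M' in auto)
  obtain d2 where d2: "d2 > 0" "\<And>d. \<lbrakk>d division_of \<Union>d; \<Union>d \<subseteq> {a..b}; (\<Sum>K\<in>d. Sup K - Inf K) < d2\<rbrakk> \<Longrightarrow>
       (\<Sum>K\<in>d. cmod (g (Sup K) - g (Inf K))) < e / (2 * M')"
    by (rule absolutely_continuous_onD[OF g, of "e / (2 * M')"]) (use e M' in auto)
  show "\<exists>\<delta>>0. \<forall>d. d division_of \<Union> d \<and> \<Union> d \<subseteq> {a..b} \<and> (\<Sum>K\<in>d. Sup K - Inf K) < \<delta> \<longrightarrow>
          (\<Sum>K\<in>d. cmod (h (Sup K) - h (Inf K))) < e"
  proof (intro exI[of _ "min d1 d2"] conjI allI impI)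
    show "min d1 d2 > 0" using d1 d2 by simp
    fix d assume "d division_of \<Union> d \<and> \<Union> d \<subseteq> {a..b} \<and> (\<Sum>K\<in>d. Sup K - Inf K) < min d1 d2"
    then have d: "d division_of \<Union> d" "\<Union> d \<subseteq> {a..b}" "(\<Sum>K\<in>d. Sup K - Inf K) < min d1 d2" by auto
    have "(\<Sum>K\<in>d. cmod (h (Sup K) - h (Inf K)))
        \<le> (\<Sum>K\<in>d. M' * (cmod (f (Sup K) - f (Inf K)) + cmod (g (Sup K) - g (Inf K))))"
    proof (rule sum_mono)
      fix K assume K: "K \<in> d"
      obtain u v where uv: "K = {u..v}" "u \<le> v" "Inf K = u" "Sup K = v"
        by (rule division_of_real_interval[OF d(1) K])
      have "K \<subseteq> {a..b}" using K d(2) by blast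
      then have "a \<le> u" "v \<le> b" using uv by auto
      then have "cmod (h v - h u) \<le> M * (cmod (f v - f u) + cmod (g v - g u))"
        using h uv by blast
      also have "\<dots> \<le> M' * (cmod (f v - f u) + cmod (g v - g u))"
        using M' by (intro mult_right_mono) auto
      finally show "cmod (h (Sup K) - h (Inf K))
          \<le> M' * (cmod (f (Sup K) - f (Inf K)) + cmod (g (Sup K) - g (Inf K)))"
        using uv by simp
    qed
    also have "\<dots> = M' * ((\<Sum>K\<in>d. cmod (f (Sup K) - f (Inf K))) + (\<Sum>K\<in>d. cmod (g (Sup K) - g (Inf K))))"
      by (simp add: sum_distrib_left sum.distrib algebra_simps)
    also have "\<dots> < M' * (e / (2 * M') + e / (2 * M'))"
      using d d1(2)[of d] d2(2)[of d] M' by (intro mult_strict_left_mono add_strict_mono) auto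
    also have "\<dots> = e" using M' by simp
    finally show "(\<Sum>K\<in>d. cmod (h (Sup K) - h (Inf K))) < e" .
  qed
qed

lemma absolutely_continuous_on_imp_continuous_on:
  assumes f: "absolutely_continuous_on {a..b} f"
  shows "continuous_on {a..b} f"
  unfolding continuous_on_iff
proof (intro ballI allI impI)
  fix x e :: real assume x: "x \<in> {a..b}" and "e > 0"
  obtain \<delta> where \<delta>: "\<delta> > 0" "\<And>d. \<lbrakk>d division_of \<Union>d; \<Union>d \<subseteq> {a..b}; (\<Sum>K\<in>d. Sup K - Inf K) < \<delta>\<rbrakk> \<Longrightarrow>
       (\<Sum>K\<in>d. cmod (f (Sup K) - f (Inf K))) < e"
    by (rule absolutely_continuous_onD[OF f \<open>e > 0\<close>]) auto
  have *: "cmod (f v - f u) < e" if "u \<le> v" "a \<le> u" "v \<le> b" "v - u < \<delta>" for u v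
  proof -
    have "{{u..v}} division_of {u..v}"
      using division_of_self[of u v] \<open>u \<le> v\<close> by simp
    then show ?thesis
      using \<delta>(2)[of "{{u..v}}"] that by simp
  qed
  show "\<exists>d>0. \<forall>x'\<in>{a..b}. dist x' x < d \<longrightarrow> dist (f x') (f x) < e"
  proof (intro exI[of _ \<delta>] conjI \<delta>(1) ballI impI)
    fix y assume y: "y \<in> {a..b}" "dist y x < \<delta>"
    show "dist (f y) (f x) < e"
      using *[of x y] *[of y x] x y
      by (cases "x \<le> y") (auto simp: dist_norm norm_minus_commute)
  qed
qed

lemma absolutely_continuous_on_mult:
  assumes f: "absolutely_continuous_on {a..b} f" and g: "absolutely_continuous_on {a..b} g"
  shows "absolutely_continuous_on {a..b} (\<lambda>t. f t * g t)"
proof -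
  have "bounded (f ` {a..b})" "bounded (g ` {a..b})"
    using f g absolutely_continuous_on_imp_continuous_on compact_continuous_image
      compact_imp_bounded compact_Icc by blast+
  then obtain A B where A: "\<And>t. t \<in> {a..b} \<Longrightarrow> cmod (f t) \<le> A"
    and B: "\<And>t. t \<in> {a..b} \<Longrightarrow> cmod (g t) \<le> B"
    unfolding bounded_iff by (metis imageI)
  show ?thesis
  proof (rule absolutely_continuous_on_dominated[OF f g])
    fix u v assume uv: "a \<le> u" "u \<le> v" "v \<le> b"
    have "f v * g v - f u * g u = (f v - f u) * g v + f u * (g v - g u)"
      by (simp add: algebra_simps)
    then have "cmod (f v * g v - f u * g u) \<le> cmod (f v - f u) * cmod (g v) + cmod (f u) * cmod (g v - g u)"
      by (metis norm_mult norm_triangle_ineq)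
    also have "\<dots> \<le> cmod (f v - f u) * max A B + max A B * cmod (g v - g u)"
      using A[of u] B[of v] uv by (intro add_mono mult_left_mono mult_right_mono) auto
    finally show "cmod (f v * g v - f u * g u) \<le> max A B * (cmod (f v - f u) + cmod (g v - g u))"
      by (simp add: algebra_simps)
  qed
qed

lemma absolutely_continuous_on_cnj:
  assumes f: "absolutely_continuous_on {a..b} f"
  shows "absolutely_continuous_on {a..b} (\<lambda>t. cnj (f t))"
  by (rule absolutely_continuous_on_dominated[OF f f, where M = 1])
     (simp flip: complex_cnj_diff)

text \<open>The arithmetic-geometric mean inequality \<open>\<bar>f\<bar> \<le> (l \<bar>f\<bar>\<^sup>2 + 1 / l) / 2\<close> splits the increments into a part
  that is small when \<open>l\<close> is, no matter how long the intervals are, and a part proportional to their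
  total length.\<close>

lemma absolutely_continuous_on_indefinite_integral:
  fixes f :: "real \<Rightarrow> complex"
  assumes f: "f absolutely_integrable_on {a..b}"
    and f2: "(\<lambda>t. (cmod (f t))\<^sup>2) integrable_on {a..b}"
  shows "absolutely_continuous_on {a..b} (\<lambda>t. integral {a..t} f)"
  unfolding absolutely_continuous_on_def
proof (intro allI impI)
  fix e :: real assume e: "e > 0"
  define Q where "Q = integral {a..b} (\<lambda>t. (cmod (f t))\<^sup>2)"
  have Q0: "Q \<ge> 0" unfolding Q_def by (rule integral_nonneg[OF f2]) simp
  define l where "l = e / (Q + 1)"
  have l: "l > 0" "l * Q < e"
    using e Q0 by (auto simp: l_def field_simps)
  show "\<exists>\<delta>>0. \<forall>d. d division_of \<Union> d \<and> \<Union> d \<subseteq> {a..b} \<and> (\<Sum>K\<in>d. Sup K - Inf K) < \<delta> \<longrightarrow>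
          (\<Sum>K\<in>d. cmod (integral {a..Sup K} f - integral {a..Inf K} f)) < e"
  proof (intro exI[of _ "l * e"] conjI allI impI)
    show "l * e > 0" using l e by simp
    fix d assume "d division_of \<Union> d \<and> \<Union> d \<subseteq> {a..b} \<and> (\<Sum>K\<in>d. Sup K - Inf K) < l * e"
    then have d: "d division_of \<Union> d" "\<Union> d \<subseteq> {a..b}" "(\<Sum>K\<in>d. Sup K - Inf K) < l * e" by auto
    let ?g = "\<lambda>t. (l * (cmod (f t))\<^sup>2 + 1 / l) / 2"
    have bound: "cmod (f t) \<le> ?g t" for t
    proof -
      have "0 \<le> (l * cmod (f t) - 1)\<^sup>2 / l" using l by simp
      also have "\<dots> = l * (cmod (f t))\<^sup>2 + 1 / l - 2 * cmod (f t)"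
        using l by (simp add: power2_eq_square field_simps)
      finally show ?thesis by simp
    qed
    have f2K: "(\<lambda>t. (cmod (f t))\<^sup>2) integrable_on K" if K: "K \<in> d" for K
    proof -
      obtain u v where "K = {u..v}" by (rule division_of_real_interval[OF d(1) K])
      moreover have "K \<subseteq> {a..b}" using K d(2) by blast
      ultimately show ?thesis using integrable_on_subinterval[OF f2] by blast
    qed
    have "(\<Sum>K\<in>d. cmod (integral {a..Sup K} f - integral {a..Inf K} f))
        \<le> (\<Sum>K\<in>d. (l * integral K (\<lambda>t. (cmod (f t))\<^sup>2) + (Sup K - Inf K) / l) / 2)"
    proof (rule sum_mono)
      fix K assume K: "K \<in> d"
      obtain u v where uv: "K = {u..v}" "u \<le> v" "Inf K = u" "Sup K = v"
        by (rule division_of_real_interval[OF d(1) K])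
      have "K \<subseteq> {a..b}" using K d(2) by blast
      then have auv: "a \<le> u" "v \<le> b" using uv by auto
      have fi: "f integrable_on {a..v}" "f integrable_on {u..v}"
        using auv set_lebesgue_integral_eq_integral(1)[OF f]
        by (auto intro: integrable_on_subinterval)
      have "integral {a..v} f - integral {a..u} f = integral {u..v} f"
        using Henstock_Kurzweil_Integration.integral_combine[OF auv(1) uv(2) fi(1)] by (simp add: algebra_simps)
      moreover have "cmod (integral {u..v} f) \<le> integral {u..v} ?g"
      proof (rule integral_norm_bound_integral[OF fi(2) _ bound])
        show "?g integrable_on {u..v}"
          using f2K[OF K] uv
          by (intro integrable_on_divide integrable_add integrable_on_mult_right integrable_const_ivl) auto
      qed
      moreover have "integral {u..v} ?g = (l * integral K (\<lambda>t. (cmod (f t))\<^sup>2) + (v - u) / l) / 2"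
      proof -
        have "integral {u..v} ?g = integral {u..v} (\<lambda>t. l * (cmod (f t))\<^sup>2 + 1 / l) / 2"
          by simp
        also have "integral {u..v} (\<lambda>t. l * (cmod (f t))\<^sup>2 + 1 / l)
            = integral {u..v} (\<lambda>t. l * (cmod (f t))\<^sup>2) + integral {u..v} (\<lambda>t. 1 / l)"
          using f2K[OF K] uv
          by (intro integral_add integrable_on_mult_right integrable_const_ivl) auto
        finally show ?thesis using uv by simp
      qed
      ultimately show "cmod (integral {a..Sup K} f - integral {a..Inf K} f)
          \<le> (l * integral K (\<lambda>t. (cmod (f t))\<^sup>2) + (Sup K - Inf K) / l) / 2"
        using uv by simp
    qed
    also have "\<dots> = (l * (\<Sum>K\<in>d. integral K (\<lambda>t. (cmod (f t))\<^sup>2)) + (\<Sum>K\<in>d. Sup K - Inf K) / l) / 2"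
      by (simp add: sum.distrib sum_distrib_left sum_divide_distrib add_divide_distrib)
    also have "(\<Sum>K\<in>d. integral K (\<lambda>t. (cmod (f t))\<^sup>2)) = integral (\<Union>d) (\<lambda>t. (cmod (f t))\<^sup>2)"
      using integral_combine_division_bottomup[OF d(1) f2K] by simp
    also have "(l * integral (\<Union>d) (\<lambda>t. (cmod (f t))\<^sup>2) + (\<Sum>K\<in>d. Sup K - Inf K) / l) / 2 < (e + e) / 2"
    proof -
      have "(\<lambda>t. (cmod (f t))\<^sup>2) integrable_on \<Union>d"
        using d(1) f2K integrable_combine_division by blast
      then have "integral (\<Union>d) (\<lambda>t. (cmod (f t))\<^sup>2) \<le> Q"
        unfolding Q_def using d(2) f2 by (intro integral_subset_le) auto
      then have "l * integral (\<Union>d) (\<lambda>t. (cmod (f t))\<^sup>2) \<le> l * Q"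
        using l by simp
      moreover have "(\<Sum>K\<in>d. Sup K - Inf K) / l < e"
        using d(3) l by (simp add: field_simps)
      ultimately show ?thesis
        using l(2) by (intro divide_strict_right_mono add_strict_mono) auto
    qed
    finally show "(\<Sum>K\<in>d. cmod (integral {a..Sup K} f - integral {a..Inf K} f)) < e" by simp
  qed
qed

text \<open>A gauge integral proof.  Where \<open>F\<close> is differentiable, the gauge makes each term of a Riemann sum
  agree with the increment of \<open>F\<close> up to a small multiple of the length.  Intervals tagged in the
  exceptional set \<open>N\<close> are forced into an open set of small measure; there the integrand is redefined to
  be zero, and absolute continuity bounds the sum of the increments.\<close>

lemma fundamental_theorem_of_calculus_absolutely_continuous:
  assumes "a \<le> b" and ac: "absolutely_continuous_on {a..b} F" and N: "negligible N"
    and deriv: "\<And>t. t \<in> {a..b} - N \<Longrightarrow> (F has_vector_derivative f t) (at t within {a..b})"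
  shows "(f has_integral F b - F a) {a..b}"
proof (rule has_integral_spike[OF N])
  define f0 where "f0 t = (if t \<in> N then 0 else f t)" for t
  show "f t = f0 t" if "t \<in> {a..b} - N" for t
    using that by (simp add: f0_def)
  show "(f0 has_integral F b - F a) {a..b}"
  proof (cases "a = b")
    case True
    then show ?thesis using has_integral_null_real[of a a f0] by simp
  next
    case False
    with \<open>a \<le> b\<close> have "a < b" by simp
    show ?thesis
      unfolding has_integral_factor_content_real
    proof (intro allI impI)
      fix e :: real assume e: "e > 0"
      have "\<exists>r>0. \<forall>y\<in>{a..b}. norm (y - t) < r \<longrightarrow>
          norm (F y - F t - (y - t) *\<^sub>R f t) \<le> e / 2 * norm (y - t)"
        if "t \<in> {a..b} - N" for t
        using deriv[OF that] e unfolding has_vector_derivative_def has_derivative_within_alt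
        by (metis half_gt_zero)
      then obtain r where r: "\<And>t. t \<in> {a..b} - N \<Longrightarrow> r t > 0"
        and rd: "\<And>t y. \<lbrakk>t \<in> {a..b} - N; y \<in> {a..b}; norm (y - t) < r t\<rbrakk> \<Longrightarrow>
          norm (F y - F t - (y - t) *\<^sub>R f t) \<le> e / 2 * norm (y - t)"
        by metis
      have e2: "e / 2 * (b - a) > 0" using e \<open>a < b\<close> by simp
      obtain \<delta> where \<delta>: "\<delta> > 0"
        "\<And>d. \<lbrakk>d division_of \<Union>d; \<Union>d \<subseteq> {a..b}; (\<Sum>K\<in>d. Sup K - Inf K) < \<delta>\<rbrakk> \<Longrightarrow>
           (\<Sum>K\<in>d. cmod (F (Sup K) - F (Inf K))) < e / 2 * (b - a)"
        by (rule absolutely_continuous_onD[OF ac e2]) auto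
      obtain G where G: "open G" "N \<subseteq> G" "G \<in> lmeasurable" "measure lebesgue G < \<delta>"
      proof -
        have "N \<in> sets lebesgue" using N by (rule negligible_imp_sets)
        then obtain G where G: "open G" "N \<subseteq> G" "G - N \<in> lmeasurable" "emeasure lebesgue (G - N) < ennreal \<delta>"
          using sets_lebesgue_outer_open \<delta>(1) by metis
        have "negligible ((G - (G - N)) \<union> ((G - N) - G))"
          using N by (rule negligible_subset) auto
        then have "G \<in> lmeasurable" "measure lebesgue G = measure lebesgue (G - N)"
          using lmeasurable_negligible_symdiff[OF G(3)] measure_negligible_symdiff[of "G - N" G] G(3)
          by (auto simp: Un_commute fmeasurableD)
        moreover have "measure lebesgue (G - N) < \<delta>"
          using G(3,4) \<delta>(1) by (simp add: emeasure_eq_measure2 ennreal_less_iff)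
        ultimately show thesis using that G by simp
      qed
      define \<gamma> where "\<gamma> t = (if t \<in> N then G else if t \<in> {a..b} then ball t (r t) else ball t 1)" for t
      have gauge: "gauge \<gamma>"
        using G r by (auto simp: gauge_def \<gamma>_def)
      have main: "norm ((\<Sum>(x,k)\<in>p. measure lborel k *\<^sub>R f0 x) - (F b - F a)) \<le> e * measure lborel {a..b}"
        if p: "p tagged_division_of {a..b}" "\<gamma> fine p" for p
      proof -
        have fin: "finite p" using p(1) by blast
        define D where "D = (\<lambda>(x, k). measure lborel k *\<^sub>R f0 x - (F (Sup k) - F (Inf k)))"
        define p1 where "p1 = {(x, k) \<in> p. x \<in> N}"
        define p2 where "p2 = {(x, k) \<in> p. x \<notin> N}"
        have sub: "p1 \<subseteq> p" "p2 \<subseteq> p" by (auto simp: p1_def p2_def)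
        have split: "sum h p = sum h p1 + sum h p2" for h :: "_ \<Rightarrow> 'z::comm_monoid_add"
        proof -
          have "p = p1 \<union> p2" "p1 \<inter> p2 = {}" by (auto simp: p1_def p2_def)
          then show ?thesis
            using fin sub by (metis finite_subset sum.union_disjoint)
        qed
        have interval: "\<exists>u v. k = {u..v} \<and> u \<le> x \<and> x \<le> v \<and> a \<le> u \<and> v \<le> b \<and> k \<subseteq> \<gamma> x" if xk: "(x, k) \<in> p" for x k
        proof -
          obtain u v where "k = cbox u v" using tagged_division_ofD(4)[OF p(1) xk] by blast
          moreover have "x \<in> k" "k \<subseteq> {a..b}" using tagged_division_ofD(2,3)[OF p(1) xk] by auto
          moreover have "k \<subseteq> \<gamma> x" using p(2) xk by (auto simp: fine_def)
          ultimately show ?thesis by (intro exI[of _ u] exI[of _ v]) auto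
        qed
        have "sum D p = (\<Sum>(x,k)\<in>p. measure lborel k *\<^sub>R f0 x) - (\<Sum>(x,k)\<in>p. F (Sup k) - F (Inf k))"
          by (simp add: D_def sum_subtractf split_def)
        also have "(\<Sum>(x,k)\<in>p. F (Sup k) - F (Inf k)) = F b - F a"
          by (rule additive_tagged_division_1[OF \<open>a \<le> b\<close> p(1)])
        finally have eq: "(\<Sum>(x,k)\<in>p. measure lborel k *\<^sub>R f0 x) - (F b - F a) = sum D p" by simp
        have "norm (sum D p1) \<le> e / 2 * (b - a)"
        proof -
          have tp: "p1 tagged_partial_division_of {a..b}"
            using tagged_partial_division_subset sub(1) p(1) tagged_division_of_def by blast
          note td = tagged_partial_division_of_Union_self[OF tp]
          note dv = partial_division_of_tagged_division[OF tp]
          let ?h = "\<lambda>k. if k = {} then 0 else norm (F (Sup k) - F (Inf k))"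
          \<comment> \<open>The redefined integrand vanishes at these tags, which leaves the increments of \<open>F\<close>.\<close>
          have "norm (sum D p1) \<le> (\<Sum>(x, k)\<in>p1. ?h k)"
          proof (rule order_trans[OF norm_sum], rule sum_mono, clarify)
            fix x k assume xk: "(x, k) \<in> p1"
            then have "x \<in> N" "k \<noteq> {}" using interval sub by (auto simp: p1_def) fastforce
            then show "norm (D (x, k)) \<le> ?h k"
              by (simp add: D_def f0_def norm_minus_commute)
          qed
          also have "\<dots> = sum ?h (snd ` p1)"
            by (rule sum.over_tagged_division_lemma[OF td]) auto
          also have "\<dots> = (\<Sum>k\<in>snd ` p1. norm (F (Sup k) - F (Inf k)))"
            using dv by (intro sum.cong) auto
          also have "\<dots> \<le> e / 2 * (b - a)"
          proof (rule less_imp_le, rule \<delta>(2)[OF dv])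
            show "\<Union> (snd ` p1) \<subseteq> {a..b}"
              using interval sub by fastforce
            have "(\<Sum>K\<in>snd ` p1. Sup K - Inf K) = measure lebesgue (\<Union> (snd ` p1))"
              by (rule sum_length_division[OF dv])
            also have "\<dots> \<le> measure lebesgue G"
            proof (rule measure_mono_fmeasurable)
              show "\<Union> (snd ` p1) \<subseteq> G"
              proof clarify
                fix y x k assume "(x, k) \<in> p1" "y \<in> snd (x, k)"
                then show "y \<in> G" using interval[of x k] by (auto simp: p1_def \<gamma>_def)
              qed
              show "\<Union> (snd ` p1) \<in> sets lebesgue"
                using lmeasurable_division[OF dv] by (rule fmeasurableD)
            qed (rule G(3))
            also have "\<dots> < \<delta>" by (rule G(4))
            finally show "(\<Sum>K\<in>snd ` p1. Sup K - Inf K) < \<delta>" .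
          qed
          finally show ?thesis .
        qed
        moreover have "norm (sum D p2) \<le> e / 2 * (b - a)"
        proof -
          have "norm (sum D p2) \<le> (\<Sum>(x, k)\<in>p2. e / 2 * measure lborel k)"
          proof (rule order_trans[OF norm_sum], rule sum_mono, clarify)
            fix x k assume xk: "(x, k) \<in> p2"
            then have xN: "x \<notin> N" by (simp add: p2_def)
            obtain u v where k: "k = {u..v}" "u \<le> x" "x \<le> v" "a \<le> u" "v \<le> b" "k \<subseteq> \<gamma> x"
              using interval[of x k] xk sub by blast
            have x: "x \<in> {a..b} - N" using k xN by auto
            have "k \<subseteq> ball x (r x)" using k(6) x by (simp add: \<gamma>_def)
            moreover have "u \<in> k" "v \<in> k" using k by auto
            ultimately have "norm (u - x) < r x" "norm (v - x) < r x"
              by (auto simp: dist_norm norm_minus_commute)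
            then have *: "norm (F v - F x - (v - x) *\<^sub>R f x) \<le> e / 2 * norm (v - x)"
                 "norm (F u - F x - (u - x) *\<^sub>R f x) \<le> e / 2 * norm (u - x)"
              using rd[OF x, of v] rd[OF x, of u] k by auto
            have "D (x, k) = (F u - F x - (u - x) *\<^sub>R f x) - (F v - F x - (v - x) *\<^sub>R f x)"
              using k xN by (simp add: D_def f0_def algebra_simps)
            then have "norm (D (x, k)) \<le> e / 2 * norm (u - x) + e / 2 * norm (v - x)"
              using * norm_triangle_ineq4 by (smt (verit))
            also have "\<dots> = e / 2 * measure lborel k" using k by (simp add: field_simps)
            finally show "norm (D (x, k)) \<le> e / 2 * measure lborel k" .
          qed
          also have "\<dots> \<le> (\<Sum>(x, k)\<in>p. e / 2 * measure lborel k)"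
            using fin sub e by (intro sum_mono2) auto
          also have "\<dots> = e / 2 * (b - a)"
            using additive_content_tagged_division[of p a b] p(1) \<open>a \<le> b\<close>
            by (simp add: split_def flip: sum_distrib_left sum_divide_distrib)
          finally show ?thesis .
        qed
        ultimately have "norm (sum D p) \<le> e * (b - a)"
          unfolding split using norm_triangle_ineq[of "sum D p1" "sum D p2"] by (simp add: field_simps)
        then show ?thesis
          using eq \<open>a \<le> b\<close> by simp
      qed
      show "\<exists>d. gauge d \<and> (\<forall>p. p tagged_division_of {a..b} \<and> d fine p \<longrightarrow>
          norm ((\<Sum>(x,k)\<in>p. measure lborel k *\<^sub>R f0 x) - (F b - F a)) \<le> e * measure lborel {a..b})"
      proof (intro exI[of _ \<gamma>] conjI allI impI gauge)
        fix p assume "p tagged_division_of {a..b} \<and> \<gamma> fine p"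
        then show "norm ((\<Sum>(x,k)\<in>p. measure lborel k *\<^sub>R f0 x) - (F b - F a)) \<le> e * measure lborel {a..b}"
          using main[of p] by fast
      qed
    qed
  qed
qed

definition ac_derivative :: "real \<Rightarrow> real \<Rightarrow> (real \<Rightarrow> complex) \<Rightarrow> (real \<Rightarrow> complex) \<Rightarrow> bool" where
  "ac_derivative a b F f \<longleftrightarrow> absolutely_continuous_on {a..b} F \<and>
     (AE t in lebesgue_on {a..b}. (F has_vector_derivative f t) (at t within {a..b}))"

lemma ac_derivative_integral:
  assumes "ac_derivative a b F f" "a \<le> t" "t \<le> b"
  shows "(f has_integral F t - F a) {a..t}"
proof -
  obtain N where N: "negligible N"
    "\<And>t. t \<in> {a..b} - N \<Longrightarrow> (F has_vector_derivative f t) (at t within {a..b})"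
    using assms(1) by (auto simp: ac_derivative_def AE_lebesgue_on_iff_negligible)
  show ?thesis
  proof (rule fundamental_theorem_of_calculus_absolutely_continuous[OF assms(2) _ N(1)])
    show "absolutely_continuous_on {a..t} F"
      using assms by (auto simp: ac_derivative_def intro: absolutely_continuous_on_subset)
    show "(F has_vector_derivative f x) (at x within {a..t})" if "x \<in> {a..t} - N" for x
      using that assms by (intro has_vector_derivative_within_subset[OF N(2)]) auto
  qed
qed

lemma ac_derivative_cong:
  assumes F: "ac_derivative a b F f"
    and eq: "\<And>t. t \<in> {a..b} \<Longrightarrow> G t = F t" "AE t in lebesgue_on {a..b}. g t = f t"
  shows "ac_derivative a b G g"
proof -
  have "absolutely_continuous_on {a..b} G"
  proof (rule absolutely_continuous_on_dominated[where M = 1])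
    show "absolutely_continuous_on {a..b} F" "absolutely_continuous_on {a..b} F"
      using F by (auto simp: ac_derivative_def)
  qed (auto simp: eq(1))
  moreover have "AE t in lebesgue_on {a..b}. (F has_vector_derivative f t) (at t within {a..b})"
    using F by (auto simp: ac_derivative_def)
  then have "AE t in lebesgue_on {a..b}. (G has_vector_derivative g t) (at t within {a..b})"
    using eq(2) AE_space
  proof eventually_elim
    case (elim t)
    then have "t \<in> {a..b}" by simp
    with elim show ?case
      using has_vector_derivative_transform[where f = F and g = G and S = "{a..b}" and x = t, OF _ eq(1)]
      by simp
  qed
  ultimately show ?thesis by (simp add: ac_derivative_def)
qed

lemma ac_derivative_mult:
  assumes F: "ac_derivative a b F f" and G: "ac_derivative a b G g"
  shows "ac_derivative a b (\<lambda>t. F t * G t) (\<lambda>t. F t * g t + f t * G t)"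
proof -
  have "AE t in lebesgue_on {a..b}. (F has_vector_derivative f t) (at t within {a..b})"
    "AE t in lebesgue_on {a..b}. (G has_vector_derivative g t) (at t within {a..b})"
    using F G by (auto simp: ac_derivative_def)
  then have "AE t in lebesgue_on {a..b}.
      ((\<lambda>t. F t * G t) has_vector_derivative F t * g t + f t * G t) (at t within {a..b})"
    by eventually_elim (rule has_vector_derivative_mult)
  then show ?thesis
    using F G by (simp add: ac_derivative_def absolutely_continuous_on_mult)
qed

lemma ac_derivative_cnj:
  assumes F: "ac_derivative a b F f"
  shows "ac_derivative a b (\<lambda>t. cnj (F t)) (\<lambda>t. cnj (f t))"
proof -
  have "AE t in lebesgue_on {a..b}. (F has_vector_derivative f t) (at t within {a..b})"
    using F by (auto simp: ac_derivative_def)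
  then have "AE t in lebesgue_on {a..b}.
      ((\<lambda>t. cnj (F t)) has_vector_derivative cnj (f t)) (at t within {a..b})"
    by eventually_elim (rule has_vector_derivative_cnj)
  then show ?thesis
    using F by (simp add: ac_derivative_def absolutely_continuous_on_cnj)
qed

lemma ac_derivative_add:
  assumes F: "ac_derivative a b F f" and G: "ac_derivative a b G g"
  shows "ac_derivative a b (\<lambda>t. F t + G t) (\<lambda>t. f t + g t)"
proof -
  have "AE t in lebesgue_on {a..b}. (F has_vector_derivative f t) (at t within {a..b})"
    "AE t in lebesgue_on {a..b}. (G has_vector_derivative g t) (at t within {a..b})"
    using F G by (auto simp: ac_derivative_def)
  then have "AE t in lebesgue_on {a..b}.
      ((\<lambda>t. F t + G t) has_vector_derivative f t + g t) (at t within {a..b})"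
    by eventually_elim (rule has_vector_derivative_add)
  moreover have "absolutely_continuous_on {a..b} (\<lambda>t. F t + G t)"
  proof (rule absolutely_continuous_on_dominated[where f = F and g = G and M = 1])
    fix u v
    have eq: "F v + G v - (F u + G u) = (F v - F u) + (G v - G u)" by simp
    show "cmod (F v + G v - (F u + G u)) \<le> 1 * (cmod (F v - F u) + cmod (G v - G u))"
      unfolding eq using norm_triangle_ineq[of "F v - F u" "G v - G u"] by simp
  qed (use F G in \<open>auto simp: ac_derivative_def\<close>)
  ultimately show ?thesis
    by (simp add: ac_derivative_def)
qed

lemma ac_derivative_const: "ac_derivative a b (\<lambda>t. K) (\<lambda>t. 0)"
  by (simp add: ac_derivative_def absolutely_continuous_on_def)

lemma ac_derivative_plus_const:
  "ac_derivative a b F f \<Longrightarrow> ac_derivative a b (\<lambda>t. K + F t) f"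
  using ac_derivative_add[OF ac_derivative_const] by fastforce

section \<open>Square-integrable functions\<close>

lemma L2_imp_integrable:
  assumes S: "S \<in> lmeasurable" and f: "f \<in> L2 S"
  shows "integrable (lebesgue_on S) f"
proof (rule Bochner_Integration.integrable_bound)
  show "integrable (lebesgue_on S) (\<lambda>t. (cmod (f t))\<^sup>2 + 1)"
    using f S by (intro Bochner_Integration.integrable_add finite_measure.integrable_const finite_measure_lebesgue_on)
      (auto simp: L2_def)
  show "f \<in> borel_measurable (lebesgue_on S)"
    using f by (simp add: L2_def)
  have "x \<le> x\<^sup>2 + 1" for x :: real
    using sum_power2_ge_zero[of "x - 1" x] by (simp add: power2_eq_square algebra_simps)
  then show "AE t in lebesgue_on S. norm (f t) \<le> norm ((cmod (f t))\<^sup>2 + 1)"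
    by simp
qed

lemma L2_imp_absolutely_integrable_on:
  assumes "S \<in> lmeasurable" "f \<in> L2 S"
  shows "f absolutely_integrable_on S" "(\<lambda>t. (cmod (f t))\<^sup>2) integrable_on S"
    "(\<lambda>t. cmod (f t)) integrable_on S"
proof -
  have S: "S \<in> sets lebesgue" using assms by (simp add: fmeasurableD)
  show "f absolutely_integrable_on S"
    using L2_imp_integrable[OF assms] S by (simp add: integrable_restrict_space set_integrable_def)
  then show "(\<lambda>t. cmod (f t)) integrable_on S"
    by (simp add: absolutely_integrable_on_def)
  show "(\<lambda>t. (cmod (f t))\<^sup>2) integrable_on S"
    using assms S by (intro integrable_on_lebesgue_on) (auto simp: L2_def)
qed

text \<open>Integrating \<open>\<bar>z + w\<bar>\<^sup>2 \<le> 2 \<bar>z\<bar>\<^sup>2 + 2 \<bar>w\<bar>\<^sup>2\<close> gives a substitute for the triangle inequality that stays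
  with squared norms, which are additive over the two intervals.\<close>

lemma L2_add:
  assumes "f \<in> L2 S" "g \<in> L2 S"
  shows "(\<lambda>t. f t + g t) \<in> L2 S"
    and "integral\<^sup>L (lebesgue_on S) (\<lambda>t. (cmod (f t + g t))\<^sup>2)
      \<le> 2 * integral\<^sup>L (lebesgue_on S) (\<lambda>t. (cmod (f t))\<^sup>2)
       + 2 * integral\<^sup>L (lebesgue_on S) (\<lambda>t. (cmod (g t))\<^sup>2)"
proof -
  have le: "(cmod (z + w))\<^sup>2 \<le> 2 * (cmod z)\<^sup>2 + 2 * (cmod w)\<^sup>2" for z w
  proof -
    have "(cmod (z + w))\<^sup>2 \<le> (cmod z + cmod w)\<^sup>2"
      by (intro power_mono norm_triangle_ineq) auto
    also have "\<dots> \<le> 2 * (cmod z)\<^sup>2 + 2 * (cmod w)\<^sup>2"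
      using sum_squares_bound[of "cmod z" "cmod w"] by (simp add: power2_sum)
    finally show ?thesis .
  qed
  have meas: "(\<lambda>t. f t + g t) \<in> borel_measurable (lebesgue_on S)"
    using assms by (auto simp: L2_def)
  have int: "integrable (lebesgue_on S) (\<lambda>t. 2 * (cmod (f t))\<^sup>2 + 2 * (cmod (g t))\<^sup>2)"
    using assms by (auto simp: L2_def)
  have "integrable (lebesgue_on S) (\<lambda>t. (cmod (f t + g t))\<^sup>2)"
  proof (rule Bochner_Integration.integrable_bound[OF int])
    show "(\<lambda>t. (cmod (f t + g t))\<^sup>2) \<in> borel_measurable (lebesgue_on S)"
      using meas by measurable
    show "AE t in lebesgue_on S. norm ((cmod (f t + g t))\<^sup>2) \<le> norm (2 * (cmod (f t))\<^sup>2 + 2 * (cmod (g t))\<^sup>2)"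
      using le by auto
  qed
  with meas show "(\<lambda>t. f t + g t) \<in> L2 S" by (simp add: L2_def)
  have "integral\<^sup>L (lebesgue_on S) (\<lambda>t. (cmod (f t + g t))\<^sup>2)
      \<le> integral\<^sup>L (lebesgue_on S) (\<lambda>t. 2 * (cmod (f t))\<^sup>2 + 2 * (cmod (g t))\<^sup>2)"
    using le by (intro integral_mono' int) auto
  then show "integral\<^sup>L (lebesgue_on S) (\<lambda>t. (cmod (f t + g t))\<^sup>2)
      \<le> 2 * integral\<^sup>L (lebesgue_on S) (\<lambda>t. (cmod (f t))\<^sup>2)
       + 2 * integral\<^sup>L (lebesgue_on S) (\<lambda>t. (cmod (g t))\<^sup>2)"
    using assms by (simp add: L2_def)
qed

lemma L2_cmult:
  assumes "f \<in> L2 S"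
  shows "(\<lambda>t. k * f t) \<in> L2 S"
proof -
  have "(\<lambda>t. k * f t) \<in> borel_measurable (lebesgue_on S)"
    using assms by (auto simp: L2_def)
  moreover have "integrable (lebesgue_on S) (\<lambda>t. (cmod k)\<^sup>2 * (cmod (f t))\<^sup>2)"
    using assms by (auto simp: L2_def)
  ultimately show ?thesis
    by (simp add: L2_def norm_mult power_mult_distrib)
qed

lemma L2_diff:
  assumes "f \<in> L2 S" "g \<in> L2 S"
  shows "(\<lambda>t. f t - g t) \<in> L2 S"
  using L2_add(1)[OF assms(1) L2_cmult[OF assms(2), of "-1"]] by simp

lemma L2_triangle_square:
  assumes "f \<in> L2 S" "g \<in> L2 S" "h \<in> L2 S"
  shows "integral\<^sup>L (lebesgue_on S) (\<lambda>t. (cmod (f t - h t))\<^sup>2)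
      \<le> 2 * integral\<^sup>L (lebesgue_on S) (\<lambda>t. (cmod (f t - g t))\<^sup>2)
       + 2 * integral\<^sup>L (lebesgue_on S) (\<lambda>t. (cmod (g t - h t))\<^sup>2)"
  using L2_add(2)[OF L2_diff[OF assms(1,2)] L2_diff[OF assms(2,3)]] by simp

lemma L2_mult_bounded:
  assumes S: "S \<in> sets lebesgue" and g: "g \<in> borel_measurable (lebesgue_on S)"
    and bound: "\<And>t. t \<in> S \<Longrightarrow> cmod (g t) \<le> B" and h: "h \<in> L2 S"
  shows "(\<lambda>t. g t * h t) \<in> L2 S"
proof -
  have meas: "(\<lambda>t. g t * h t) \<in> borel_measurable (lebesgue_on S)"
    using g h by (auto simp: L2_def)
  have "integrable (lebesgue_on S) (\<lambda>t. (cmod (g t * h t))\<^sup>2)"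
  proof (rule Bochner_Integration.integrable_bound)
    show "integrable (lebesgue_on S) (\<lambda>t. B\<^sup>2 * (cmod (h t))\<^sup>2)"
      using h by (auto simp: L2_def)
    show "(\<lambda>t. (cmod (g t * h t))\<^sup>2) \<in> borel_measurable (lebesgue_on S)"
      using meas by measurable
    show "AE t in lebesgue_on S. norm ((cmod (g t * h t))\<^sup>2) \<le> norm (B\<^sup>2 * (cmod (h t))\<^sup>2)"
    proof (rule AE_I2)
      fix t assume "t \<in> space (lebesgue_on S)"
      then have "(cmod (g t))\<^sup>2 \<le> B\<^sup>2" using bound[of t] by (intro power_mono) auto
      then show "norm ((cmod (g t * h t))\<^sup>2) \<le> norm (B\<^sup>2 * (cmod (h t))\<^sup>2)"
        by (auto simp: norm_mult power_mult_distrib intro!: mult_right_mono)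
    qed
  qed
  with meas show ?thesis by (simp add: L2_def)
qed

lemma continuous_imp_L2:
  assumes g: "continuous_on {a..b} g"
  shows "g \<in> L2 {a..b}"
proof -
  have "continuous_on {a..b} (\<lambda>t. (cmod (g t))\<^sup>2)"
    by (intro continuous_intros g)
  then show ?thesis
    using g by (simp add: L2_def continuous_imp_measurable_on_sets_lebesgue continuous_imp_integrable_real)
qed

lemma L2_mult_continuous:
  assumes g: "continuous_on {a..b} g" and h: "h \<in> L2 {a..b}"
  shows "(\<lambda>t. g t * h t) \<in> L2 {a..b}"
proof -
  obtain B where "\<And>t. t \<in> {a..b} \<Longrightarrow> cmod (g t) \<le> B"
    using compact_imp_bounded[OF compact_continuous_image[OF g compact_Icc]]
    unfolding bounded_iff by (metis imageI)
  then show ?thesis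
    using g h by (intro L2_mult_bounded) (auto simp: continuous_imp_measurable_on_sets_lebesgue)
qed

text \<open>The variance of \<open>\<bar>h\<bar>\<close> is nonnegative.\<close>

lemma L1_square_le_L2:
  assumes "a < b" and h: "h \<in> L2 {a..b}"
  shows "(integral {a..b} (\<lambda>t. cmod (h t)))\<^sup>2
    \<le> (b - a) * integral\<^sup>L (lebesgue_on {a..b}) (\<lambda>t. (cmod (h t))\<^sup>2)"
proof -
  note int = L2_imp_absolutely_integrable_on[OF lmeasurable_interval(1) h]
  define I where "I = integral {a..b} (\<lambda>t. cmod (h t))"
  define Q where "Q = integral {a..b} (\<lambda>t. (cmod (h t))\<^sup>2)"
  define m where "m = I / (b - a)"
  have "((\<lambda>t. (cmod (h t))\<^sup>2 - 2 * m * cmod (h t) + m\<^sup>2) has_integral Q - 2 * m * I + (b - a) *\<^sub>R m\<^sup>2) {a..b}"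
    unfolding Q_def I_def using int \<open>a < b\<close> has_integral_const_real[of "m\<^sup>2" a b]
    by (intro has_integral_add has_integral_diff has_integral_mult_right integrable_integral) auto
  then have "0 \<le> Q - 2 * m * I + (b - a) *\<^sub>R m\<^sup>2"
  proof (rule has_integral_nonneg)
    show "0 \<le> (cmod (h t))\<^sup>2 - 2 * m * cmod (h t) + m\<^sup>2" for t
      using zero_le_power2[of "cmod (h t) - m"] by (simp add: power2_diff algebra_simps)
  qed
  also have Im: "I = m * (b - a)"
    using \<open>a < b\<close> by (simp add: m_def)
  finally have "(b - a) * m\<^sup>2 \<le> Q"
    by (simp add: power2_eq_square algebra_simps)
  then have "(b - a) * ((b - a) * m\<^sup>2) \<le> (b - a) * Q"
    using \<open>a < b\<close> by (intro mult_left_mono) auto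
  then have "I\<^sup>2 \<le> (b - a) * Q"
    by (simp add: Im power2_eq_square mult_ac)
  moreover have "integral\<^sup>L (lebesgue_on {a..b}) (\<lambda>t. (cmod (h t))\<^sup>2) = Q"
    unfolding Q_def using h by (intro lebesgue_integral_eq_integral) (auto simp: L2_def)
  ultimately show ?thesis by (simp add: I_def)
qed

lemma ac_derivative_indefinite_integral:
  assumes f: "f \<in> L2 {a..b}"
  shows "ac_derivative a b (\<lambda>t. integral {a..t} f) f"
proof -
  note int = L2_imp_absolutely_integrable_on[OF lmeasurable_interval(1) f]
  obtain N where "negligible N" "\<And>t. t \<in> {a..b} - N \<Longrightarrow>
      ((\<lambda>t. integral {a..t} f) has_vector_derivative f t) (at t within {a..b})"
    by (rule lebesgue_differentiation_interval[OF set_lebesgue_integral_eq_integral(1)[OF int(1)]]) blast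
  then have "AE t in lebesgue_on {a..b}.
      ((\<lambda>t. integral {a..t} f) has_vector_derivative f t) (at t within {a..b})"
    by (intro AE_lebesgue_on_iff_negligible[THEN iffD2] exI[of _ N]) auto
  then show ?thesis
    using absolutely_continuous_on_indefinite_integral[OF int(1,2)]
    by (simp add: ac_derivative_def)
qed

lemma ac_derivative_continuous_derivative:
  assumes F: "\<And>t. t \<in> {a..b} \<Longrightarrow> (F has_vector_derivative f t) (at t within {a..b})"
    and f: "continuous_on {a..b} f"
  shows "ac_derivative a b F f"
proof (rule ac_derivative_cong[OF ac_derivative_plus_const[OF ac_derivative_indefinite_integral]])
  show "f \<in> L2 {a..b}"
    using f by (intro continuous_imp_L2) auto
  show "F t = F a + integral {a..t} f" if "t \<in> {a..b}" for t
  proof -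
    have "(f has_integral F t - F a) {a..t}"
      using that by (intro fundamental_theorem_of_calculus has_vector_derivative_within_subset[OF F]) auto
    then show ?thesis by (simp add: integral_unique)
  qed
qed auto

section \<open>The boundary value problem on one interval\<close>

definition wave :: "complex \<Rightarrow> complex" where
  "wave z = exp (\<i> * 2 * of_real pi * z)"

lemma unit_exp_eq_wave: "unit_exp x = wave (of_real x)"
  by (simp add: unit_exp_def wave_def)

lemma wave_nonzero [simp]: "wave z \<noteq> 0"
  by (simp add: wave_def)

lemma wave_0 [simp]: "wave 0 = 1"
  by (simp add: wave_def)

lemma wave_add: "wave (z + w) = wave z * wave w"
  by (simp add: wave_def exp_add algebra_simps)

lemma wave_minus_mult [simp]: "wave (- z) * wave z = 1" "wave z * wave (- z) = 1"
  by (simp_all flip: wave_add)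

lemma norm_wave: "cmod (wave z) = exp (- 2 * pi * Im z)"
  by (simp add: wave_def norm_exp_eq_Re)

lemma wave_eq_1_iff: "wave z = 1 \<longleftrightarrow> (\<exists>n::int. z = of_int n)"
proof
  assume "wave z = 1"
  then obtain n :: int where "Im z = 0" "2 * pi * Re z = of_int (2 * n) * pi"
    by (auto simp: wave_def exp_eq_1)
  then have "Im z = 0" "Re z = of_int n" by auto
  then show "\<exists>n::int. z = of_int n"
    by (intro exI[of _ n] complex_eqI) auto
next
  assume "\<exists>n::int. z = of_int n"
  then show "wave z = 1" by (auto simp: wave_def exp_eq_1)
qed

lemma continuous_on_wave [continuous_intros]:
  "continuous_on S f \<Longrightarrow> continuous_on S (\<lambda>t. wave (f t))"
  unfolding wave_def by (intro continuous_intros)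

lemma ac_derivative_wave:
  "ac_derivative a b (\<lambda>t. wave (z * of_real t)) (\<lambda>t. \<i> * 2 * of_real pi * (z * wave (z * of_real t)))"
proof (rule ac_derivative_continuous_derivative)
  fix t
  have "((\<lambda>t. wave (z * of_real t)) has_vector_derivative
      \<i> * 2 * of_real pi * z * exp (\<i> * 2 * of_real pi * z * of_real t)) (at t within {a..b})"
    unfolding wave_def
    by (auto intro!: derivative_eq_intros has_vector_derivative_real_field simp: algebra_simps)
  then show "((\<lambda>t. wave (z * of_real t)) has_vector_derivative
      \<i> * 2 * of_real pi * (z * wave (z * of_real t))) (at t within {a..b})"
    by (simp add: wave_def algebra_simps)
qed (intro continuous_intros)

text \<open>With \<open>c = unit_exp \<phi>\<close> or \<open>c = unit_exp (\<theta> - \<phi>)\<close> and square-integrable \<open>g\<close>, this says that the momentum operator on the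
  interval, restricted by the quasi-periodic condition, maps \<open>F\<close> to \<open>g\<close>.\<close>

definition bvp :: "real \<Rightarrow> real \<Rightarrow> complex \<Rightarrow> (real \<Rightarrow> complex) \<Rightarrow> (real \<Rightarrow> complex) \<Rightarrow> bool" where
  "bvp a b c F g \<longleftrightarrow> ac_derivative a b F (\<lambda>t. \<i> * 2 * of_real pi * g t) \<and> F a = c * F b"

lemma bvp_cong:
  assumes "bvp a b c F f" "a \<le> b" "\<And>t. t \<in> {a..b} \<Longrightarrow> G t = F t" "AE t in lebesgue_on {a..b}. g t = f t"
  shows "bvp a b c G g"
  using assms unfolding bvp_def
  by (auto elim!: ac_derivative_cong eventually_mono)

lemma bvp_add:
  assumes "bvp a b c F f" "bvp a b c G g"
  shows "bvp a b c (\<lambda>t. F t + G t) (\<lambda>t. f t + g t)"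
proof -
  have "ac_derivative a b (\<lambda>t. F t + G t) (\<lambda>t. \<i> * 2 * of_real pi * f t + \<i> * 2 * of_real pi * g t)"
    using assms by (intro ac_derivative_add) (auto simp: bvp_def)
  then show ?thesis
    using assms by (simp add: bvp_def distrib_left)
qed

lemma bvp_cmult:
  assumes "bvp a b c F f"
  shows "bvp a b c (\<lambda>t. K * F t) (\<lambda>t. K * f t)"
proof -
  have "ac_derivative a b (\<lambda>t. K * F t) (\<lambda>t. K * (\<i> * 2 * of_real pi * f t) + 0 * F t)"
    using assms by (intro ac_derivative_mult ac_derivative_const) (auto simp: bvp_def)
  then show ?thesis
    using assms by (simp add: bvp_def mult_ac)
qed

lemma bvp_continuous_on: "bvp a b c F f \<Longrightarrow> continuous_on {a..b} F"
  by (auto simp: bvp_def ac_derivative_def intro: absolutely_continuous_on_imp_continuous_on)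

text \<open>Apply the fundamental theorem to \<open>F * cnj G\<close>: its values at the two end points coincide because
  \<open>c\<close> has modulus one.\<close>

lemma bvp_symmetric:
  assumes "a \<le> b" "cmod c = 1" and F: "bvp a b c F f" and G: "bvp a b c G g"
  shows "((\<lambda>t. f t * cnj (G t) - F t * cnj (g t)) has_integral 0) {a..b}"
proof -
  have "ac_derivative a b (\<lambda>t. F t * cnj (G t))
      (\<lambda>t. F t * cnj (\<i> * 2 * of_real pi * g t) + \<i> * 2 * of_real pi * f t * cnj (G t))"
    using F G by (intro ac_derivative_mult ac_derivative_cnj) (auto simp: bvp_def)
  from ac_derivative_integral[OF this \<open>a \<le> b\<close>]
  have "((\<lambda>t. F t * cnj (\<i> * 2 * of_real pi * g t) + \<i> * 2 * of_real pi * f t * cnj (G t))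
      has_integral F b * cnj (G b) - F a * cnj (G a)) {a..b}" by simp
  moreover have "F a * cnj (G a) = F b * cnj (G b)"
  proof -
    have "c * cnj c = 1" using assms(2) by (simp add: complex_norm_square[symmetric])
    then show ?thesis using F G by (simp add: bvp_def mult_ac)
  qed
  ultimately have "((\<lambda>t. 1 / (\<i> * 2 * of_real pi) *
        (F t * cnj (\<i> * 2 * of_real pi * g t) + \<i> * 2 * of_real pi * f t * cnj (G t)))
      has_integral 1 / (\<i> * 2 * of_real pi) * 0) {a..b}"
    by (intro has_integral_mult_right) auto
  moreover have "1 / (\<i> * 2 * of_real pi) *
        (F t * cnj (\<i> * 2 * of_real pi * g t) + \<i> * 2 * of_real pi * f t * cnj (G t))
      = f t * cnj (G t) - F t * cnj (g t)" for t
  proof -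
    have "F t * cnj (\<i> * 2 * of_real pi * g t) + \<i> * 2 * of_real pi * f t * cnj (G t)
        = (\<i> * 2 * of_real pi) * (f t * cnj (G t) - F t * cnj (g t))"
      by (simp add: algebra_simps)
    then show ?thesis by simp
  qed
  ultimately show ?thesis by simp
qed

text \<open>Variation of constants gives \<open>F t = wave (z * t) * (K + J t)\<close> with \<open>J\<close> a primitive of the transformed
  inhomogeneity, and the boundary condition becomes \<open>K = c * E * (K + J b)\<close> with \<open>E = wave (z * (b - a))\<close>, solvable
  for \<open>K\<close> when \<open>c * E\<close> is not one.\<close>

lemma bvp_solvable:
  assumes "a \<le> b" "h \<in> L2 {a..b}" and nonres: "c * wave (z * of_real (b - a)) \<noteq> 1"
  obtains F where "bvp a b c F (\<lambda>t. z * F t + h t)"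
proof
  define k where "k t = \<i> * 2 * of_real pi * wave (- z * of_real t) * h t" for t
  define J where "J t = integral {a..t} k" for t
  define E where "E = wave (z * of_real (b - a))"
  define K where "K = c * E * J b / (1 - c * E)"
  define F where "F t = wave (z * of_real t) * (K + J t)" for t
  have "k \<in> L2 {a..b}"
    unfolding k_def using assms(2) by (intro L2_mult_continuous continuous_intros) auto
  then have "ac_derivative a b J k"
    unfolding J_def by (rule ac_derivative_indefinite_integral)
  then have "ac_derivative a b F (\<lambda>t. wave (z * of_real t) * k t +
      \<i> * 2 * of_real pi * (z * wave (z * of_real t)) * (K + J t))"
    unfolding F_def by (intro ac_derivative_mult ac_derivative_wave ac_derivative_plus_const)
  moreover have "wave (z * of_real t) * k t + \<i> * 2 * of_real pi * (z * wave (z * of_real t)) * (K + J t)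
      = \<i> * 2 * of_real pi * (z * F t + h t)" for t
  proof -
    have "wave (z * of_real t) * k t = \<i> * 2 * of_real pi * (wave (z * of_real t) * wave (- (z * of_real t))) * h t"
      unfolding k_def by (simp add: mult_ac)
    then show ?thesis by (simp add: F_def algebra_simps)
  qed
  ultimately have "ac_derivative a b F (\<lambda>t. \<i> * 2 * of_real pi * (z * F t + h t))"
    by simp
  moreover have "F a = c * F b"
  proof -
    have "J a = 0" by (simp add: J_def)
    moreover have "wave (z * of_real b) = wave (z * of_real a) * E"
      by (simp add: E_def algebra_simps flip: wave_add)
    moreover have K: "K = c * E * (K + J b)"
      using nonres by (simp add: K_def E_def field_simps)
    ultimately show ?thesis
      unfolding F_def by (subst K) (simp add: mult_ac)
  qed
  ultimately show "bvp a b c F (\<lambda>t. z * F t + h t)"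
    by (simp add: bvp_def)
qed

lemma bvp_variation_of_constants:
  assumes "bvp a b c F (\<lambda>t. z * F t + h t)" "t \<in> {a..b}"
  shows "((\<lambda>s. \<i> * 2 * of_real pi * wave (- z * of_real s) * h s) has_integral
      wave (- z * of_real t) * F t - wave (- z * of_real a) * F a) {a..t}"
proof -
  have "ac_derivative a b (\<lambda>t. wave (- z * of_real t) * F t)
     (\<lambda>t. wave (- z * of_real t) * (\<i> * 2 * of_real pi * (z * F t + h t)) +
       \<i> * 2 * of_real pi * (- z * wave (- z * of_real t)) * F t)"
    using assms(1) by (intro ac_derivative_mult ac_derivative_wave) (auto simp: bvp_def)
  then have "ac_derivative a b (\<lambda>t. wave (- z * of_real t) * F t)
     (\<lambda>t. \<i> * 2 * of_real pi * wave (- z * of_real t) * h t)"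
    by (rule ac_derivative_cong) (auto simp: algebra_simps)
  from ac_derivative_integral[OF this] show ?thesis
    using assms(2) by simp
qed

lemma bvp_homogeneous:
  assumes "a \<le> b" "bvp a b c F (\<lambda>t. z * F t)"
  obtains K where "\<And>t. t \<in> {a..b} \<Longrightarrow> F t = K * wave (z * of_real t)"
    "K \<noteq> 0 \<Longrightarrow> c * wave (z * of_real (b - a)) = 1"
proof
  define K where "K = wave (- z * of_real a) * F a"
  show F: "F t = K * wave (z * of_real t)" if "t \<in> {a..b}" for t
  proof -
    have "((\<lambda>s. \<i> * 2 * of_real pi * wave (- z * of_real s) * 0) has_integral
      wave (- z * of_real t) * F t - K) {a..t}"
      unfolding K_def using assms(2) that by (intro bvp_variation_of_constants[where h = "\<lambda>_. 0"]) auto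
    then have "wave (- z * of_real t) * F t = K"
      using has_integral_unique[OF has_integral_0] by fastforce
    moreover have "F t = (wave (- (z * of_real t)) * wave (z * of_real t)) * F t"
      by simp
    then have "F t = (wave (- z * of_real t) * F t) * wave (z * of_real t)"
      by (simp add: mult_ac)
    ultimately show ?thesis by simp
  qed
  assume "K \<noteq> 0"
  moreover have "K * wave (z * of_real a) = c * (K * wave (z * of_real b))"
    using assms F[of a] F[of b] by (simp add: bvp_def)
  moreover have "wave (z * of_real b) = wave (z * of_real a) * wave (z * of_real (b - a))"
    by (simp add: algebra_simps flip: wave_add)
  ultimately show "c * wave (z * of_real (b - a)) = 1" by simp
qed

lemma bvp_wave:
  assumes "K \<noteq> 0 \<Longrightarrow> c * wave (z * of_real (b - a)) = 1"
  shows "bvp a b c (\<lambda>t. K * wave (z * of_real t)) (\<lambda>t. z * (K * wave (z * of_real t)))"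
proof -
  have "ac_derivative a b (\<lambda>t. K * wave (z * of_real t))
      (\<lambda>t. K * (\<i> * 2 * of_real pi * (z * wave (z * of_real t))) + 0 * wave (z * of_real t))"
    by (intro ac_derivative_mult ac_derivative_wave ac_derivative_const)
  moreover have "wave (z * of_real b) = wave (z * of_real a) * wave (z * of_real (b - a))"
    by (simp add: algebra_simps flip: wave_add)
  ultimately show ?thesis
    using assms by (cases "K = 0") (simp_all add: bvp_def mult_ac)
qed

text \<open>By variation of constants \<open>G t = wave (- z * t) * F t\<close> differs from \<open>G a\<close> by at most a multiple of the
  \<open>L\<^sup>1\<close> norm of \<open>h\<close>, and the boundary condition \<open>G a = c * E * G b\<close>, where \<open>E = wave (z * (b - a))\<close>, then controls \<open>G a\<close> itself.\<close>

lemma bvp_bound: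
  assumes "a \<le> b" "cmod c = 1" and nonres: "c * wave (z * of_real (b - a)) \<noteq> 1"
  obtains C where "C \<ge> 0"
    "\<And>F h t. \<lbrakk>h \<in> L2 {a..b}; bvp a b c F (\<lambda>t. z * F t + h t); t \<in> {a..b}\<rbrakk> \<Longrightarrow>
       cmod (F t) \<le> C * integral {a..b} (\<lambda>t. cmod (h t))"
proof
  define W where "W = exp (2 * pi * (cmod z * (\<bar>a\<bar> + \<bar>b\<bar>)))"
  define E where "E = wave (z * of_real (b - a))"
  define M where "M = 2 * pi * W"
  define C where "C = W * (cmod E / cmod (1 - c * E) * M + M)"
  have W: "cmod (wave w) \<le> W" if "cmod w \<le> cmod z * (\<bar>a\<bar> + \<bar>b\<bar>)" for w
  proof -
    have "- Im w \<le> cmod w" using abs_Im_le_cmod[of w] by linarith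
    then have "2 * pi * (- Im w) \<le> 2 * pi * (cmod z * (\<bar>a\<bar> + \<bar>b\<bar>))"
      using that by (intro mult_left_mono) auto
    then show ?thesis by (simp add: norm_wave W_def)
  qed
  have Wt: "cmod (wave (z * of_real t)) \<le> W" "cmod (wave (- z * of_real t)) \<le> W" if "t \<in> {a..b}" for t
    using that by (intro W; simp add: norm_mult; intro mult_left_mono; auto)+
  have "W > 0" by (simp add: W_def)
  then have "M > 0" by (simp add: M_def)
  show "C \<ge> 0" unfolding C_def using \<open>W > 0\<close> \<open>M > 0\<close> by simp
  fix F h t assume h: "h \<in> L2 {a..b}" and F: "bvp a b c F (\<lambda>t. z * F t + h t)" and t: "t \<in> {a..b}"
  define H where "H = integral {a..b} (\<lambda>t. cmod (h t))"
  have hi: "(\<lambda>t. cmod (h t)) integrable_on {a..b}"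
    using L2_imp_absolutely_integrable_on[OF _ h] by simp
  define G where "G t = wave (- z * of_real t) * F t" for t
  have FG: "F t = wave (z * of_real t) * G t" for t
  proof -
    have "F t = (wave (z * of_real t) * wave (- (z * of_real t))) * F t" by simp
    then show ?thesis by (simp add: G_def mult_ac)
  qed
  have GG: "cmod (G t - G a) \<le> M * H" if t: "t \<in> {a..b}" for t
  proof -
    have I: "((\<lambda>s. \<i> * 2 * of_real pi * wave (- z * of_real s) * h s) has_integral G t - G a) {a..t}"
      unfolding G_def by (rule bvp_variation_of_constants[OF F t])
    have hit: "(\<lambda>t. cmod (h t)) integrable_on {a..t}"
      using t by (intro integrable_on_subinterval[OF hi]) auto
    have "cmod (G t - G a) \<le> integral {a..t} (\<lambda>s. M * cmod (h s))"
      unfolding integral_unique[OF I, symmetric]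
    proof (rule integral_norm_bound_integral)
      show "(\<lambda>s. M * cmod (h s)) integrable_on {a..t}"
        by (intro integrable_on_mult_right hit)
      fix s assume "s \<in> {a..t}"
      then have "cmod (wave (- z * of_real s)) \<le> W" using t by (intro Wt) auto
      then show "cmod (\<i> * 2 * of_real pi * wave (- z * of_real s) * h s) \<le> M * cmod (h s)"
        by (simp add: norm_mult M_def mult_right_mono)
    qed (use I in blast)
    also have "\<dots> = M * integral {a..t} (\<lambda>s. cmod (h s))" by simp
    also have "\<dots> \<le> M * H"
      unfolding H_def using t \<open>M > 0\<close> by (intro mult_left_mono integral_subset_le hi hit) auto
    finally show ?thesis .
  qed
  have "wave (z * of_real b) = wave (z * of_real a) * E"
    by (simp add: E_def algebra_simps flip: wave_add)
  then have "wave (z * of_real a) * G a = wave (z * of_real a) * (c * E * G b)"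
    using F FG[of a] FG[of b] by (simp add: bvp_def)
  then have "G a = c * E * G b" by simp
  then have "G a * (1 - c * E) = c * E * (G b - G a)" by (simp add: algebra_simps)
  then have "cmod (G a) * cmod (1 - c * E) = cmod E * cmod (G b - G a)"
    using assms(2) by (metis mult_1 norm_mult)
  moreover have "cmod (1 - c * E) > 0" using nonres by (simp add: E_def)
  ultimately have "cmod (G a) = cmod E / cmod (1 - c * E) * cmod (G b - G a)"
    by (simp add: field_simps)
  also have "\<dots> \<le> cmod E / cmod (1 - c * E) * (M * H)"
    using GG[of b] assms(1) by (intro mult_left_mono) auto
  finally have Ga: "cmod (G a) \<le> cmod E / cmod (1 - c * E) * (M * H)" .
  have "cmod (G t) \<le> cmod (G a) + cmod (G t - G a)"
    by (metis add.commute diff_add_cancel norm_triangle_ineq)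
  then have Gt: "cmod (G t) \<le> cmod E / cmod (1 - c * E) * (M * H) + M * H"
    using Ga GG[OF t] by linarith
  have "cmod (F t) \<le> W * (cmod E / cmod (1 - c * E) * (M * H) + M * H)"
    unfolding FG[of t] norm_mult using Wt(1)[OF t] Gt \<open>W > 0\<close> by (intro mult_mono) auto
  then show "cmod (F t) \<le> C * integral {a..b} (\<lambda>t. cmod (h t))"
    by (simp add: C_def H_def algebra_simps)
qed

lemma bvp_L2_bound:
  assumes "a < b" "cmod c = 1" and nonres: "c * wave (z * of_real (b - a)) \<noteq> 1"
  obtains D where "D \<ge> 0"
    "\<And>f g F. \<lbrakk>f \<in> L2 {a..b}; g \<in> L2 {a..b}; ae_eq {a..b} f F; bvp a b c F g\<rbrakk> \<Longrightarrow>
       integral\<^sup>L (lebesgue_on {a..b}) (\<lambda>t. (cmod (f t))\<^sup>2)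
         \<le> D * integral\<^sup>L (lebesgue_on {a..b}) (\<lambda>t. (cmod (g t - z * f t))\<^sup>2)"
proof -
  obtain C where C: "C \<ge> 0"
    "\<And>F h t. \<lbrakk>h \<in> L2 {a..b}; bvp a b c F (\<lambda>t. z * F t + h t); t \<in> {a..b}\<rbrakk> \<Longrightarrow>
       cmod (F t) \<le> C * integral {a..b} (\<lambda>t. cmod (h t))"
    by (rule bvp_bound[OF less_imp_le[OF \<open>a < b\<close>] assms(2) nonres]) auto
  show thesis
  proof (rule that[of "(b - a)\<^sup>2 * C\<^sup>2"])
    show "0 \<le> (b - a)\<^sup>2 * C\<^sup>2" by simp
    fix f g F assume f: "f \<in> L2 {a..b}" and g: "g \<in> L2 {a..b}" and fF: "ae_eq {a..b} f F" and F: "bvp a b c F g"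
    define h where "h t = g t - z * f t" for t
    define I where "I = integral {a..b} (\<lambda>t. cmod (h t))"
    have h: "h \<in> L2 {a..b}" unfolding h_def by (intro L2_diff L2_cmult f g)
    have "bvp a b c F (\<lambda>t. z * F t + h t)"
    proof (rule bvp_cong[OF F less_imp_le[OF \<open>a < b\<close>]])
      show "AE t in lebesgue_on {a..b}. z * F t + h t = g t"
        using fF unfolding ae_eq_def h_def by eventually_elim simp
    qed auto
    then have bound: "cmod (F t) \<le> C * I" if "t \<in> {a..b}" for t
      unfolding I_def by (rule C(2)[OF h _ that])
    have "integral\<^sup>L (lebesgue_on {a..b}) (\<lambda>t. (cmod (f t))\<^sup>2)
        \<le> integral\<^sup>L (lebesgue_on {a..b}) (\<lambda>t. (C * I)\<^sup>2)"
    proof (rule integral_mono_AE)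
      show "integrable (lebesgue_on {a..b}) (\<lambda>t. (cmod (f t))\<^sup>2)" using f by (simp add: L2_def)
      show "integrable (lebesgue_on {a..b}) (\<lambda>t. (C * I)\<^sup>2)"
        by (intro finite_measure.integrable_const finite_measure_lebesgue_on) auto
      show "AE t in lebesgue_on {a..b}. (cmod (f t))\<^sup>2 \<le> (C * I)\<^sup>2"
        using fF AE_space unfolding ae_eq_def
      proof eventually_elim
        case (elim t)
        then show ?case using bound[of t] by (intro power_mono) auto
      qed
    qed
    also have "\<dots> = (b - a) * C\<^sup>2 * I\<^sup>2"
      using \<open>a < b\<close> by (simp add: measure_restrict_space power_mult_distrib)
    also have "\<dots> \<le> (b - a) * C\<^sup>2 * ((b - a) * integral\<^sup>L (lebesgue_on {a..b}) (\<lambda>t. (cmod (h t))\<^sup>2))"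
      using L1_square_le_L2[OF \<open>a < b\<close> h] \<open>a < b\<close> unfolding I_def by (intro mult_left_mono) auto
    finally show "integral\<^sup>L (lebesgue_on {a..b}) (\<lambda>t. (cmod (f t))\<^sup>2)
         \<le> (b - a)\<^sup>2 * C\<^sup>2 * integral\<^sup>L (lebesgue_on {a..b}) (\<lambda>t. (cmod (g t - z * f t))\<^sup>2)"
      by (simp add: h_def power2_eq_square mult_ac)
  qed
qed

section \<open>Density of trigonometric polynomials\<close>

lemma unit_exp_add: "unit_exp (x + y) = unit_exp x * unit_exp y"
  by (simp add: unit_exp_eq_wave wave_add)

lemma norm_unit_exp [simp]: "cmod (unit_exp x) = 1"
  by (simp add: unit_exp_eq_wave norm_wave)

lemma unit_exp_0 [simp]: "unit_exp 0 = 1"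
  by (simp add: unit_exp_eq_wave)

lemma cnj_unit_exp: "cnj (unit_exp x) = unit_exp (- x)"
  by (simp add: unit_exp_def exp_cnj)

lemma continuous_on_unit_exp [continuous_intros]:
  "continuous_on S f \<Longrightarrow> continuous_on S (\<lambda>t. unit_exp (f t))"
  unfolding unit_exp_def by (intro continuous_intros)

text \<open>For \<open>M > 0\<close>, the radial retraction of the plane onto the disc of radius \<open>M\<close>.\<close>

definition clip :: "real \<Rightarrow> complex \<Rightarrow> complex" where
  "clip M z = of_real (M / max M (cmod z)) * z"

lemma clip_props:
  assumes "M > 0"
  shows "cmod (clip M z) \<le> M" "cmod (z - clip M z) \<le> cmod z" "cmod z \<le> M \<Longrightarrow> clip M z = z"
    "continuous_on UNIV (clip M)"
proof -
  have m: "max M (cmod z) > 0" using assms by (simp add: less_max_iff_disj)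
  have "cmod (clip M z) = M * (cmod z / max M (cmod z))"
    using assms m by (simp add: clip_def norm_mult norm_divide)
  also have "\<dots> \<le> M * 1"
    using assms m by (intro mult_left_mono) auto
  finally show "cmod (clip M z) \<le> M" by simp
  have r: "0 \<le> M / max M (cmod z)" "M / max M (cmod z) \<le> 1"
    using assms m by auto
  have "z - clip M z = of_real (1 - M / max M (cmod z)) * z"
    by (simp add: clip_def algebra_simps)
  then have "cmod (z - clip M z) = (1 - M / max M (cmod z)) * cmod z"
    using r by (simp only: norm_mult norm_of_real abs_of_nonneg diff_ge_0_iff_ge)
  also have "\<dots> \<le> 1 * cmod z"
    using r by (intro mult_right_mono) auto
  finally show "cmod (z - clip M z) \<le> cmod z" by simp
  show "clip M z = z" if "cmod z \<le> M"
    using that assms by (simp add: clip_def max_def)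
  have "max M (cmod w) \<noteq> 0" for w
    using assms max.cobounded1[of M "cmod w"] by linarith
  then show "continuous_on UNIV (clip M)"
    unfolding clip_def by (intro continuous_intros) auto
qed

text \<open>Dominated convergence, with \<open>\<bar>h\<bar>\<^sup>2\<close> as the dominating function.\<close>

lemma L2_approx_bounded:
  assumes h: "h \<in> L2 S" and "\<epsilon> > 0"
  obtains M where "M > 0" "(\<lambda>t. clip M (h t)) \<in> L2 S"
    "integral\<^sup>L (lebesgue_on S) (\<lambda>t. (cmod (h t - clip M (h t)))\<^sup>2) < \<epsilon>"
proof -
  have meas: "h \<in> borel_measurable (lebesgue_on S)" using h by (simp add: L2_def)
  have cm: "(\<lambda>t. clip M (h t)) \<in> borel_measurable (lebesgue_on S)" if "M > 0" for M
    using borel_measurable_continuous_onI[OF clip_props(4)[OF that]] meas by measurable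
  have "(\<lambda>n. integral\<^sup>L (lebesgue_on S) (\<lambda>t. (cmod (h t - clip (real (Suc n)) (h t)))\<^sup>2))
      \<longlonglongrightarrow> integral\<^sup>L (lebesgue_on S) (\<lambda>t. 0)"
  proof (rule integral_dominated_convergence[where w = "\<lambda>t. (cmod (h t))\<^sup>2"])
    show "integrable (lebesgue_on S) (\<lambda>t. (cmod (h t))\<^sup>2)" using h by (simp add: L2_def)
    show "(\<lambda>t. (cmod (h t - clip (real (Suc n)) (h t)))\<^sup>2) \<in> borel_measurable (lebesgue_on S)" for n
      using cm[of "real (Suc n)"] meas by (intro borel_measurable_power borel_measurable_norm borel_measurable_diff) auto
    show "AE t in lebesgue_on S. (\<lambda>n. (cmod (h t - clip (real (Suc n)) (h t)))\<^sup>2) \<longlonglongrightarrow> 0"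
    proof (rule AE_I2)
      fix t
      obtain N where N: "cmod (h t) \<le> real N" using real_arch_simple by blast
      have "(cmod (h t - clip (real (Suc n)) (h t)))\<^sup>2 = 0" if "n \<ge> N" for n
        using clip_props(3)[of "real (Suc n)" "h t"] N that by simp
      then show "(\<lambda>n. (cmod (h t - clip (real (Suc n)) (h t)))\<^sup>2) \<longlonglongrightarrow> 0"
        by (intro tendsto_eventually eventually_sequentiallyI[of N])
    qed
    show "AE t in lebesgue_on S. norm ((cmod (h t - clip (real (Suc n)) (h t)))\<^sup>2) \<le> (cmod (h t))\<^sup>2" for n
      using clip_props(2)[of "real (Suc n)"] by (intro AE_I2) (simp add: power_mono)
  qed simp
  then have "\<forall>\<^sub>F n in sequentially. integral\<^sup>L (lebesgue_on S) (\<lambda>t. (cmod (h t - clip (real (Suc n)) (h t)))\<^sup>2) < \<epsilon>"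
    using \<open>\<epsilon> > 0\<close> by (intro order_tendstoD(2)) auto
  then obtain n where n: "integral\<^sup>L (lebesgue_on S) (\<lambda>t. (cmod (h t - clip (real (Suc n)) (h t)))\<^sup>2) < \<epsilon>"
    by (auto simp: eventually_sequentially)
  show thesis
  proof (rule that[OF _ _ n])
    have "integrable (lebesgue_on S) (\<lambda>t. (cmod (h t - clip (real (Suc n)) (h t)))\<^sup>2)"
    proof (rule Bochner_Integration.integrable_bound[where f = "\<lambda>t. (cmod (h t))\<^sup>2"])
      show "integrable (lebesgue_on S) (\<lambda>t. (cmod (h t))\<^sup>2)" using h by (simp add: L2_def)
      show "(\<lambda>t. (cmod (h t - clip (real (Suc n)) (h t)))\<^sup>2) \<in> borel_measurable (lebesgue_on S)"
        using cm[of "real (Suc n)"] meas by (intro borel_measurable_power borel_measurable_norm borel_measurable_diff) auto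
      show "AE t in lebesgue_on S. norm ((cmod (h t - clip (real (Suc n)) (h t)))\<^sup>2) \<le> norm ((cmod (h t))\<^sup>2)"
        using clip_props(2)[of "real (Suc n)"] by (intro AE_I2) (simp add: power_mono)
    qed
    then have "(\<lambda>t. h t - clip (real (Suc n)) (h t)) \<in> L2 S"
      using cm[of "real (Suc n)"] meas by (auto simp: L2_def)
    from L2_diff[OF h this] show "(\<lambda>t. clip (real (Suc n)) (h t)) \<in> L2 S" by simp
  qed simp
qed

text \<open>A measurable function is an almost everywhere limit of continuous functions \<open>G n\<close>.  Clipping them
  at the level of a bounded approximation of \<open>h\<close> makes dominated convergence applicable, and the cutoff
  functions \<open>\<phi> n\<close> enforce zeros at the end points without affecting the limit inside.\<close>

lemma L2_approx_continuous:
  assumes "a < b" and h: "h \<in> L2 {a..b}" and "\<epsilon> > 0"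
  obtains g where "continuous_on {a..b} g" "g a = 0" "g b = 0"
    "integral\<^sup>L (lebesgue_on {a..b}) (\<lambda>t. (cmod (h t - g t))\<^sup>2) < \<epsilon>"
proof -
  let ?\<mu> = "lebesgue_on {a..b}"
  obtain M where M: "M > 0" "(\<lambda>t. clip M (h t)) \<in> L2 {a..b}"
    "integral\<^sup>L ?\<mu> (\<lambda>t. (cmod (h t - clip M (h t)))\<^sup>2) < \<epsilon> / 4"
    by (rule L2_approx_bounded[OF h, of "\<epsilon> / 4"]) (use \<open>\<epsilon> > 0\<close> in auto)
  have "h measurable_on {a..b}"
    using h by (simp add: measurable_on_iff_borel_measurable L2_def)
  then obtain N G where N: "negligible N" and G: "\<And>n. continuous_on UNIV (G n)"
    "\<And>t. t \<notin> N \<Longrightarrow> (\<lambda>n. G n t) \<longlonglongrightarrow> (if t \<in> {a..b} then h t else 0)"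
    unfolding measurable_on_def by metis
  define \<phi> where "\<phi> n t = min 1 (real n * min (t - a) (b - t))" for n :: nat and t
  define k where "k n t = of_real (\<phi> n t) * clip M (G n t)" for n t
  have kc: "continuous_on {a..b} (k n)" for n
  proof -
    have "continuous_on {a..b} (\<lambda>t. clip M (G n t))"
      by (intro continuous_on_compose2[OF clip_props(4)[OF M(1)] continuous_on_subset[OF G(1)]]) auto
    then show ?thesis
      unfolding k_def \<phi>_def by (intro continuous_intros)
  qed
  have k0: "k n a = 0" "k n b = 0" for n
    using \<open>a < b\<close> by (simp_all add: k_def \<phi>_def)
  have \<phi>: "0 \<le> \<phi> n t" "\<phi> n t \<le> 1" if "t \<in> {a..b}" for n t
    using that by (auto simp: \<phi>_def)
  have kb: "cmod (k n t) \<le> M" if "t \<in> {a..b}" for n t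
  proof -
    have "cmod (k n t) = \<phi> n t * cmod (clip M (G n t))"
      using \<phi>[OF that] by (simp add: k_def norm_mult)
    also have "\<dots> \<le> 1 * M"
      using \<phi>[OF that] clip_props(1)[OF M(1)] M(1) by (intro mult_mono) auto
    finally show ?thesis by simp
  qed
  have "(\<lambda>n. integral\<^sup>L ?\<mu> (\<lambda>t. (cmod (clip M (h t) - k n t))\<^sup>2)) \<longlonglongrightarrow> integral\<^sup>L ?\<mu> (\<lambda>t. 0)"
  proof (rule integral_dominated_convergence[where w = "\<lambda>t. (2 * M)\<^sup>2"])
    show "integrable ?\<mu> (\<lambda>t. (2 * M)\<^sup>2)"
      by (intro finite_measure.integrable_const finite_measure_lebesgue_on) auto
    show "(\<lambda>t. (cmod (clip M (h t) - k n t))\<^sup>2) \<in> borel_measurable ?\<mu>" for n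
    proof -
      have "k n \<in> borel_measurable ?\<mu>" "(\<lambda>t. clip M (h t)) \<in> borel_measurable ?\<mu>"
        using M(2) continuous_imp_L2[OF kc[of n]] by (simp_all add: L2_def)
      then show ?thesis by measurable
    qed
    show "AE t in ?\<mu>. (\<lambda>n. (cmod (clip M (h t) - k n t))\<^sup>2) \<longlonglongrightarrow> 0"
    proof (rule AE_lebesgue_on_iff_negligible[THEN iffD2], simp, intro exI[of _ "N \<union> {a, b}"] conjI ballI)
      show "negligible (N \<union> {a, b})" using N by auto
      fix t assume t: "t \<in> {a..b} - (N \<union> {a, b})"
      then have t': "a < t" "t < b" "t \<notin> N" by auto
      have "(\<lambda>n. G n t) \<longlonglongrightarrow> h t" using G(2)[OF t'(3)] t by simp
      then have "(\<lambda>n. clip M (G n t)) \<longlonglongrightarrow> clip M (h t)"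
        using clip_props(4)[OF M(1)] by (intro continuous_on_tendsto_compose[of UNIV "clip M"]) auto
      moreover have "\<forall>\<^sub>F n in sequentially. \<phi> n t = 1"
      proof -
        define r where "r = min (t - a) (b - t)"
        have r: "r > 0" using t' by (simp add: r_def)
        obtain n0 :: nat where "1 / r \<le> real n0" using real_arch_simple by blast
        then have "1 \<le> real n * r" if "n \<ge> n0" for n
        proof -
          have "1 / r \<le> real n" using \<open>1 / r \<le> real n0\<close> that by linarith
          then show ?thesis using r by (simp add: field_simps)
        qed
        then show ?thesis
          by (intro eventually_sequentiallyI[of n0]) (simp add: \<phi>_def r_def)
      qed
      then have "(\<lambda>n. complex_of_real (\<phi> n t)) \<longlonglongrightarrow> 1"
        by (intro tendsto_eventually) (auto elim: eventually_mono)
      ultimately have "(\<lambda>n. k n t) \<longlonglongrightarrow> 1 * clip M (h t)"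
        unfolding k_def by (intro tendsto_mult)
      then have "(\<lambda>n. (cmod (clip M (h t) - k n t))\<^sup>2) \<longlonglongrightarrow> (cmod (clip M (h t) - 1 * clip M (h t)))\<^sup>2"
        by (intro tendsto_intros)
      then show "(\<lambda>n. (cmod (clip M (h t) - k n t))\<^sup>2) \<longlonglongrightarrow> 0" by simp
    qed
    show "AE t in ?\<mu>. norm ((cmod (clip M (h t) - k n t))\<^sup>2) \<le> (2 * M)\<^sup>2" for n
    proof (rule AE_I2)
      fix t assume "t \<in> space ?\<mu>"
      then have "cmod (k n t) \<le> M" using kb by simp
      moreover have "cmod (clip M (h t)) \<le> M" by (rule clip_props(1)[OF M(1)])
      ultimately have "cmod (clip M (h t) - k n t) \<le> 2 * M"
        using norm_triangle_ineq4[of "clip M (h t)" "k n t"] by linarith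
      then have "(cmod (clip M (h t) - k n t))\<^sup>2 \<le> (2 * M)\<^sup>2"
        by (intro power_mono) auto
      then show "norm ((cmod (clip M (h t) - k n t))\<^sup>2) \<le> (2 * M)\<^sup>2" by simp
    qed
  qed simp
  then have "\<forall>\<^sub>F n in sequentially. integral\<^sup>L ?\<mu> (\<lambda>t. (cmod (clip M (h t) - k n t))\<^sup>2) < \<epsilon> / 4"
    using \<open>\<epsilon> > 0\<close> by (intro order_tendstoD(2)) auto
  then obtain n where n: "integral\<^sup>L ?\<mu> (\<lambda>t. (cmod (clip M (h t) - k n t))\<^sup>2) < \<epsilon> / 4"
    by (auto simp: eventually_sequentially)
  have "integral\<^sup>L ?\<mu> (\<lambda>t. (cmod (h t - k n t))\<^sup>2) < \<epsilon>"
    using L2_triangle_square[OF h M(2) continuous_imp_L2[OF kc[of n]]] M(3) n by linarith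
  with that kc k0 show thesis by blast
qed

inductive trig_polynomial :: "real \<Rightarrow> (real \<Rightarrow> complex) \<Rightarrow> bool" for L :: real where
  monomial: "trig_polynomial L (\<lambda>t. K * unit_exp (of_int n / L * t))"
| add: "\<lbrakk>trig_polynomial L p; trig_polynomial L q\<rbrakk> \<Longrightarrow> trig_polynomial L (\<lambda>t. p t + q t)"

lemma trig_polynomial_const: "trig_polynomial L (\<lambda>t. K)"
  using trig_polynomial.monomial[of L K 0] by simp

lemma trig_polynomial_mult:
  assumes "trig_polynomial L p" "trig_polynomial L q"
  shows "trig_polynomial L (\<lambda>t. p t * q t)"
  using assms(1)
proof induction
  case (monomial K n)
  show ?case using assms(2)
  proof induction
    case (monomial J m)
    have "(\<lambda>t. K * unit_exp (of_int n / L * t) * (J * unit_exp (of_int m / L * t)))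
        = (\<lambda>t. K * J * unit_exp (of_int (n + m) / L * t))"
      by (simp add: add_divide_distrib distrib_right unit_exp_add) (simp add: mult_ac)
    then show ?case by (metis trig_polynomial.monomial)
  next
    case (add p q)
    then show ?case using trig_polynomial.add by (simp add: distrib_left)
  qed
next
  case (add p1 p2)
  then show ?case using trig_polynomial.add by (simp add: distrib_right)
qed

text \<open>On the circle a real linear function of \<open>z\<close> is a combination of \<open>z\<close> and \<open>cnj z\<close>, that is, up to
  constant factors, of the exponentials of frequency \<open>1 / L\<close> and \<open>- 1 / L\<close>.\<close>

lemma trig_polynomial_real_polynomial:
  assumes "real_polynomial_function q"
  shows "trig_polynomial L (\<lambda>t. of_real (q (unit_exp ((t - a) / L))))"
  using assms
proof induction
  case (linear f)
  define A where "A = (of_real (f 1) - \<i> * of_real (f \<i>)) / 2"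
  define B where "B = (of_real (f 1) + \<i> * of_real (f \<i>)) / 2"
  have f: "of_real (f z) = A * z + B * cnj z" for z
  proof -
    have "f z = f (Re z *\<^sub>R 1 + Im z *\<^sub>R \<i>)"
      by (rule arg_cong[of _ _ f]) (simp add: complex_eq_iff)
    also have "\<dots> = Re z * f 1 + Im z * f \<i>"
      using linear by (simp add: bounded_linear.linear linear_add linear_scale)
    finally show ?thesis
      by (simp add: A_def B_def complex_eq_iff algebra_simps) (simp add: field_simps)
  qed
  have u: "unit_exp ((t - a) / L) = unit_exp (- a / L) * unit_exp (of_int 1 / L * t)" for t
    by (simp add: diff_divide_distrib flip: unit_exp_add)
  have cu: "cnj (unit_exp ((t - a) / L)) = unit_exp (a / L) * unit_exp (of_int (- 1) / L * t)" for t
    by (simp add: cnj_unit_exp diff_divide_distrib flip: unit_exp_add)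
  have "trig_polynomial L (\<lambda>t. A * unit_exp (- a / L) * unit_exp (of_int 1 / L * t)
      + B * unit_exp (a / L) * unit_exp (of_int (- 1) / L * t))"
    by (intro trig_polynomial.intros)
  then show ?case
    unfolding f cu by (simp add: u mult.assoc)
next
  case (const c)
  show ?case by (rule trig_polynomial_const)
next
  case (add f g)
  then show ?case by (simp add: trig_polynomial.add)
next
  case (mult f g)
  then show ?case by (simp add: trig_polynomial_mult)
qed

text \<open>A function \<open>g\<close> with equal values at the end points factors through the map \<open>u\<close> of the interval onto the circle,
  and the factor \<open>\<phi>\<close> is continuous because its graph is compact.  Stone--Weierstrass on the circle
  approximates \<open>\<phi>\<close> by a polynomial in the real and imaginary parts.\<close>

lemma trig_polynomial_uniformly_dense:
  assumes "a < b" and g: "continuous_on {a..b} g" "g a = g b" and "\<epsilon> > 0"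
  obtains p where "trig_polynomial (b - a) p" "\<And>t. t \<in> {a..b} \<Longrightarrow> cmod (g t - p t) < \<epsilon>"
proof -
  define L where "L = b - a"
  have L: "L > 0" using \<open>a < b\<close> by (simp add: L_def)
  define u where "u t = unit_exp ((t - a) / L)" for t
  have uc: "continuous_on {a..b} u"
    unfolding u_def using L by (intro continuous_intros) auto
  have inj: "g s = g t" if st: "s \<in> {a..b}" "t \<in> {a..b}" "u s = u t" for s t
  proof -
    have "u s = u t * unit_exp ((s - t) / L)"
      unfolding u_def by (simp add: diff_divide_distrib flip: unit_exp_add)
    moreover have "u t \<noteq> 0" by (simp add: u_def unit_exp_eq_wave)
    ultimately have "wave (of_real ((s - t) / L)) = 1"
      using st(3) by (simp add: unit_exp_eq_wave)
    then obtain n :: int where "complex_of_real ((s - t) / L) = of_int n"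
      by (auto simp: wave_eq_1_iff)
    then have "complex_of_real ((s - t) / L) = complex_of_real (of_int n)" by simp
    then have "(s - t) / L = of_int n" by (simp only: of_real_eq_iff)
    then have n: "s - t = of_int n * L" using L by (simp add: field_simps)
    \<comment> \<open>Points with the same image differ by a multiple of the period \<open>L\<close>, hence are equal or the two end points.\<close>
    have "\<bar>s - t\<bar> \<le> L" using st by (auto simp: L_def)
    then have "\<bar>real_of_int n\<bar> \<le> 1" using L by (simp add: n abs_mult)
    then have "n = - 1 \<or> n = 0 \<or> n = 1" by linarith
    moreover have "s = a \<and> t = b" if "n = - 1" using that n st by (auto simp: L_def)
    moreover have "s = b \<and> t = a" if "n = 1" using that n st by (auto simp: L_def)
    ultimately show ?thesis using g(2) n by auto
  qed
  define \<phi> where "\<phi> z = g (SOME t. t \<in> {a..b} \<and> u t = z)" for z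
  have \<phi>: "\<phi> (u t) = g t" if "t \<in> {a..b}" for t
  proof -
    have "(SOME s. s \<in> {a..b} \<and> u s = u t) \<in> {a..b} \<and> u (SOME s. s \<in> {a..b} \<and> u s = u t) = u t"
      by (rule someI[of _ t]) (use that in simp)
    then show ?thesis unfolding \<phi>_def using that by (intro inj) auto
  qed
  have "continuous_on (u ` {a..b}) \<phi>"
  proof (rule continuous_from_closed_graph)
    show "compact (g ` {a..b})"
      by (intro compact_continuous_image g compact_Icc)
    show "\<phi> \<in> u ` {a..b} \<rightarrow> g ` {a..b}" using \<phi> by auto
    have "(\<lambda>z. (z, \<phi> z)) ` u ` {a..b} = (\<lambda>t. (u t, g t)) ` {a..b}"
      unfolding image_image using \<phi> by (intro image_cong) auto
    moreover have "compact ((\<lambda>t. (u t, g t)) ` {a..b})"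
      by (intro compact_continuous_image continuous_intros g uc compact_Icc)
    ultimately show "closed ((\<lambda>z. (z, \<phi> z)) ` u ` {a..b})"
      by (simp add: compact_imp_closed)
  qed
  moreover have "compact (u ` {a..b})"
    by (intro compact_continuous_image uc compact_Icc)
  ultimately obtain q where q: "polynomial_function q" "\<And>z. z \<in> u ` {a..b} \<Longrightarrow> cmod (\<phi> z - q z) < \<epsilon>"
    using Stone_Weierstrass_polynomial_function[of "u ` {a..b}" \<phi> \<epsilon>] \<open>\<epsilon> > 0\<close> by auto
  have "real_polynomial_function (\<lambda>z. Re (q z))" "real_polynomial_function (\<lambda>z. Im (q z))"
    using q(1) bounded_linear_Re bounded_linear_Im unfolding polynomial_function_def o_def by blast+
  then have "trig_polynomial L (\<lambda>t. of_real (Re (q (u t))) + \<i> * of_real (Im (q (u t))))"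
    unfolding u_def
    by (intro trig_polynomial.add trig_polynomial_mult trig_polynomial_const trig_polynomial_real_polynomial)
  then have "trig_polynomial (b - a) (\<lambda>t. q (u t))"
    by (simp add: L_def flip: complex_eq)
  moreover have "cmod (g t - q (u t)) < \<epsilon>" if "t \<in> {a..b}" for t
    using q(2)[of "u t"] \<phi>[OF that] that by auto
  ultimately show thesis using that by blast
qed

text \<open>The factor \<open>unit_exp (\<mu> * t)\<close> has modulus one, so approximating \<open>h\<close> amounts to approximating
  \<open>unit_exp (- \<mu> * t) * h t\<close>; it shifts the frequencies to those compatible with a quasi-periodic condition.\<close>

lemma trig_polynomial_L2_dense:
  assumes "a < b" and h: "h \<in> L2 {a..b}" and "\<epsilon> > 0"
  obtains p where "trig_polynomial (b - a) p"
    "integral\<^sup>L (lebesgue_on {a..b}) (\<lambda>t. (cmod (h t - unit_exp (\<mu> * t) * p t))\<^sup>2) < \<epsilon>"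
proof -
  let ?\<mu> = "lebesgue_on {a..b}"
  obtain g where g: "continuous_on {a..b} g" "g a = 0" "g b = 0"
    "integral\<^sup>L ?\<mu> (\<lambda>t. (cmod (h t - g t))\<^sup>2) < \<epsilon> / 4"
    by (rule L2_approx_continuous[OF \<open>a < b\<close> h, of "\<epsilon> / 4"]) (use \<open>\<epsilon> > 0\<close> in auto)
  \<comment> \<open>A uniform error \<open>e\<close> contributes \<open>e\<^sup>2 * (b - a)\<close> to the integral of the squared error.\<close>
  define e where "e = sqrt (\<epsilon> / (4 * (b - a)))"
  have e: "e > 0" "e\<^sup>2 * (b - a) = \<epsilon> / 4"
    using \<open>a < b\<close> \<open>\<epsilon> > 0\<close> by (simp_all add: e_def) (simp add: field_simps)
  have "continuous_on {a..b} (\<lambda>t. unit_exp (- \<mu> * t) * g t)"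
    by (intro continuous_intros g)
  then obtain p where p: "trig_polynomial (b - a) p"
    "\<And>t. t \<in> {a..b} \<Longrightarrow> cmod (unit_exp (- \<mu> * t) * g t - p t) < e"
    using trig_polynomial_uniformly_dense[OF \<open>a < b\<close>, of "\<lambda>t. unit_exp (- \<mu> * t) * g t" e] g e by auto
  have pc: "continuous_on {a..b} p"
    using p(1) by induction (intro continuous_intros; simp)+
  then have epc: "continuous_on {a..b} (\<lambda>t. unit_exp (\<mu> * t) * p t)"
    by (intro continuous_intros)
  have close: "(cmod (g t - unit_exp (\<mu> * t) * p t))\<^sup>2 \<le> e\<^sup>2" if "t \<in> {a..b}" for t
  proof -
    have "g t - unit_exp (\<mu> * t) * p t = unit_exp (\<mu> * t) * (unit_exp (- \<mu> * t) * g t - p t)"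
      by (simp add: algebra_simps flip: unit_exp_add mult.assoc)
    then have "cmod (g t - unit_exp (\<mu> * t) * p t) = cmod (unit_exp (- \<mu> * t) * g t - p t)"
      by (simp only: norm_mult norm_unit_exp mult_1)
    then show ?thesis using p(2)[OF that] by (intro power_mono) auto
  qed
  have gL: "g \<in> L2 {a..b}" and eL: "(\<lambda>t. unit_exp (\<mu> * t) * p t) \<in> L2 {a..b}"
    using g(1) epc by (auto intro: continuous_imp_L2)
  have "integral\<^sup>L ?\<mu> (\<lambda>t. (cmod (g t - unit_exp (\<mu> * t) * p t))\<^sup>2) \<le> integral\<^sup>L ?\<mu> (\<lambda>t. e\<^sup>2)"
    using close by (intro integral_mono' finite_measure.integrable_const finite_measure_lebesgue_on) auto
  also have "\<dots> = \<epsilon> / 4"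
    using e(2) \<open>a < b\<close> by (simp add: measure_restrict_space mult.commute)
  finally have "integral\<^sup>L ?\<mu> (\<lambda>t. (cmod (h t - unit_exp (\<mu> * t) * p t))\<^sup>2) < \<epsilon>"
    using L2_triangle_square[OF h gL eL] g(4) by linarith
  with that p(1) show thesis by blast
qed

section \<open>Integration over a disjoint union\<close>

lemma AE_lebesgue_on_Un:
  assumes "A \<in> sets lebesgue" "B \<in> sets lebesgue"
  shows "(AE t in lebesgue_on (A \<union> B). P t) \<longleftrightarrow>
    (AE t in lebesgue_on A. P t) \<and> (AE t in lebesgue_on B. P t)"
  using assms by (auto simp: AE_restrict_space_iff elim: eventually_elim2)

lemma L2_Un_iff:
  assumes A: "A \<in> sets lebesgue" and B: "B \<in> sets lebesgue"
  shows "f \<in> L2 (A \<union> B) \<longleftrightarrow> f \<in> L2 A \<and> f \<in> L2 B"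
proof
  assume f: "f \<in> L2 (A \<union> B)"
  have "f \<in> L2 C" if "C \<in> sets lebesgue" "C \<subseteq> A \<union> B" for C
  proof -
    have "set_integrable lebesgue (A \<union> B) (\<lambda>t. (cmod (f t))\<^sup>2)"
      using f A B by (simp add: L2_def integrable_restrict_space set_integrable_def)
    then have "set_integrable lebesgue C (\<lambda>t. (cmod (f t))\<^sup>2)"
      by (rule set_integrable_subset) (use that in auto)
    then have "integrable (lebesgue_on C) (\<lambda>t. (cmod (f t))\<^sup>2)"
      using that by (simp add: integrable_restrict_space set_integrable_def)
    moreover have "f \<in> borel_measurable (lebesgue_on C)"
      using f that by (auto simp: L2_def intro: measurable_restrict_mono)
    ultimately show ?thesis by (simp add: L2_def)
  qed
  then show "f \<in> L2 A \<and> f \<in> L2 B" using A B by blast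
next
  assume f: "f \<in> L2 A \<and> f \<in> L2 B"
  have "set_integrable lebesgue (A \<union> B) (\<lambda>t. (cmod (f t))\<^sup>2)"
    using f A B by (intro set_integrable_Un) (auto simp: L2_def integrable_restrict_space set_integrable_def)
  then have "integrable (lebesgue_on (A \<union> B)) (\<lambda>t. (cmod (f t))\<^sup>2)"
    using A B by (simp add: integrable_restrict_space set_integrable_def)
  moreover have "f \<in> borel_measurable (lebesgue_on (A \<union> B))"
  proof -
    have AB: "(\<lambda>t. indicat_real A t *\<^sub>R f t) \<in> borel_measurable lebesgue"
      "(\<lambda>t. indicat_real B t *\<^sub>R f t) \<in> borel_measurable lebesgue"
      using f A B by (simp_all add: L2_def borel_measurable_restrict_space_iff)
    have compl: "(\<lambda>t. 1 - indicat_real A t) \<in> borel_measurable lebesgue"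
      using A by (intro borel_measurable_diff) auto
    have "(\<lambda>t. indicat_real A t *\<^sub>R f t + (1 - indicat_real A t) *\<^sub>R (indicat_real B t *\<^sub>R f t))
        \<in> borel_measurable lebesgue"
      by (rule borel_measurable_add[OF AB(1) borel_measurable_scaleR[OF compl AB(2)]])
    also have "(\<lambda>t. indicat_real A t *\<^sub>R f t + (1 - indicat_real A t) *\<^sub>R (indicat_real B t *\<^sub>R f t))
        = (\<lambda>t. indicat_real (A \<union> B) t *\<^sub>R f t)"
      by (auto simp: indicator_def)
    finally show ?thesis
      using A B by (simp add: borel_measurable_restrict_space_iff)
  qed
  ultimately show "f \<in> L2 (A \<union> B)" by (simp add: L2_def)
qed

lemma integral_lebesgue_on_Un:
  fixes f :: "'a::euclidean_space \<Rightarrow> 'b::{banach, second_countable_topology}"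
  assumes A: "A \<in> sets lebesgue" and B: "B \<in> sets lebesgue" and "A \<inter> B = {}"
    and f: "integrable (lebesgue_on (A \<union> B)) f"
  shows "integrable (lebesgue_on A) f" "integrable (lebesgue_on B) f"
    "integral\<^sup>L (lebesgue_on (A \<union> B)) f = integral\<^sup>L (lebesgue_on A) f + integral\<^sup>L (lebesgue_on B) f"
proof -
  have AB: "set_integrable lebesgue (A \<union> B) f"
    using f A B by (simp add: integrable_restrict_space set_integrable_def)
  have sA: "set_integrable lebesgue A f" by (rule set_integrable_subset[OF AB]) (use A in auto)
  have sB: "set_integrable lebesgue B f" by (rule set_integrable_subset[OF AB]) (use B in auto)
  show "integrable (lebesgue_on A) f" "integrable (lebesgue_on B) f"
    using sA sB A B by (simp_all add: integrable_restrict_space set_integrable_def)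
  show "integral\<^sup>L (lebesgue_on (A \<union> B)) f = integral\<^sup>L (lebesgue_on A) f + integral\<^sup>L (lebesgue_on B) f"
    using set_integral_Un[OF assms(3) sA sB] A B
    by (simp add: set_lebesgue_integral_def integral_restrict_space)
qed

section \<open>Selfadjointness, spectrum and multiplicity\<close>

lemma L2_inner_integrable:
  assumes f: "f \<in> L2 S" and g: "g \<in> L2 S"
  shows "integrable (lebesgue_on S) (\<lambda>t. f t * cnj (g t))"
proof (rule Bochner_Integration.integrable_bound[where f = "\<lambda>t. (cmod (f t))\<^sup>2 + (cmod (g t))\<^sup>2"])
  show "integrable (lebesgue_on S) (\<lambda>t. (cmod (f t))\<^sup>2 + (cmod (g t))\<^sup>2)"
    using f g by (auto simp: L2_def)
  have "f \<in> borel_measurable (lebesgue_on S)" "g \<in> borel_measurable (lebesgue_on S)"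
    using f g by (auto simp: L2_def)
  moreover have "(\<lambda>t. cnj (g t)) \<in> borel_measurable (lebesgue_on S)"
    using calculation(2)
    by (rule measurable_compose) (intro borel_measurable_continuous_onI continuous_intros)
  ultimately show "(\<lambda>t. f t * cnj (g t)) \<in> borel_measurable (lebesgue_on S)"
    by (intro borel_measurable_times)
  have "x * y \<le> x\<^sup>2 + y\<^sup>2" if "x \<ge> 0" "y \<ge> 0" for x y :: real
    using sum_squares_bound[of x y] that mult_nonneg_nonneg[of x y] by linarith
  then show "AE t in lebesgue_on S. norm (f t * cnj (g t)) \<le> norm ((cmod (f t))\<^sup>2 + (cmod (g t))\<^sup>2)"
    by (simp add: norm_mult)
qed

lemma L2_inner_diff_right:
  assumes "f \<in> L2 S" "g \<in> L2 S" "h \<in> L2 S"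
  shows "L2_inner S f (\<lambda>t. g t - h t) = L2_inner S f g - L2_inner S f h"
proof -
  have "L2_inner S f (\<lambda>t. g t - h t)
      = integral\<^sup>L (lebesgue_on S) (\<lambda>t. f t * cnj (g t) - f t * cnj (h t))"
    by (simp add: L2_inner_def algebra_simps)
  then show ?thesis
    using assms by (simp add: L2_inner_def L2_inner_integrable)
qed

lemma L2_inner_add_left:
  assumes "f \<in> L2 S" "g \<in> L2 S" "h \<in> L2 S"
  shows "L2_inner S (\<lambda>t. f t + g t) h = L2_inner S f h + L2_inner S g h"
proof -
  have "L2_inner S (\<lambda>t. f t + g t) h
      = integral\<^sup>L (lebesgue_on S) (\<lambda>t. f t * cnj (h t) + g t * cnj (h t))"
    by (simp add: L2_inner_def algebra_simps)
  then show ?thesis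
    using assms by (simp add: L2_inner_def L2_inner_integrable)
qed

lemma L2_inner_cmult:
  "L2_inner S (\<lambda>t. k * f t) g = k * L2_inner S f g"
  "L2_inner S f (\<lambda>t. k * g t) = cnj k * L2_inner S f g"
proof -
  show "L2_inner S (\<lambda>t. k * f t) g = k * L2_inner S f g"
    by (simp add: L2_inner_def mult.assoc)
  have "L2_inner S f (\<lambda>t. k * g t) = integral\<^sup>L (lebesgue_on S) (\<lambda>t. cnj k * (f t * cnj (g t)))"
    by (simp add: L2_inner_def mult_ac)
  then show "L2_inner S f (\<lambda>t. k * g t) = cnj k * L2_inner S f g"
    by (simp add: L2_inner_def)
qed

lemma L2_inner_cong:
  assumes "f \<in> L2 S" "f' \<in> L2 S" "g \<in> L2 S" "g' \<in> L2 S" "ae_eq S f f'" "ae_eq S g g'"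
  shows "L2_inner S f g = L2_inner S f' g'"
  unfolding L2_inner_def
proof (rule integral_cong_AE)
  show "(\<lambda>t. f t * cnj (g t)) \<in> borel_measurable (lebesgue_on S)"
    "(\<lambda>t. f' t * cnj (g' t)) \<in> borel_measurable (lebesgue_on S)"
    by (intro borel_measurable_integrable L2_inner_integrable assms)+
  show "AE t in lebesgue_on S. f t * cnj (g t) = f' t * cnj (g' t)"
    using assms(5,6) unfolding ae_eq_def by eventually_elim simp
qed

lemma L2_norm_eq_0_iff:
  assumes "f \<in> L2 S"
  shows "L2_norm S f = 0 \<longleftrightarrow> ae_eq S f (\<lambda>t. 0)"
proof -
  have "L2_norm S f = 0 \<longleftrightarrow> integral\<^sup>L (lebesgue_on S) (\<lambda>t. (cmod (f t))\<^sup>2) = 0"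
    by (simp add: L2_norm_def)
  also have "\<dots> \<longleftrightarrow> (AE t in lebesgue_on S. (cmod (f t))\<^sup>2 = 0)"
    using assms by (intro integral_nonneg_eq_0_iff_AE) (auto simp: L2_def)
  finally show ?thesis by (simp add: ae_eq_def)
qed

lemma L2_norm_square: "(L2_norm S f)\<^sup>2 = integral\<^sup>L (lebesgue_on S) (\<lambda>t. (cmod (f t))\<^sup>2)"
  by (simp add: L2_norm_def)

lemma L2_inner_self: "L2_inner S f f = of_real ((L2_norm S f)\<^sup>2)"
  unfolding L2_norm_square L2_inner_def
  by (subst integral_complex_of_real[symmetric]) (simp only: complex_norm_square)

text \<open>The basic criterion.  If \<open>(g, h)\<close> is in the adjoint, surjectivity of \<open>T - \<i>\<close> gives \<open>(f, f')\<close> in \<open>T\<close> such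
  that the adjoint maps \<open>u = g - f\<close> to \<open>\<i> u\<close>; such a \<open>u\<close> is orthogonal to the range of \<open>T + \<i>\<close>,
  which is everything, so \<open>u = 0\<close>.\<close>

lemma selfadjointI:
  assumes T: "T \<subseteq> L2 S \<times> L2 S"
    and closed: "\<And>f g f' g'. \<lbrakk>(f, g) \<in> T; f' \<in> L2 S; g' \<in> L2 S; ae_eq S f' f; ae_eq S g' g\<rbrakk> \<Longrightarrow> (f', g') \<in> T"
    and symmetric: "\<And>f f' k k'. \<lbrakk>(f, f') \<in> T; (k, k') \<in> T\<rbrakk> \<Longrightarrow> L2_inner S f' k = L2_inner S f k'"
    and onto: "\<And>h z. \<lbrakk>h \<in> L2 S; z = \<i> \<or> z = - \<i>\<rbrakk> \<Longrightarrow> \<exists>(f, g)\<in>T. ae_eq S (\<lambda>t. g t - z * f t) h"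
    and dense: "densely_defined S T"
  shows "selfadjoint S T"
proof -
  have "(g, h) \<in> T" if gh: "(g, h) \<in> adjoint_graph S T" for g h
  proof -
    have g: "g \<in> L2 S" and h: "h \<in> L2 S"
      and adj: "\<And>k k'. (k, k') \<in> T \<Longrightarrow> L2_inner S k' g = L2_inner S k h"
      using gh by (auto simp: adjoint_graph_def)
    obtain f f' where f: "(f, f') \<in> T" "ae_eq S (\<lambda>t. f' t - \<i> * f t) (\<lambda>t. h t - \<i> * g t)"
      using onto[OF L2_diff[OF h L2_cmult[OF g, of \<i>]], of \<i>] by auto
    have fL: "f \<in> L2 S" "f' \<in> L2 S" using f(1) T by auto
    define u where "u t = g t - f t" for t
    have u: "u \<in> L2 S" unfolding u_def by (intro L2_diff g fL)
    obtain k k' where k: "(k, k') \<in> T" "ae_eq S (\<lambda>t. k' t - - \<i> * k t) u"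
      using onto[OF u, of "- \<i>"] by auto
    have kL: "k \<in> L2 S" "k' \<in> L2 S" using k(1) T by auto
    \<comment> \<open>The pair \<open>(u, \<i> u)\<close> is a difference of elements of the adjoint and of \<open>T\<close>.\<close>
    have hf: "ae_eq S (\<lambda>t. h t - f' t) (\<lambda>t. \<i> * u t)"
      using f(2) unfolding ae_eq_def
    proof eventually_elim
      case (elim t)
      then show ?case by (simp add: u_def algebra_simps)
    qed
    have "L2_inner S k' u = L2_inner S k' g - L2_inner S k' f"
      unfolding u_def by (rule L2_inner_diff_right[OF kL(2) g fL(1)])
    also have "\<dots> = L2_inner S k h - L2_inner S k f'"
      by (simp add: adj[OF k(1)] symmetric[OF k(1) f(1)])
    also have "\<dots> = L2_inner S k (\<lambda>t. h t - f' t)"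
      by (rule L2_inner_diff_right[symmetric, OF kL(1) h fL(2)])
    also have "\<dots> = L2_inner S k (\<lambda>t. \<i> * u t)"
      by (intro L2_inner_cong kL L2_diff h fL L2_cmult u hf) (simp add: ae_eq_def)
    also have "\<dots> = - \<i> * L2_inner S k u"
      by (simp add: L2_inner_cmult)
    finally have "L2_inner S (\<lambda>t. k' t + \<i> * k t) u = 0"
      using L2_inner_add_left[OF kL(2) L2_cmult[OF kL(1), of \<i>] u] by (simp add: L2_inner_cmult)
    moreover have "L2_inner S (\<lambda>t. k' t + \<i> * k t) u = L2_inner S u u"
      using k(2) by (intro L2_inner_cong L2_add kL L2_cmult u) (simp_all add: ae_eq_def)
    ultimately have "L2_norm S u = 0" by (simp add: L2_inner_self)
    then have u0: "ae_eq S u (\<lambda>t. 0)" using L2_norm_eq_0_iff[OF u] by simp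
    have "ae_eq S g f"
      using u0 unfolding ae_eq_def u_def by eventually_elim simp
    moreover have "ae_eq S h f'"
      using u0 hf unfolding ae_eq_def by eventually_elim simp
    ultimately show ?thesis using closed[OF f(1) g h] by simp
  qed
  moreover have "T \<subseteq> adjoint_graph S T"
    using T symmetric by (auto simp: adjoint_graph_def)
  ultimately show ?thesis
    using dense by (auto simp: selfadjoint_def)
qed

text \<open>The bound in the definition of the resolvent set would force the norm of \<open>f\<close> to vanish.\<close>

lemma eigenfunction_imp_spectrum:
  assumes "eigenfunction S T z f" "f \<in> L2 S"
  shows "z \<in> spectrum S T"
proof -
  have f: "(f, \<lambda>t. z * f t) \<in> T" "\<not> ae_eq S f (\<lambda>t. 0)"
    using assms(1) by (auto simp: eigenfunction_def eigenspace_def)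
  have "L2_norm S f \<noteq> 0"
    using f(2) L2_norm_eq_0_iff[OF assms(2)] by simp
  moreover have "L2_norm S f \<ge> 0" by (simp add: L2_norm_def)
  moreover have "L2_norm S f \<le> 0" if z: "z \<in> resolvent_set S T"
  proof -
    obtain C where "\<forall>(f, g)\<in>T. L2_norm S f \<le> C * L2_norm S (\<lambda>t. g t - z * f t)"
      using z unfolding resolvent_set_def by blast
    from bspec[OF this f(1)] show ?thesis by (simp add: L2_norm_def)
  qed
  ultimately show ?thesis
    unfolding spectrum_def by force
qed

lemma has_multiplicity_1I:
  assumes w: "w \<in> eigenspace T z"
    and ex: "\<And>f. f \<in> eigenspace T z \<Longrightarrow> \<exists>K. ae_eq S f (\<lambda>t. K * w t)"
    and unique: "\<And>f K K'. \<lbrakk>ae_eq S f (\<lambda>t. K * w t); ae_eq S f (\<lambda>t. K' * w t)\<rbrakk> \<Longrightarrow> K = K'"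
  shows "has_multiplicity S T z 1"
proof -
  have "\<exists>!c :: nat \<Rightarrow> complex. (\<forall>k\<ge>1. c k = 0) \<and> ae_eq S f (\<lambda>t. \<Sum>k<1. c k * w t)"
    if f: "f \<in> eigenspace T z" for f
  proof -
    obtain K where K: "ae_eq S f (\<lambda>t. K * w t)"
      using ex[OF f] by blast
    show ?thesis
    proof (rule ex1I[of _ "\<lambda>k. if k = 0 then K else 0"])
      show "(\<forall>k\<ge>(1::nat). (if k = 0 then K else 0) = 0) \<and>
          ae_eq S f (\<lambda>t. \<Sum>k<(1::nat). (if k = 0 then K else 0) * w t)"
        using K by simp
      fix c :: "nat \<Rightarrow> complex"
      assume c: "(\<forall>k\<ge>1. c k = 0) \<and> ae_eq S f (\<lambda>t. \<Sum>k<1. c k * w t)"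
      then have "c 0 = K" using unique[OF _ K, of "c 0"] by simp
      moreover have "k = 0 \<or> k \<ge> 1" for k :: nat by linarith
      ultimately show "c = (\<lambda>k. if k = 0 then K else 0)"
        using c by fastforce
    qed
  qed
  then show ?thesis
    unfolding has_multiplicity_def by (intro exI[of _ "\<lambda>_. w"] conjI ballI allI impI w)
qed

lemma has_multiplicity_2I:
  assumes v: "v \<in> eigenspace T z" and w: "w \<in> eigenspace T z"
    and ex: "\<And>f. f \<in> eigenspace T z \<Longrightarrow> \<exists>K L. ae_eq S f (\<lambda>t. K * v t + L * w t)"
    and unique: "\<And>f K L K' L'. \<lbrakk>ae_eq S f (\<lambda>t. K * v t + L * w t);
      ae_eq S f (\<lambda>t. K' * v t + L' * w t)\<rbrakk> \<Longrightarrow> K = K' \<and> L = L'"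
  shows "has_multiplicity S T z 2"
proof -
  define b where "b k = (if k = (0::nat) then v else w)" for k
  have b: "(\<Sum>k<2. c k * b k t) = c 0 * v t + c 1 * w t" for c t
    by (simp add: b_def numeral_2_eq_2)
  have "\<exists>!c :: nat \<Rightarrow> complex. (\<forall>k\<ge>2. c k = 0) \<and> ae_eq S f (\<lambda>t. \<Sum>k<2. c k * b k t)"
    if f: "f \<in> eigenspace T z" for f
  proof -
    obtain K L where K: "ae_eq S f (\<lambda>t. K * v t + L * w t)"
      using ex[OF f] by blast
    show ?thesis
    proof (rule ex1I[of _ "\<lambda>k. if k = 0 then K else if k = 1 then L else 0"])
      show "(\<forall>k\<ge>(2::nat). (if k = 0 then K else if k = 1 then L else 0) = 0) \<and>
          ae_eq S f (\<lambda>t. \<Sum>k<(2::nat). (if k = 0 then K else if k = 1 then L else 0) * b k t)"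
        unfolding b using K by simp
      fix c :: "nat \<Rightarrow> complex"
      assume c: "(\<forall>k\<ge>2. c k = 0) \<and> ae_eq S f (\<lambda>t. \<Sum>k<2. c k * b k t)"
      then have "c 0 = K \<and> c 1 = L" unfolding b using unique[OF _ K] by blast
      moreover have "k = 0 \<or> k = 1 \<or> k \<ge> 2" for k :: nat by linarith
      ultimately show "c = (\<lambda>k. if k = 0 then K else if k = 1 then L else 0)"
        using c by fastforce
    qed
  qed
  moreover have "b k \<in> eigenspace T z" for k using v w by (simp add: b_def)
  ultimately show ?thesis
    unfolding has_multiplicity_def by (intro exI[of _ b] conjI ballI allI impI)
qed

definition eigen_span :: "real set \<Rightarrow> l2_op \<Rightarrow> (real \<Rightarrow> complex) set" where
  "eigen_span S T = {v. \<exists>(n::nat) (c :: nat \<Rightarrow> complex) b.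
     (\<forall>k<n. \<exists>z. eigenfunction S T z (b k)) \<and> v = (\<lambda>t. \<Sum>k<n. c k * b k t)}"

lemma eigen_spanE:
  assumes "v \<in> eigen_span S T"
  obtains n :: nat and b c where "\<forall>k<n. \<exists>z. eigenfunction S T z (b k)" "\<And>t. v t = (\<Sum>k<n. c k * b k t)"
proof -
  from assms have "\<exists>(n::nat) c b. (\<forall>k<n. \<exists>z. eigenfunction S T z (b k)) \<and> v = (\<lambda>t. \<Sum>k<n. c k * b k t)"
    unfolding eigen_span_def mem_Collect_eq .
  then show thesis
    using that by auto
qed

lemma eigen_span_eigenfunction:
  "eigenfunction S T z f \<Longrightarrow> (\<lambda>t. K * f t) \<in> eigen_span S T"
  unfolding eigen_span_def
  by (rule CollectI, rule exI[of _ 1], rule exI[of _ "\<lambda>_. K"], rule exI[of _ "\<lambda>_. f"]) auto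

lemma eigen_span_add:
  assumes "v \<in> eigen_span S T" "w \<in> eigen_span S T"
  shows "(\<lambda>t. v t + w t) \<in> eigen_span S T"
proof -
  obtain n :: nat and b c where v: "\<forall>k<n. \<exists>z. eigenfunction S T z (b k)" "\<And>t. v t = (\<Sum>k<n. c k * b k t)"
    by (rule eigen_spanE[OF assms(1)]) auto
  obtain n' :: nat and b' c' where w: "\<forall>k<n'. \<exists>z. eigenfunction S T z (b' k)" "\<And>t. w t = (\<Sum>k<n'. c' k * b' k t)"
    by (rule eigen_spanE[OF assms(2)]) auto
  define C where "C k = (if k < n then c k else c' (k - n))" for k
  define B where "B k = (if k < n then b k else b' (k - n))" for k
  have "(\<Sum>k<n + n'. C k * B k t) = v t + w t" for t
  proof -
    have "(\<Sum>k<n + n'. C k * B k t) = (\<Sum>k<n. C k * B k t) + (\<Sum>k<n'. C (n + k) * B (n + k) t)"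
      by (induction n') (auto simp: add_ac)
    then show ?thesis by (simp add: C_def B_def v w)
  qed
  then have "(\<lambda>t. v t + w t) = (\<lambda>t. \<Sum>k<n + n'. C k * B k t)" by simp
  moreover have "\<forall>k<n + n'. \<exists>z. eigenfunction S T z (B k)"
    using v(1) w(1) by (auto simp: B_def)
  ultimately show ?thesis
    unfolding eigen_span_def mem_Collect_eq by (intro exI conjI)
qed

lemma eigenfunctions_totalI:
  assumes "\<And>h \<epsilon>. \<lbrakk>h \<in> L2 S; \<epsilon> > 0\<rbrakk> \<Longrightarrow>
    \<exists>v\<in>eigen_span S T. integral\<^sup>L (lebesgue_on S) (\<lambda>t. (cmod (h t - v t))\<^sup>2) < \<epsilon>"
  shows "eigenfunctions_total S T"
  unfolding eigenfunctions_total_def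
proof (intro ballI allI impI)
  fix h and \<epsilon> :: real assume h: "h \<in> L2 S" and e: "\<epsilon> > 0"
  obtain v where v: "v \<in> eigen_span S T" "integral\<^sup>L (lebesgue_on S) (\<lambda>t. (cmod (h t - v t))\<^sup>2) < \<epsilon>\<^sup>2"
    using assms[OF h, of "\<epsilon>\<^sup>2"] e by auto
  from v(2) have "L2_norm S (\<lambda>t. h t - v t) < \<epsilon>"
    using e real_sqrt_less_mono[OF v(2)] by (simp add: L2_norm_def)
  moreover obtain n :: nat and b c where "\<forall>k<n. \<exists>z. eigenfunction S T z (b k)" "\<And>t. v t = (\<Sum>k<n. c k * b k t)"
    by (rule eigen_spanE[OF v(1)]) auto
  ultimately show "\<exists>(n::nat) (c :: nat \<Rightarrow> complex) b. (\<forall>k<n. \<exists>z. eigenfunction S T z (b k)) \<and> L2_norm S (\<lambda>t. h t - (\<Sum>k<n. c k * b k t)) < \<epsilon>"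
    by (intro exI[of _ n] exI[of _ c] exI[of _ b] conjI) simp_all
qed

section \<open>The momentum operator as a pair of boundary value problems\<close>

lemma two_intervals_disjoint:
  assumes "1 < (\<alpha>::real)"
  shows "{0..1::real} \<in> sets lebesgue" "{\<alpha>..\<beta>} \<in> sets lebesgue" "{0..1} \<inter> {\<alpha>..\<beta>} = {}"
  using assms by auto

text \<open>An interval contained in the union cannot cross the gap, so a division of a subset splits into
  two divisions.\<close>

lemma absolutely_continuous_on_two_intervals_iff:
  assumes "1 < \<alpha>"
  shows "absolutely_continuous_on (two_intervals \<alpha> \<beta>) F \<longleftrightarrow>
    absolutely_continuous_on {0..1} F \<and> absolutely_continuous_on {\<alpha>..\<beta>} F"
proof (intro iffI conjI; (elim conjE)?)
  assume "absolutely_continuous_on (two_intervals \<alpha> \<beta>) F"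
  then show "absolutely_continuous_on {0..1} F" "absolutely_continuous_on {\<alpha>..\<beta>} F"
    by (auto simp: two_intervals_def intro: absolutely_continuous_on_subset)
next
  assume F: "absolutely_continuous_on {0..1} F" "absolutely_continuous_on {\<alpha>..\<beta>} F"
  show "absolutely_continuous_on (two_intervals \<alpha> \<beta>) F"
    unfolding absolutely_continuous_on_def
  proof (intro allI impI)
    fix e :: real assume e: "e > 0"
    then have e2: "e / 2 > 0" by simp
    obtain d1 where d1: "d1 > 0" "\<And>d. \<lbrakk>d division_of \<Union>d; \<Union>d \<subseteq> {0..1}; (\<Sum>K\<in>d. Sup K - Inf K) < d1\<rbrakk> \<Longrightarrow>
         (\<Sum>K\<in>d. cmod (F (Sup K) - F (Inf K))) < e / 2"
      by (rule absolutely_continuous_onD[OF F(1) e2]) auto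
    obtain d2 where d2: "d2 > 0" "\<And>d. \<lbrakk>d division_of \<Union>d; \<Union>d \<subseteq> {\<alpha>..\<beta>}; (\<Sum>K\<in>d. Sup K - Inf K) < d2\<rbrakk> \<Longrightarrow>
         (\<Sum>K\<in>d. cmod (F (Sup K) - F (Inf K))) < e / 2"
      by (rule absolutely_continuous_onD[OF F(2) e2]) auto
    show "\<exists>\<delta>>0. \<forall>d. d division_of \<Union> d \<and> \<Union> d \<subseteq> two_intervals \<alpha> \<beta> \<and> (\<Sum>K\<in>d. Sup K - Inf K) < \<delta> \<longrightarrow>
          (\<Sum>K\<in>d. cmod (F (Sup K) - F (Inf K))) < e"
    proof (intro exI[of _ "min d1 d2"] conjI allI impI)
      show "min d1 d2 > 0" using d1 d2 by simp
      fix d assume "d division_of \<Union> d \<and> \<Union> d \<subseteq> two_intervals \<alpha> \<beta> \<and> (\<Sum>K\<in>d. Sup K - Inf K) < min d1 d2"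
      then have d: "d division_of \<Union> d" "\<Union> d \<subseteq> two_intervals \<alpha> \<beta>" "(\<Sum>K\<in>d. Sup K - Inf K) < min d1 d2"
        by auto
      have fin: "finite d" using d(1) by blast
      define p where "p = {K\<in>d. K \<subseteq> {0..1}}"
      define q where "q = {K\<in>d. \<not> K \<subseteq> {0..1}}"
      have pq: "d = p \<union> q" "p \<inter> q = {}" by (auto simp: p_def q_def)
      have sub: "p \<subseteq> d" "q \<subseteq> d" by (auto simp: p_def q_def)
      have split: "sum h d = sum h p + sum h q" for h :: "real set \<Rightarrow> real"
        using fin pq sub by (metis finite_subset sum.union_disjoint)
      have len: "Sup K - Inf K \<ge> 0" if K: "K \<in> d" for K
        by (rule division_of_real_interval[OF d(1) K]) simp
      have "K \<subseteq> {\<alpha>..\<beta>}" if K: "K \<in> q" for K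
      proof -
        have Kd: "K \<in> d" using K by (simp add: q_def)
        obtain u v where uv: "K = {u..v}" "u \<le> v"
          by (rule division_of_real_interval[OF d(1) Kd])
        have KS: "{u..v} \<subseteq> two_intervals \<alpha> \<beta>" using d(2) Kd uv by blast
        then have mem: "t \<in> two_intervals \<alpha> \<beta>" if "u \<le> t" "t \<le> v" for t using that by auto
        \<comment> \<open>Otherwise the interval would contain a point of the gap.\<close>
        have "\<not> (u \<le> 1 \<and> 1 < v)"
        proof
          assume "u \<le> 1 \<and> 1 < v"
          then have "min v ((1 + \<alpha>) / 2) \<in> two_intervals \<alpha> \<beta>"
            using assms by (intro mem) auto
          then show False
            using \<open>u \<le> 1 \<and> 1 < v\<close> assms by (auto simp: two_intervals_def min_def split: if_splits)
        qed
        moreover have "\<not> {u..v} \<subseteq> {0..1}" using K uv by (auto simp: q_def)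
        moreover have "u \<in> two_intervals \<alpha> \<beta>" "v \<in> two_intervals \<alpha> \<beta>" using mem uv by auto
        ultimately show ?thesis
          using uv assms by (auto simp: two_intervals_def)
      qed
      then have "\<Union> q \<subseteq> {\<alpha>..\<beta>}" by blast
      moreover have "\<Union> p \<subseteq> {0..1}" by (auto simp: p_def)
      moreover have "p division_of \<Union> p" "q division_of \<Union> q"
        using division_of_subset[OF d(1)] sub by auto
      moreover have "(\<Sum>K\<in>p. Sup K - Inf K) < d1" "(\<Sum>K\<in>q. Sup K - Inf K) < d2"
      proof -
        have "(\<Sum>K\<in>p. Sup K - Inf K) \<ge> 0" "(\<Sum>K\<in>q. Sup K - Inf K) \<ge> 0"
          using len sub by (auto intro!: sum_nonneg)
        then show "(\<Sum>K\<in>p. Sup K - Inf K) < d1" "(\<Sum>K\<in>q. Sup K - Inf K) < d2"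
          using d(3) split[of "\<lambda>K. Sup K - Inf K"] by auto
      qed
      ultimately have "(\<Sum>K\<in>p. cmod (F (Sup K) - F (Inf K))) < e / 2"
          "(\<Sum>K\<in>q. cmod (F (Sup K) - F (Inf K))) < e / 2"
        using d1(2)[of p] d2(2)[of q] by auto
      then show "(\<Sum>K\<in>d. cmod (F (Sup K) - F (Inf K))) < e"
        unfolding split by simp
    qed
  qed
qed

lemma at_within_two_intervals:
  assumes "1 < \<alpha>"
  shows "t \<in> {0..1} \<Longrightarrow> at t within two_intervals \<alpha> \<beta> = at t within {0..1}"
    and "t \<in> {\<alpha>..\<beta>} \<Longrightarrow> at t within two_intervals \<alpha> \<beta> = at t within {\<alpha>..\<beta>}"
proof -
  show "at t within two_intervals \<alpha> \<beta> = at t within {0..1}" if "t \<in> {0..1}"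
    by (rule at_within_nhd[where S = "{..<\<alpha>}"]) (use assms that in \<open>auto simp: two_intervals_def\<close>)
  show "at t within two_intervals \<alpha> \<beta> = at t within {\<alpha>..\<beta>}" if "t \<in> {\<alpha>..\<beta>}"
    by (rule at_within_nhd[where S = "{1<..}"]) (use assms that in \<open>auto simp: two_intervals_def\<close>)
qed

lemma boundary_matrix_condition:
  "boundary_matrix 1 \<phi> \<psi> \<theta> *v vector [x, y] = vector [x', y'] \<longleftrightarrow>
    x' = unit_exp \<phi> * x \<and> y' = unit_exp (\<theta> - \<phi>) * y"
  by (auto simp: boundary_matrix_def matrix_vector_mult_def vec_eq_iff forall_2 sum_2)

text \<open>The two components are separated, so that derivatives within the union are derivatives within the
  components; by their uniqueness \<open>g\<close> equals the momentum of \<open>F\<close> almost everywhere if and only if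
  \<open>F\<close> has the derivative \<open>2 \<pi> \<i> g\<close> almost everywhere.\<close>

lemma momentum_graph_iff:
  assumes "1 < \<alpha>" "\<alpha> < \<beta>"
  shows "(f, g) \<in> P_op \<alpha> \<beta> (boundary_matrix 1 \<phi> \<psi> \<theta>) \<longleftrightarrow>
    f \<in> L2 (two_intervals \<alpha> \<beta>) \<and> g \<in> L2 (two_intervals \<alpha> \<beta>) \<and>
    (\<exists>F. ae_eq (two_intervals \<alpha> \<beta>) f F \<and>
       bvp 0 1 (unit_exp \<phi>) F g \<and> bvp \<alpha> \<beta> (unit_exp (\<theta> - \<phi>)) F g)"
    (is "_ \<longleftrightarrow> _ \<and> _ \<and> (\<exists>F. ?R F)")
proof -
  define S where "S = two_intervals \<alpha> \<beta>"
  define p :: complex where "p = \<i> * 2 * of_real pi"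
  have p: "p \<noteq> 0" by (simp add: p_def)
  note components = two_intervals_disjoint[OF assms(1)]
  have AE_S: "(AE t in lebesgue_on S. Q t) \<longleftrightarrow>
      (AE t in lebesgue_on {0..1}. Q t) \<and> (AE t in lebesgue_on {\<alpha>..\<beta>}. Q t)" for Q
    unfolding S_def two_intervals_def by (rule AE_lebesgue_on_Un[OF components(1,2)])
  have deriv_S: "(AE t in lebesgue_on S. (F has_vector_derivative f' t) (at t within S)) \<longleftrightarrow>
      (AE t in lebesgue_on {0..1}. (F has_vector_derivative f' t) (at t within {0..1})) \<and>
      (AE t in lebesgue_on {\<alpha>..\<beta>}. (F has_vector_derivative f' t) (at t within {\<alpha>..\<beta>}))" for F f'
    unfolding AE_S unfolding S_def
    by (intro arg_cong2[of _ _ _ _ "(\<and>)"] AE_cong) (simp_all add: at_within_two_intervals[OF assms(1)])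
  have ac: "absolutely_continuous_on S F \<and>
        (AE t in lebesgue_on S. (F has_vector_derivative f' t) (at t within S)) \<longleftrightarrow>
      ac_derivative 0 1 F f' \<and> ac_derivative \<alpha> \<beta> F f'" for F f'
    unfolding deriv_S ac_derivative_def unfolding S_def
    by (auto simp: absolutely_continuous_on_two_intervals_iff[OF assms(1)])
  have nontriv: "at t within S \<noteq> bot" if "t \<in> S" for t
  proof -
    have "t islimpt S"
      using that assms by (auto simp: S_def two_intervals_def islimpt_Un)
    then show ?thesis by (simp add: trivial_limit_within)
  qed
  have momentum_eq: "AE t in lebesgue_on S. momentum S F t = f' t / p"
    if "AE t in lebesgue_on S. (F has_vector_derivative f' t) (at t within S)" for F f'
    using that AE_space
  proof eventually_elim
    case (elim t)
    then have "t \<in> S" by simp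
    then show ?case
      using vector_derivative_within[OF nontriv elim(1)] by (simp add: momentum_def p_def)
  qed
  have "(f, g) \<in> P_op \<alpha> \<beta> (boundary_matrix 1 \<phi> \<psi> \<theta>) \<longleftrightarrow> f \<in> L2 S \<and> g \<in> L2 S \<and>
      (\<exists>F\<in>momentum_domain S. F 0 = unit_exp \<phi> * F 1 \<and> F \<alpha> = unit_exp (\<theta> - \<phi>) * F \<beta> \<and>
         ae_eq S f F \<and> ae_eq S g (momentum S F))"
    by (auto simp: P_op_def operator_graph_def P_domain_def boundary_matrix_condition S_def)
  also have "\<dots> \<longleftrightarrow> f \<in> L2 S \<and> g \<in> L2 S \<and> (\<exists>F. ?R F)"
  proof (intro conj_cong refl)
    assume g: "g \<in> L2 S"
    have "F \<in> momentum_domain S \<and> ae_eq S g (momentum S F) \<longleftrightarrow>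
        ac_derivative 0 1 F (\<lambda>t. p * g t) \<and> ac_derivative \<alpha> \<beta> F (\<lambda>t. p * g t)" for F
    proof
      assume F: "F \<in> momentum_domain S \<and> ae_eq S g (momentum S F)"
      then obtain f' where f': "absolutely_continuous_on S F"
        "AE t in lebesgue_on S. (F has_vector_derivative f' t) (at t within S)"
        by (auto simp: momentum_domain_def)
      have "AE t in lebesgue_on S. g t = momentum S F t" using F by (simp add: ae_eq_def)
      then have "AE t in lebesgue_on S. (F has_vector_derivative p * g t) (at t within S)"
        using momentum_eq[OF f'(2)] f'(2)
      proof eventually_elim
        case (elim t)
        then have "p * g t = f' t" using p by simp
        then show ?case using elim by simp
      qed
      with f'(1) show "ac_derivative 0 1 F (\<lambda>t. p * g t) \<and> ac_derivative \<alpha> \<beta> F (\<lambda>t. p * g t)"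
        unfolding ac[symmetric] by simp
    next
      assume "ac_derivative 0 1 F (\<lambda>t. p * g t) \<and> ac_derivative \<alpha> \<beta> F (\<lambda>t. p * g t)"
      then have F: "absolutely_continuous_on S F"
        "AE t in lebesgue_on S. (F has_vector_derivative p * g t) (at t within S)"
        unfolding ac[symmetric] by simp_all
      have "F \<in> momentum_domain S"
        unfolding momentum_domain_def
        by (intro CollectI conjI bexI[of _ "\<lambda>t. p * g t"] F L2_cmult[OF g])
      moreover have "ae_eq S g (momentum S F)"
        using momentum_eq[OF F(2)] p unfolding ae_eq_def by (auto elim: eventually_mono)
      ultimately show "F \<in> momentum_domain S \<and> ae_eq S g (momentum S F)" by simp
    qed
    then show "(\<exists>F\<in>momentum_domain S. F 0 = unit_exp \<phi> * F 1 \<and> F \<alpha> = unit_exp (\<theta> - \<phi>) * F \<beta> \<and>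
         ae_eq S f F \<and> ae_eq S g (momentum S F)) \<longleftrightarrow> (\<exists>F. ?R F)"
      unfolding bvp_def S_def[symmetric] p_def[symmetric] Bex_def by blast
  qed
  finally show ?thesis unfolding S_def .
qed

section \<open>The case of a diagonal boundary matrix\<close>

locale diagonal_boundary_condition =
  fixes \<alpha> \<beta> \<phi> \<psi> \<theta> :: real
  assumes \<alpha>: "1 < \<alpha>" and \<alpha>\<beta>: "\<alpha> < \<beta>"
begin

abbreviation S :: "real set" where "S \<equiv> two_intervals \<alpha> \<beta>"
abbreviation P :: l2_op where "P \<equiv> P_op \<alpha> \<beta> (boundary_matrix 1 \<phi> \<psi> \<theta>)"
abbreviation \<Lambda>1 :: "real set" where "\<Lambda>1 \<equiv> Lambda1 \<phi>"
abbreviation \<Lambda>2 :: "real set" where "\<Lambda>2 \<equiv> Lambda2 \<alpha> \<beta> \<phi> \<theta>"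

definition wave1 :: "complex \<Rightarrow> real \<Rightarrow> complex" where
  "wave1 z t = indicator {0..1} t * wave (z * of_real t)"
definition wave2 :: "complex \<Rightarrow> real \<Rightarrow> complex" where
  "wave2 z t = indicator {\<alpha>..\<beta>} t * wave (z * of_real t)"

lemmas graph_iff = momentum_graph_iff[OF \<alpha> \<alpha>\<beta>, of _ _ \<phi> \<psi> \<theta>]
lemmas components = two_intervals_disjoint[OF \<alpha>]

lemma wave12:
  "t \<in> {0..1} \<Longrightarrow> wave1 z t = wave (z * of_real t)" "t \<in> {0..1} \<Longrightarrow> wave2 z t = 0"
  "t \<in> {\<alpha>..\<beta>} \<Longrightarrow> wave2 z t = wave (z * of_real t)" "t \<in> {\<alpha>..\<beta>} \<Longrightarrow> wave1 z t = 0"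
  using \<alpha> by (auto simp: wave1_def wave2_def)

lemma L2_S_iff: "f \<in> L2 S \<longleftrightarrow> f \<in> L2 {0..1} \<and> f \<in> L2 {\<alpha>..\<beta>}"
  unfolding two_intervals_def by (rule L2_Un_iff[OF components(1,2)])

lemma AE_S_iff: "(AE t in lebesgue_on S. Q t) \<longleftrightarrow>
    (AE t in lebesgue_on {0..1}. Q t) \<and> (AE t in lebesgue_on {\<alpha>..\<beta>}. Q t)"
  unfolding two_intervals_def by (rule AE_lebesgue_on_Un[OF components(1,2)])

lemma ae_eq_S_iff: "ae_eq S f g \<longleftrightarrow> ae_eq {0..1} f g \<and> ae_eq {\<alpha>..\<beta>} f g"
  unfolding ae_eq_def by (rule AE_S_iff)

lemma integral_S:
  fixes f :: "real \<Rightarrow> 'b::{banach, second_countable_topology}"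
  assumes "integrable (lebesgue_on S) f"
  shows "integral\<^sup>L (lebesgue_on S) f = integral\<^sup>L (lebesgue_on {0..1}) f + integral\<^sup>L (lebesgue_on {\<alpha>..\<beta>}) f"
  using integral_lebesgue_on_Un(3)[OF components(1,2,3)] assms by (simp add: two_intervals_def)

lemma piecewise_continuous_L2:
  assumes "continuous_on {0..1} f" "continuous_on {\<alpha>..\<beta>} f"
  shows "f \<in> L2 S"
  using assms by (simp add: L2_S_iff continuous_imp_L2)

lemma wave12_L2: "(\<lambda>t. K1 * wave1 z t + K2 * wave2 z t) \<in> L2 S"
proof (rule piecewise_continuous_L2)
  have c: "continuous_on A (\<lambda>t. K * wave (z * of_real t))" for A :: "real set" and K
    by (intro continuous_intros)
  show "continuous_on {0..1} (\<lambda>t. K1 * wave1 z t + K2 * wave2 z t)"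
    by (rule continuous_on_eq[OF c[of _ K1]]) (simp add: wave12)
  show "continuous_on {\<alpha>..\<beta>} (\<lambda>t. K1 * wave1 z t + K2 * wave2 z t)"
    by (rule continuous_on_eq[OF c[of _ K2]]) (simp add: wave12)
qed

lemma norm_boundary: "cmod (unit_exp \<phi>) = 1" "cmod (unit_exp (\<theta> - \<phi>)) = 1"
  by simp_all

lemma resonance1: "unit_exp \<phi> * wave (z * of_real (1 - 0)) = 1 \<longleftrightarrow> z \<in> of_real ` \<Lambda>1"
proof -
  have "unit_exp \<phi> * wave (z * of_real (1 - 0)) = wave (of_real \<phi> + z)"
    by (simp add: unit_exp_eq_wave wave_add)
  also have "\<dots> = 1 \<longleftrightarrow> (\<exists>n::int. z = of_real (- \<phi> + of_int n))"
    unfolding wave_eq_1_iff by (intro ex_cong1) (auto simp: algebra_simps)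
  finally show ?thesis unfolding Lambda1_def by blast
qed

lemma resonance2: "unit_exp (\<theta> - \<phi>) * wave (z * of_real (\<beta> - \<alpha>)) = 1 \<longleftrightarrow> z \<in> of_real ` \<Lambda>2"
proof -
  have "unit_exp (\<theta> - \<phi>) * wave (z * of_real (\<beta> - \<alpha>)) = wave (of_real (\<theta> - \<phi>) + z * of_real (\<beta> - \<alpha>))"
    by (simp add: unit_exp_eq_wave wave_add)
  also have "\<dots> = 1 \<longleftrightarrow> (\<exists>n::int. z = of_real ((\<phi> - \<theta>) / (\<beta> - \<alpha>) + 1 / (\<beta> - \<alpha>) * of_int n))"
    unfolding wave_eq_1_iff
  proof (intro ex_cong1)
    fix n :: int
    define L where "L = complex_of_real (\<beta> - \<alpha>)"
    have L: "L \<noteq> 0" using \<alpha>\<beta> by (simp add: L_def)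
    have l: "of_real ((\<phi> - \<theta>) / (\<beta> - \<alpha>) + 1 / (\<beta> - \<alpha>) * of_int n) = (of_real (\<phi> - \<theta>) + of_int n) / L"
      by (simp add: L_def add_divide_distrib)
    show "of_real (\<theta> - \<phi>) + z * of_real (\<beta> - \<alpha>) = of_int n \<longleftrightarrow>
        z = of_real ((\<phi> - \<theta>) / (\<beta> - \<alpha>) + 1 / (\<beta> - \<alpha>) * of_int n)"
      unfolding l L_def[symmetric] using L by (simp add: eq_divide_eq) (auto simp: algebra_simps)
  qed
  finally show ?thesis unfolding Lambda2_def by blast
qed

lemma P_subset: "P \<subseteq> L2 S \<times> L2 S"
  using graph_iff by auto

lemma P_ae_closed:
  assumes "(f, g) \<in> P" and L2: "f' \<in> L2 S" "g' \<in> L2 S" and eq: "ae_eq S f' f" "ae_eq S g' g"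
  shows "(f', g') \<in> P"
proof -
  obtain F where F: "ae_eq S f F" "bvp 0 1 (unit_exp \<phi>) F g" "bvp \<alpha> \<beta> (unit_exp (\<theta> - \<phi>)) F g"
    using assms(1) by (auto simp: graph_iff)
  have "ae_eq S f' F"
    using eq(1) F(1) unfolding ae_eq_def by eventually_elim simp
  moreover have "AE t in lebesgue_on {0..1}. g' t = g t" "AE t in lebesgue_on {\<alpha>..\<beta>}. g' t = g t"
    using eq(2) by (auto simp: ae_eq_S_iff, auto simp: ae_eq_def)
  ultimately show ?thesis
    unfolding graph_iff using L2 \<alpha>\<beta> bvp_cong[OF F(2), of F g'] bvp_cong[OF F(3), of F g'] by auto
qed

lemma P_add:
  assumes "(f, g) \<in> P" "(f', g') \<in> P"
  shows "(\<lambda>t. f t + f' t, \<lambda>t. g t + g' t) \<in> P"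
proof -
  obtain F where F: "ae_eq S f F" "bvp 0 1 (unit_exp \<phi>) F g" "bvp \<alpha> \<beta> (unit_exp (\<theta> - \<phi>)) F g"
    using assms(1) by (auto simp: graph_iff)
  obtain F' where F': "ae_eq S f' F'" "bvp 0 1 (unit_exp \<phi>) F' g'" "bvp \<alpha> \<beta> (unit_exp (\<theta> - \<phi>)) F' g'"
    using assms(2) by (auto simp: graph_iff)
  have "ae_eq S (\<lambda>t. f t + f' t) (\<lambda>t. F t + F' t)"
    using F(1) F'(1) unfolding ae_eq_def by eventually_elim simp
  moreover have "(\<lambda>t. f t + f' t) \<in> L2 S" "(\<lambda>t. g t + g' t) \<in> L2 S"
    using P_subset assms by (auto intro!: L2_add)
  ultimately show ?thesis
    unfolding graph_iff using bvp_add F(2,3) F'(2,3) by blast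
qed

lemma P_cmult:
  assumes "(f, g) \<in> P"
  shows "(\<lambda>t. K * f t, \<lambda>t. K * g t) \<in> P"
proof -
  obtain F where F: "ae_eq S f F" "bvp 0 1 (unit_exp \<phi>) F g" "bvp \<alpha> \<beta> (unit_exp (\<theta> - \<phi>)) F g"
    using assms(1) by (auto simp: graph_iff)
  have "ae_eq S (\<lambda>t. K * f t) (\<lambda>t. K * F t)"
    using F(1) unfolding ae_eq_def by eventually_elim simp
  moreover have "(\<lambda>t. K * f t) \<in> L2 S" "(\<lambda>t. K * g t) \<in> L2 S"
    using P_subset assms by (auto intro!: L2_cmult)
  ultimately show ?thesis
    unfolding graph_iff using bvp_cmult F(2,3) by blast
qed

text \<open>Replacing \<open>f\<close> and \<open>k\<close> by their absolutely continuous representatives, the difference of the two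
  sides is a sum of the integrals in \<open>bvp_symmetric\<close>.\<close>

lemma P_symmetric:
  assumes f: "(f, f') \<in> P" and k: "(k, k') \<in> P"
  shows "L2_inner S f' k = L2_inner S f k'"
proof -
  obtain F where F: "ae_eq S f F" "bvp 0 1 (unit_exp \<phi>) F f'" "bvp \<alpha> \<beta> (unit_exp (\<theta> - \<phi>)) F f'"
    using f by (auto simp: graph_iff)
  obtain G where G: "ae_eq S k G" "bvp 0 1 (unit_exp \<phi>) G k'" "bvp \<alpha> \<beta> (unit_exp (\<theta> - \<phi>)) G k'"
    using k by (auto simp: graph_iff)
  have L2: "f \<in> L2 S" "f' \<in> L2 S" "k \<in> L2 S" "k' \<in> L2 S"
    using P_subset f k by auto
  define d where "d t = f' t * cnj (k t) - f t * cnj (k' t)" for t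
  have d: "integrable (lebesgue_on S) d"
    unfolding d_def using L2 by (intro Bochner_Integration.integrable_diff L2_inner_integrable)
  have zero: "integral\<^sup>L (lebesgue_on {a..b}) d = 0"
    if "a \<le> b" "cmod c = 1" "bvp a b c F f'" "bvp a b c G k'" "ae_eq {a..b} f F" "ae_eq {a..b} k G"
      "integrable (lebesgue_on {a..b}) d" for a b c
  proof -
    have I: "((\<lambda>t. f' t * cnj (G t) - F t * cnj (k' t)) has_integral 0) {a..b}"
      by (rule bvp_symmetric[OF that(1-4)])
    have "AE t in lebesgue_on {a..b}. d t = f' t * cnj (G t) - F t * cnj (k' t)"
      using that(5,6) unfolding ae_eq_def d_def by eventually_elim simp
    then obtain N where "negligible N" "\<And>t. t \<in> {a..b} - N \<Longrightarrow> d t = f' t * cnj (G t) - F t * cnj (k' t)"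
      by (auto simp: AE_lebesgue_on_iff_negligible)
    then have "(d has_integral 0) {a..b}"
      using has_integral_spike[OF _ _ I] by blast
    then show ?thesis
      using lebesgue_integral_eq_integral[OF that(7)] by (simp add: integral_unique)
  qed
  have parts: "integrable (lebesgue_on {0..1}) d" "integrable (lebesgue_on {\<alpha>..\<beta>}) d"
    using integral_lebesgue_on_Un(1,2)[OF components(1,2,3)] d by (simp_all add: two_intervals_def)
  have "integral\<^sup>L (lebesgue_on S) d = 0"
    using integral_S[OF d] zero[OF _ norm_boundary(1) F(2) G(2) _ _ parts(1)]
      zero[OF _ norm_boundary(2) F(3) G(3) _ _ parts(2)] F(1) G(1) \<alpha>\<beta>
    by (simp add: ae_eq_S_iff)
  then show ?thesis
    unfolding d_def L2_inner_def using L2 by (simp add: L2_inner_integrable)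
qed

text \<open>The two boundary value problems are solved separately, and the solutions are glued across the gap.\<close>

lemma P_onto:
  assumes h: "h \<in> L2 S" and z: "z \<notin> of_real ` (\<Lambda>1 \<union> \<Lambda>2)"
  shows "\<exists>(f, g)\<in>P. ae_eq S (\<lambda>t. g t - z * f t) h"
proof -
  have nonres: "unit_exp \<phi> * wave (z * of_real (1 - 0)) \<noteq> 1"
      "unit_exp (\<theta> - \<phi>) * wave (z * of_real (\<beta> - \<alpha>)) \<noteq> 1"
    using z unfolding resonance1 resonance2 by auto
  have hJ: "h \<in> L2 {0..1}" "h \<in> L2 {\<alpha>..\<beta>}" using h by (auto simp: L2_S_iff)
  obtain F1 where F1: "bvp 0 1 (unit_exp \<phi>) F1 (\<lambda>t. z * F1 t + h t)"
    by (rule bvp_solvable[OF _ hJ(1) nonres(1)]) auto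
  obtain F2 where F2: "bvp \<alpha> \<beta> (unit_exp (\<theta> - \<phi>)) F2 (\<lambda>t. z * F2 t + h t)"
    by (rule bvp_solvable[OF _ hJ(2) nonres(2)]) (use \<alpha>\<beta> in auto)
  define F where "F t = (if t \<le> 1 then F1 t else F2 t)" for t
  have F: "bvp 0 1 (unit_exp \<phi>) F (\<lambda>t. z * F t + h t)"
    by (rule bvp_cong[OF F1]) (auto simp: F_def intro: AE_I2)
  have F': "bvp \<alpha> \<beta> (unit_exp (\<theta> - \<phi>)) F (\<lambda>t. z * F t + h t)"
    by (rule bvp_cong[OF F2]) (use \<alpha> \<alpha>\<beta> in \<open>auto simp: F_def intro: AE_I2\<close>)
  have FL: "F \<in> L2 S"
    using F F' by (intro piecewise_continuous_L2 bvp_continuous_on)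
  have "(F, \<lambda>t. z * F t + h t) \<in> P"
    unfolding graph_iff
    by (intro conjI exI[of _ F] FL L2_add L2_cmult h F F') (simp add: ae_eq_def)
  moreover have "ae_eq S (\<lambda>t. (z * F t + h t) - z * F t) h"
    by (simp add: ae_eq_def)
  ultimately show ?thesis
    by (intro bexI[of _ "(F, \<lambda>t. z * F t + h t)"]) simp_all
qed

lemma P_resolvent:
  assumes z: "z \<notin> of_real ` (\<Lambda>1 \<union> \<Lambda>2)"
  shows "z \<in> resolvent_set S P"
proof -
  have nonres: "unit_exp \<phi> * wave (z * of_real (1 - 0)) \<noteq> 1"
      "unit_exp (\<theta> - \<phi>) * wave (z * of_real (\<beta> - \<alpha>)) \<noteq> 1"
    using z unfolding resonance1 resonance2 by auto
  obtain D1 where D1: "D1 \<ge> 0"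
    "\<And>f g F. \<lbrakk>f \<in> L2 {0..1}; g \<in> L2 {0..1}; ae_eq {0..1} f F; bvp 0 1 (unit_exp \<phi>) F g\<rbrakk> \<Longrightarrow>
       integral\<^sup>L (lebesgue_on {0..1}) (\<lambda>t. (cmod (f t))\<^sup>2)
         \<le> D1 * integral\<^sup>L (lebesgue_on {0..1}) (\<lambda>t. (cmod (g t - z * f t))\<^sup>2)"
    by (rule bvp_L2_bound[OF _ norm_boundary(1) nonres(1)]) auto
  obtain D2 where D2: "D2 \<ge> 0"
    "\<And>f g F. \<lbrakk>f \<in> L2 {\<alpha>..\<beta>}; g \<in> L2 {\<alpha>..\<beta>}; ae_eq {\<alpha>..\<beta>} f F; bvp \<alpha> \<beta> (unit_exp (\<theta> - \<phi>)) F g\<rbrakk> \<Longrightarrow>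
       integral\<^sup>L (lebesgue_on {\<alpha>..\<beta>}) (\<lambda>t. (cmod (f t))\<^sup>2)
         \<le> D2 * integral\<^sup>L (lebesgue_on {\<alpha>..\<beta>}) (\<lambda>t. (cmod (g t - z * f t))\<^sup>2)"
    by (rule bvp_L2_bound[OF \<alpha>\<beta> norm_boundary(2) nonres(2)]) auto
  have "L2_norm S f \<le> sqrt (max D1 D2) * L2_norm S (\<lambda>t. g t - z * f t)" if fg: "(f, g) \<in> P" for f g
  proof -
    obtain F where F: "ae_eq S f F" "bvp 0 1 (unit_exp \<phi>) F g" "bvp \<alpha> \<beta> (unit_exp (\<theta> - \<phi>)) F g"
      using fg by (auto simp: graph_iff)
    have L2: "f \<in> L2 S" "g \<in> L2 S" using P_subset fg by auto
    have hL2: "(\<lambda>t. g t - z * f t) \<in> L2 S" by (intro L2_diff L2_cmult L2)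
    have "integral\<^sup>L (lebesgue_on S) (\<lambda>t. (cmod (f t))\<^sup>2)
        = integral\<^sup>L (lebesgue_on {0..1}) (\<lambda>t. (cmod (f t))\<^sup>2) + integral\<^sup>L (lebesgue_on {\<alpha>..\<beta>}) (\<lambda>t. (cmod (f t))\<^sup>2)"
      using L2 by (intro integral_S) (simp add: L2_def)
    also have "\<dots> \<le> max D1 D2 * integral\<^sup>L (lebesgue_on {0..1}) (\<lambda>t. (cmod (g t - z * f t))\<^sup>2)
         + max D1 D2 * integral\<^sup>L (lebesgue_on {\<alpha>..\<beta>}) (\<lambda>t. (cmod (g t - z * f t))\<^sup>2)"
    proof (rule add_mono)
      show "integral\<^sup>L (lebesgue_on {0..1}) (\<lambda>t. (cmod (f t))\<^sup>2)
          \<le> max D1 D2 * integral\<^sup>L (lebesgue_on {0..1}) (\<lambda>t. (cmod (g t - z * f t))\<^sup>2)"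
        using L2 F by (intro order_trans[OF D1(2)[of f g F]] mult_right_mono) (auto simp: L2_S_iff ae_eq_S_iff)
      show "integral\<^sup>L (lebesgue_on {\<alpha>..\<beta>}) (\<lambda>t. (cmod (f t))\<^sup>2)
          \<le> max D1 D2 * integral\<^sup>L (lebesgue_on {\<alpha>..\<beta>}) (\<lambda>t. (cmod (g t - z * f t))\<^sup>2)"
        using L2 F by (intro order_trans[OF D2(2)[of f g F]] mult_right_mono) (auto simp: L2_S_iff ae_eq_S_iff)
    qed
    also have "\<dots> = max D1 D2 * integral\<^sup>L (lebesgue_on S) (\<lambda>t. (cmod (g t - z * f t))\<^sup>2)"
      using integral_S[of "\<lambda>t. (cmod (g t - z * f t))\<^sup>2"] hL2 by (simp add: L2_def distrib_left)
    finally show ?thesis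
      unfolding L2_norm_def real_sqrt_mult[symmetric] by (rule real_sqrt_le_mono)
  qed
  then show ?thesis
    unfolding resolvent_set_def using P_onto[OF _ z] by blast
qed

text \<open>The homogeneous problems on the two intervals are independent of each other, and each has a
  nonzero solution only at resonance.\<close>

lemma eigenspace_iff:
  "f \<in> eigenspace P z \<longleftrightarrow> f \<in> L2 S \<and>
     (\<exists>K1 K2. ae_eq S f (\<lambda>t. K1 * wave1 z t + K2 * wave2 z t) \<and>
        (K1 \<noteq> 0 \<longrightarrow> z \<in> of_real ` \<Lambda>1) \<and> (K2 \<noteq> 0 \<longrightarrow> z \<in> of_real ` \<Lambda>2))"
  (is "_ \<longleftrightarrow> _ \<and> ?R")
proof (intro iffI conjI; (elim conjE exE)?)
  assume f: "f \<in> eigenspace P z"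
  then have fP: "(f, \<lambda>t. z * f t) \<in> P" by (simp add: eigenspace_def)
  then show "f \<in> L2 S" using P_subset by auto
  obtain F where F: "ae_eq S f F" "bvp 0 1 (unit_exp \<phi>) F (\<lambda>t. z * f t)"
      "bvp \<alpha> \<beta> (unit_exp (\<theta> - \<phi>)) F (\<lambda>t. z * f t)"
    using fP by (auto simp: graph_iff)
  have FJ: "AE t in lebesgue_on {0..1}. f t = F t" "AE t in lebesgue_on {\<alpha>..\<beta>}. f t = F t"
    using F(1) by (auto simp: ae_eq_S_iff, auto simp: ae_eq_def)
  have "bvp 0 1 (unit_exp \<phi>) F (\<lambda>t. z * F t)"
  proof (rule bvp_cong[OF F(2)])
    show "AE t in lebesgue_on {0..1}. z * F t = z * f t"
      using FJ(1) by eventually_elim simp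
  qed auto
  then obtain K1 where K1: "\<And>t. t \<in> {0..1} \<Longrightarrow> F t = K1 * wave (z * of_real t)"
    "K1 \<noteq> 0 \<Longrightarrow> unit_exp \<phi> * wave (z * of_real (1 - 0)) = 1"
    by (rule bvp_homogeneous[rotated]) auto
  have "bvp \<alpha> \<beta> (unit_exp (\<theta> - \<phi>)) F (\<lambda>t. z * F t)"
  proof (rule bvp_cong[OF F(3)])
    show "AE t in lebesgue_on {\<alpha>..\<beta>}. z * F t = z * f t"
      using FJ(2) by eventually_elim simp
  qed (use \<alpha>\<beta> in auto)
  then obtain K2 where K2: "\<And>t. t \<in> {\<alpha>..\<beta>} \<Longrightarrow> F t = K2 * wave (z * of_real t)"
    "K2 \<noteq> 0 \<Longrightarrow> unit_exp (\<theta> - \<phi>) * wave (z * of_real (\<beta> - \<alpha>)) = 1"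
    by (rule bvp_homogeneous[rotated]) (use \<alpha>\<beta> in auto)
  have FK: "F t = K1 * wave1 z t + K2 * wave2 z t" if "t \<in> S" for t
    using that K1(1)[of t] K2(1)[of t] by (auto simp: two_intervals_def wave12)
  have "ae_eq S f (\<lambda>t. K1 * wave1 z t + K2 * wave2 z t)"
    using F(1) AE_space[of "lebesgue_on S"] unfolding ae_eq_def by eventually_elim (simp add: FK)
  then show ?R
    using K1(2) K2(2) unfolding resonance1 resonance2 by blast
next
  fix K1 K2
  assume f: "f \<in> L2 S" and eq: "ae_eq S f (\<lambda>t. K1 * wave1 z t + K2 * wave2 z t)"
    and K: "K1 \<noteq> 0 \<longrightarrow> z \<in> of_real ` \<Lambda>1" "K2 \<noteq> 0 \<longrightarrow> z \<in> of_real ` \<Lambda>2"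
  define F where "F t = K1 * wave1 z t + K2 * wave2 z t" for t
  have FJ: "AE t in lebesgue_on {0..1}. f t = F t" "AE t in lebesgue_on {\<alpha>..\<beta>}. f t = F t"
    using eq unfolding F_def by (auto simp: ae_eq_S_iff, auto simp: ae_eq_def)
  have "bvp 0 1 (unit_exp \<phi>) (\<lambda>t. K1 * wave (z * of_real t)) (\<lambda>t. z * (K1 * wave (z * of_real t)))"
    using K(1) by (intro bvp_wave) (unfold resonance1, blast)
  then have "bvp 0 1 (unit_exp \<phi>) F (\<lambda>t. z * f t)"
  proof (rule bvp_cong)
    show "AE t in lebesgue_on {0..1}. z * f t = z * (K1 * wave (z * of_real t))"
      using FJ(1) AE_space by eventually_elim (simp add: F_def wave12)
  qed (simp_all add: F_def wave12)
  moreover have "bvp \<alpha> \<beta> (unit_exp (\<theta> - \<phi>)) (\<lambda>t. K2 * wave (z * of_real t)) (\<lambda>t. z * (K2 * wave (z * of_real t)))"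
    using K(2) by (intro bvp_wave) (unfold resonance2, blast)
  then have "bvp \<alpha> \<beta> (unit_exp (\<theta> - \<phi>)) F (\<lambda>t. z * f t)"
  proof (rule bvp_cong)
    show "AE t in lebesgue_on {\<alpha>..\<beta>}. z * f t = z * (K2 * wave (z * of_real t))"
      using FJ(2) AE_space by eventually_elim (simp add: F_def wave12)
  qed (use \<alpha>\<beta> in \<open>simp_all add: F_def wave12\<close>)
  ultimately have "(f, \<lambda>t. z * f t) \<in> P"
    unfolding graph_iff using f L2_cmult[OF f] eq unfolding F_def[symmetric] by blast
  then show "f \<in> eigenspace P z" by (simp add: eigenspace_def)
qed

lemma wave12_unique:
  assumes "ae_eq S (\<lambda>t. K1 * wave1 z t + K2 * wave2 z t) (\<lambda>t. K1' * wave1 z t + K2' * wave2 z t)"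
  shows "K1 = K1'" "K2 = K2'"
proof -
  have eq: "AE t in lebesgue_on {0..1}. K1 * wave1 z t + K2 * wave2 z t = K1' * wave1 z t + K2' * wave2 z t"
    "AE t in lebesgue_on {\<alpha>..\<beta>}. K1 * wave1 z t + K2 * wave2 z t = K1' * wave1 z t + K2' * wave2 z t"
    using assms by (auto simp: ae_eq_S_iff, auto simp: ae_eq_def)
  obtain t where "t \<in> {0..1}" "K1 * wave1 z t + K2 * wave2 z t = K1' * wave1 z t + K2' * wave2 z t"
    by (rule AE_interval_exists[OF _ eq(1)]) auto
  then show "K1 = K1'" by (simp add: wave12)
  obtain t where "t \<in> {\<alpha>..\<beta>}" "K1 * wave1 z t + K2 * wave2 z t = K1' * wave1 z t + K2' * wave2 z t"
    by (rule AE_interval_exists[OF \<alpha>\<beta> eq(2)])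
  then show "K2 = K2'" by (simp add: wave12)
qed

lemma eigenfunction_wave1:
  assumes "z \<in> of_real ` \<Lambda>1"
  shows "eigenfunction S P z (wave1 z)"
proof -
  have "wave1 z \<in> L2 S" using wave12_L2[of 1 z 0] by simp
  moreover have "ae_eq S (wave1 z) (\<lambda>t. 1 * wave1 z t + 0 * wave2 z t)" by (simp add: ae_eq_def)
  ultimately have "wave1 z \<in> eigenspace P z"
    using assms unfolding eigenspace_iff by blast
  moreover have "\<not> ae_eq S (wave1 z) (\<lambda>t. 0)"
    using wave12_unique(1)[of 1 z 0 0 0] by auto
  ultimately show ?thesis by (simp add: eigenfunction_def)
qed

lemma eigenfunction_wave2:
  assumes "z \<in> of_real ` \<Lambda>2"
  shows "eigenfunction S P z (wave2 z)"
proof -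
  have "wave2 z \<in> L2 S" using wave12_L2[of 0 z 1] by simp
  moreover have "ae_eq S (wave2 z) (\<lambda>t. 0 * wave1 z t + 1 * wave2 z t)" by (simp add: ae_eq_def)
  ultimately have "wave2 z \<in> eigenspace P z"
    using assms unfolding eigenspace_iff by blast
  moreover have "\<not> ae_eq S (wave2 z) (\<lambda>t. 0)"
    using wave12_unique(2)[of 0 z 1 0 0] by auto
  ultimately show ?thesis by (simp add: eigenfunction_def)
qed

lemma point_spectrum_eq: "point_spectrum S P = of_real ` (\<Lambda>1 \<union> \<Lambda>2)"
proof -
  have "z \<in> of_real ` (\<Lambda>1 \<union> \<Lambda>2)" if f: "eigenfunction S P z f" for z f
  proof (rule ccontr)
    assume z: "z \<notin> of_real ` (\<Lambda>1 \<union> \<Lambda>2)"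
    obtain K1 K2 where "ae_eq S f (\<lambda>t. K1 * wave1 z t + K2 * wave2 z t)"
        "K1 \<noteq> 0 \<longrightarrow> z \<in> of_real ` \<Lambda>1" "K2 \<noteq> 0 \<longrightarrow> z \<in> of_real ` \<Lambda>2"
      using f unfolding eigenfunction_def eigenspace_iff by blast
    then have "ae_eq S f (\<lambda>t. 0)" using z by auto
    then show False using f by (simp add: eigenfunction_def)
  qed
  then show ?thesis
    using eigenfunction_wave1 eigenfunction_wave2 unfolding point_spectrum_def image_Un by blast
qed

lemma eigenfunction_L2: "eigenfunction S P z f \<Longrightarrow> f \<in> L2 S"
  using P_subset by (auto simp: eigenfunction_def eigenspace_def)

lemma spectrum_eq: "spectrum S P = of_real ` (\<Lambda>1 \<union> \<Lambda>2)"
proof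
  show "spectrum S P \<subseteq> of_real ` (\<Lambda>1 \<union> \<Lambda>2)"
    using P_resolvent unfolding spectrum_def by blast
  show "of_real ` (\<Lambda>1 \<union> \<Lambda>2) \<subseteq> spectrum S P"
    using eigenfunction_imp_spectrum eigenfunction_L2 unfolding point_spectrum_eq[symmetric]
    by (auto simp: point_spectrum_def)
qed

lemma trig_polynomial_eigen_span1:
  assumes "trig_polynomial (1 - 0) p"
  shows "(\<lambda>t. indicator {0..1} t * (unit_exp (- \<phi> * t) * p t)) \<in> eigen_span S P"
  using assms
proof induction
  case (monomial K n)
  define l where "l = - \<phi> + of_int n"
  have eq: "indicator {0..1} t * (unit_exp (- \<phi> * t) * (K * unit_exp (of_int n / (1 - 0) * t)))
      = K * wave1 (of_real l) t" for t
  proof -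
    have "unit_exp (- \<phi> * t) * unit_exp (of_int n / (1 - 0) * t) = wave (of_real l * of_real t)"
      by (simp add: l_def algebra_simps unit_exp_eq_wave flip: wave_add)
    then show ?thesis by (simp add: wave1_def mult_ac)
  qed
  have l: "of_real l \<in> complex_of_real ` \<Lambda>1"
    unfolding Lambda1_def l_def by (intro imageI) blast
  show ?case
    unfolding eq by (rule eigen_span_eigenfunction[OF eigenfunction_wave1[OF l]])
next
  case (add p q)
  then show ?case using eigen_span_add[OF add.IH] by (simp add: distrib_left)
qed

lemma trig_polynomial_eigen_span2:
  assumes "trig_polynomial (\<beta> - \<alpha>) p"
  shows "(\<lambda>t. indicator {\<alpha>..\<beta>} t * (unit_exp ((\<phi> - \<theta>) / (\<beta> - \<alpha>) * t) * p t)) \<in> eigen_span S P"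
  using assms
proof induction
  case (monomial K n)
  define l where "l = (\<phi> - \<theta>) / (\<beta> - \<alpha>) + 1 / (\<beta> - \<alpha>) * of_int n"
  have eq: "indicator {\<alpha>..\<beta>} t * (unit_exp ((\<phi> - \<theta>) / (\<beta> - \<alpha>) * t) * (K * unit_exp (of_int n / (\<beta> - \<alpha>) * t)))
      = K * wave2 (of_real l) t" for t
  proof -
    have "unit_exp ((\<phi> - \<theta>) / (\<beta> - \<alpha>) * t) * unit_exp (of_int n / (\<beta> - \<alpha>) * t)
        = unit_exp ((\<phi> - \<theta>) / (\<beta> - \<alpha>) * t + of_int n / (\<beta> - \<alpha>) * t)"
      by (rule unit_exp_add[symmetric])
    also have "\<dots> = wave (of_real l * of_real t)"
      by (simp add: l_def distrib_right unit_exp_eq_wave)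
    finally show ?thesis by (simp add: wave2_def mult_ac)
  qed
  have l: "of_real l \<in> complex_of_real ` \<Lambda>2"
    unfolding Lambda2_def l_def by (intro imageI) blast
  show ?case
    unfolding eq by (rule eigen_span_eigenfunction[OF eigenfunction_wave2[OF l]])
next
  case (add p q)
  then show ?case using eigen_span_add[OF add.IH] by (simp add: distrib_left)
qed

text \<open>The eigenfunctions lie in the domain, and \<open>P\<close> is linear.\<close>

lemma eigen_span_domain:
  assumes "v \<in> eigen_span S P"
  obtains g where "(v, g) \<in> P"
proof -
  obtain n :: nat and b c where v: "\<forall>k<n. \<exists>z. eigenfunction S P z (b k)" "\<And>t. v t = (\<Sum>k<n. c k * b k t)"
    by (rule eigen_spanE[OF assms]) auto
  have partial: "\<exists>g. (\<lambda>t. \<Sum>k<m. c k * b k t, g) \<in> P" if "m \<le> n" for m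
    using that
  proof (induction m)
    case 0
    have "(\<lambda>t. 0) \<in> eigenspace P 0"
      unfolding eigenspace_iff using wave12_L2[of 0 0 0]
      by (auto simp: ae_eq_def intro!: exI[of _ 0])
    then show ?case by (auto simp: eigenspace_def)
  next
    case (Suc m)
    then obtain g where g: "(\<lambda>t. \<Sum>k<m. c k * b k t, g) \<in> P" by auto
    have "\<exists>z. eigenfunction S P z (b m)" using v(1) Suc.prems by auto
    then obtain z where "(b m, \<lambda>t. z * b m t) \<in> P"
      unfolding eigenfunction_def eigenspace_def by blast
    from P_add[OF g P_cmult[OF this, of "c m"]] show ?case by auto
  qed
  have "v = (\<lambda>t. \<Sum>k<n. c k * b k t)" using v(2) by blast
  then show thesis using that partial[of n] by auto
qed

lemma eigen_span_dense:
  assumes h: "h \<in> L2 S" and "\<epsilon> > 0"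
  shows "\<exists>v\<in>eigen_span S P. integral\<^sup>L (lebesgue_on S) (\<lambda>t. (cmod (h t - v t))\<^sup>2) < \<epsilon>"
proof -
  have hJ: "h \<in> L2 {0..1}" "h \<in> L2 {\<alpha>..\<beta>}" using h by (auto simp: L2_S_iff)
  obtain p where p: "trig_polynomial (1 - 0) p"
    "integral\<^sup>L (lebesgue_on {0..1}) (\<lambda>t. (cmod (h t - unit_exp (- \<phi> * t) * p t))\<^sup>2) < \<epsilon> / 2"
    by (rule trig_polynomial_L2_dense[OF _ hJ(1), of "\<epsilon> / 2" "- \<phi>"]) (use \<open>\<epsilon> > 0\<close> in auto)
  obtain q where q: "trig_polynomial (\<beta> - \<alpha>) q"
    "integral\<^sup>L (lebesgue_on {\<alpha>..\<beta>}) (\<lambda>t. (cmod (h t - unit_exp ((\<phi> - \<theta>) / (\<beta> - \<alpha>) * t) * q t))\<^sup>2) < \<epsilon> / 2"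
    by (rule trig_polynomial_L2_dense[OF \<alpha>\<beta> hJ(2), of "\<epsilon> / 2" "(\<phi> - \<theta>) / (\<beta> - \<alpha>)"]) (use \<open>\<epsilon> > 0\<close> in auto)
  define v where "v t = indicator {0..1} t * (unit_exp (- \<phi> * t) * p t)
      + indicator {\<alpha>..\<beta>} t * (unit_exp ((\<phi> - \<theta>) / (\<beta> - \<alpha>) * t) * q t)" for t
  have v: "v \<in> eigen_span S P"
    unfolding v_def by (intro eigen_span_add trig_polynomial_eigen_span1 trig_polynomial_eigen_span2 p q)
  then obtain g where "(v, g) \<in> P" by (rule eigen_span_domain)
  then have "(\<lambda>t. h t - v t) \<in> L2 S" using P_subset by (intro L2_diff h) auto
  then have "integral\<^sup>L (lebesgue_on S) (\<lambda>t. (cmod (h t - v t))\<^sup>2)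
      = integral\<^sup>L (lebesgue_on {0..1}) (\<lambda>t. (cmod (h t - v t))\<^sup>2)
      + integral\<^sup>L (lebesgue_on {\<alpha>..\<beta>}) (\<lambda>t. (cmod (h t - v t))\<^sup>2)"
    by (intro integral_S) (simp add: L2_def)
  also have "integral\<^sup>L (lebesgue_on {0..1}) (\<lambda>t. (cmod (h t - v t))\<^sup>2)
      = integral\<^sup>L (lebesgue_on {0..1}) (\<lambda>t. (cmod (h t - unit_exp (- \<phi> * t) * p t))\<^sup>2)"
    using \<alpha> by (intro Bochner_Integration.integral_cong refl) (auto simp: v_def)
  also have "integral\<^sup>L (lebesgue_on {\<alpha>..\<beta>}) (\<lambda>t. (cmod (h t - v t))\<^sup>2)
      = integral\<^sup>L (lebesgue_on {\<alpha>..\<beta>}) (\<lambda>t. (cmod (h t - unit_exp ((\<phi> - \<theta>) / (\<beta> - \<alpha>) * t) * q t))\<^sup>2)"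
    using \<alpha> by (intro Bochner_Integration.integral_cong refl) (auto simp: v_def)
  finally have "integral\<^sup>L (lebesgue_on S) (\<lambda>t. (cmod (h t - v t))\<^sup>2) < \<epsilon>"
    using p(2) q(2) by linarith
  with v show ?thesis by blast
qed

lemma P_densely_defined: "densely_defined S P"
  unfolding densely_defined_def
proof (intro ballI allI impI)
  fix h and \<epsilon> :: real assume h: "h \<in> L2 S" and e: "\<epsilon> > 0"
  obtain v where v: "v \<in> eigen_span S P" "integral\<^sup>L (lebesgue_on S) (\<lambda>t. (cmod (h t - v t))\<^sup>2) < \<epsilon>\<^sup>2"
    using eigen_span_dense[OF h, of "\<epsilon>\<^sup>2"] e by auto
  obtain g where "(v, g) \<in> P" using v(1) by (rule eigen_span_domain)
  moreover have "L2_norm S (\<lambda>t. h t - v t) < \<epsilon>"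
    using e real_sqrt_less_mono[OF v(2)] by (simp add: L2_norm_def)
  ultimately show "\<exists>(f, g)\<in>P. L2_norm S (\<lambda>t. h t - f t) < \<epsilon>" by blast
qed

text \<open>Since \<open>\<Lambda>1\<close> and \<open>\<Lambda>2\<close> are real, \<open>\<i>\<close> and \<open>- \<i>\<close> are nonresonant.\<close>

lemma P_selfadjoint: "selfadjoint S P"
proof (rule selfadjointI)
  show "\<exists>(f, g)\<in>P. ae_eq S (\<lambda>t. g t - z * f t) h" if "h \<in> L2 S" "z = \<i> \<or> z = - \<i>" for h z
  proof (rule P_onto[OF that(1)])
    show "z \<notin> of_real ` (\<Lambda>1 \<union> \<Lambda>2)"
      using that(2) by (auto simp: complex_eq_iff)
  qed
qed (fact P_subset P_ae_closed P_symmetric P_densely_defined)+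

lemma P_pure_point: "has_pure_point_spectrum S P (\<Lambda>1 \<union> \<Lambda>2)"
  unfolding has_pure_point_spectrum_def
  using spectrum_eq point_spectrum_eq eigenfunctions_totalI[of S P] eigen_span_dense by blast

lemma P_multiplicity:
  assumes l: "l \<in> \<Lambda>1 \<union> \<Lambda>2"
  shows "has_multiplicity S P (of_real l) (if l \<in> \<Lambda>1 \<inter> \<Lambda>2 then 2 else 1)"
proof -
  let ?z = "complex_of_real l"
  have res: "?z \<in> of_real ` \<Lambda>1 \<longleftrightarrow> l \<in> \<Lambda>1" "?z \<in> of_real ` \<Lambda>2 \<longleftrightarrow> l \<in> \<Lambda>2"
    by auto
  have eig: "wave1 ?z \<in> eigenspace P ?z" if "l \<in> \<Lambda>1" 
    using eigenfunction_wave1[of ?z] that by (auto simp: eigenfunction_def)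
  have eig': "wave2 ?z \<in> eigenspace P ?z" if "l \<in> \<Lambda>2" 
    using eigenfunction_wave2[of ?z] that by (auto simp: eigenfunction_def)
  have coords: "\<exists>K1 K2. ae_eq S f (\<lambda>t. K1 * wave1 ?z t + K2 * wave2 ?z t) \<and>
      (K1 \<noteq> 0 \<longrightarrow> l \<in> \<Lambda>1) \<and> (K2 \<noteq> 0 \<longrightarrow> l \<in> \<Lambda>2)" if "f \<in> eigenspace P ?z" for f
    using that unfolding eigenspace_iff res by blast
  have unique: "K1 = K1' \<and> K2 = K2'"
    if "ae_eq S f (\<lambda>t. K1 * wave1 ?z t + K2 * wave2 ?z t)" "ae_eq S f (\<lambda>t. K1' * wave1 ?z t + K2' * wave2 ?z t)"
    for f K1 K2 K1' K2'
  proof -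
    have "ae_eq S (\<lambda>t. K1 * wave1 ?z t + K2 * wave2 ?z t) (\<lambda>t. K1' * wave1 ?z t + K2' * wave2 ?z t)"
      using that unfolding ae_eq_def by eventually_elim simp
    then show ?thesis using wave12_unique by blast
  qed
  consider "l \<in> \<Lambda>1" "l \<in> \<Lambda>2" | "l \<in> \<Lambda>1" "l \<notin> \<Lambda>2" | "l \<notin> \<Lambda>1" "l \<in> \<Lambda>2"
    using l by blast
  then show ?thesis
  proof cases
    case 1
    have "has_multiplicity S P ?z 2"
      by (rule has_multiplicity_2I[OF eig eig']) (use 1 coords unique in blast)+
    then show ?thesis using 1 by simp
  next
    case 2
    have "has_multiplicity S P ?z 1"
    proof (rule has_multiplicity_1I[OF eig])
      show "\<exists>K. ae_eq S f (\<lambda>t. K * wave1 ?z t)" if "f \<in> eigenspace P ?z" for f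
        using coords[OF that] 2 by auto
      show "K = K'" if "ae_eq S f (\<lambda>t. K * wave1 ?z t)" "ae_eq S f (\<lambda>t. K' * wave1 ?z t)" for f K K'
        using unique[of f K 0 K' 0] that by simp
    qed (use 2 in simp)
    then show ?thesis using 2 by simp
  next
    case 3
    have "has_multiplicity S P ?z 1"
    proof (rule has_multiplicity_1I[OF eig'])
      show "\<exists>K. ae_eq S f (\<lambda>t. K * wave2 ?z t)" if "f \<in> eigenspace P ?z" for f
        using coords[OF that] 3 by auto
      show "K = K'" if "ae_eq S f (\<lambda>t. K * wave2 ?z t)" "ae_eq S f (\<lambda>t. K' * wave2 ?z t)" for f K K'
        using unique[of f 0 K 0 K'] that by simp
    qed (use 3 in simp)
    then show ?thesis using 3 by simp
  qed
qed

end

theorem theorem3p3: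
  fixes \<alpha> \<beta> \<phi> \<psi> \<theta> :: real
  assumes "1 < \<alpha>" and "\<alpha> < \<beta>"
  shows "let S = two_intervals \<alpha> \<beta>;
             P = P_op \<alpha> \<beta> (boundary_matrix 1 \<phi> \<psi> \<theta>);
             \<Lambda>1 = Lambda1 \<phi>;
             \<Lambda>2 = Lambda2 \<alpha> \<beta> \<phi> \<theta>
         in selfadjoint S P \<and>
            has_pure_point_spectrum S P (\<Lambda>1 \<union> \<Lambda>2) \<and>
            (\<forall>n::int. eigenfunction S P (of_real (- \<phi> + of_int n))
               (\<lambda>t. indicator {0..1} t * unit_exp ((- \<phi> + of_int n) * t))) \<and>
            (\<forall>n::int. eigenfunction S P (of_real ((\<phi> - \<theta> + of_int n) / (\<beta> - \<alpha>)))
               (\<lambda>t. indicator {\<alpha>..\<beta>} t * unit_exp ((\<phi> - \<theta> + of_int n) / (\<beta> - \<alpha>) * t))) \<and>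
            (\<forall>l \<in> \<Lambda>1 \<union> \<Lambda>2.
               has_multiplicity S P (of_real l) (if l \<in> \<Lambda>1 \<inter> \<Lambda>2 then 2 else 1))"
proof -
  interpret diagonal_boundary_condition \<alpha> \<beta> \<phi> \<psi> \<theta>
    using assms by unfold_locales
  have "eigenfunction S P (of_real (- \<phi> + of_int n))
      (\<lambda>t. indicator {0..1} t * unit_exp ((- \<phi> + of_int n) * t))" for n :: int
  proof -
    have "(\<lambda>t. indicator {0..1} t * unit_exp ((- \<phi> + of_int n) * t)) = wave1 (of_real (- \<phi> + of_int n))"
      by (simp add: wave1_def unit_exp_eq_wave fun_eq_iff)
    moreover have "complex_of_real (- \<phi> + of_int n) \<in> of_real ` \<Lambda>1"
      unfolding Lambda1_def by (intro imageI) blast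
    ultimately show ?thesis by (metis eigenfunction_wave1)
  qed
  moreover have "eigenfunction S P (of_real ((\<phi> - \<theta> + of_int n) / (\<beta> - \<alpha>)))
      (\<lambda>t. indicator {\<alpha>..\<beta>} t * unit_exp ((\<phi> - \<theta> + of_int n) / (\<beta> - \<alpha>) * t))" for n :: int
  proof -
    have "(\<lambda>t. indicator {\<alpha>..\<beta>} t * unit_exp ((\<phi> - \<theta> + of_int n) / (\<beta> - \<alpha>) * t))
        = wave2 (of_real ((\<phi> - \<theta> + of_int n) / (\<beta> - \<alpha>)))"
      by (simp add: wave2_def unit_exp_eq_wave fun_eq_iff)
    moreover have "(\<phi> - \<theta> + of_int n) / (\<beta> - \<alpha>) \<in> \<Lambda>2"
      unfolding Lambda2_def by (auto simp: add_divide_distrib)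
    ultimately show ?thesis by (metis eigenfunction_wave2 imageI)
  qed
  ultimately show ?thesis
    unfolding Let_def using P_selfadjoint P_pure_point P_multiplicity by blast
qed

end
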